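(* Let $N\ge1$, $\lambda\in\mathbb{R}\setminus\{0\}$, $\frac{4}{N+2}<\alpha\le\frac4N$ ($2<\alpha\le4$ if $N=1$), let $\varphi\in L^2(\mathbb{R}^N)$ with $\varphi\not\equiv0$, and let $u$ be the corresponding solution of $$i\frac{\partial u}{\partial t}+\Delta u+\lambda|u|^\alpha u=0,\qquad u(0)=\varphi .$$ If $\alpha=\frac4N$, assume further that $u$ is positively global in time. Suppose that for every $r\in\left[2,\frac{2N}{N-2}\right)$ ($r\in[2,\infty)$ if $N=1$) there is a constant $C$ such that $$\|u(t)\|_{L^r}\le C|t|^{-N\left(\frac12-\frac1r\right)}\quad\text{for almost every }t>0 .$$ Then for every $r\in[2,\infty]$, $$\liminf_{t\to\infty}|t|^{N\left(\frac12-\frac1r\right)}\|u(t)\|_{L^r}>0 .$$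
   Context: Functions are complex-valued, $L^p=L^p(\mathbb{R}^N;\mathbb{C})$, and $\|f\|_{L^p}=\infty$ by convention if $f\notin L^p$. For $N=2$, $\frac{2N}{N-2}$ is read as $\infty$. For $0<\alpha\le\frac4N$ and $\varphi\in L^2(\mathbb{R}^N)$, the corresponding solution is the unique maximal solution $u\in C((-T_*,T^* );L^2(\mathbb{R}^N))\cap L^q_{\mathrm{loc}}((-T_*,T^* );L^{\alpha+2}(\mathbb{R}^N))$, $q=\frac{4(\alpha+2)}{N\alpha}$, of the equation with $u(0)=\varphi$; it satisfies $\|u(t)\|_{L^2}=\|\varphi\|_{L^2}$ for all $t$, and $T_*=T^*=\infty$ if $\alpha<\frac4N$. "Positively global in time" means $T^*=\infty$. *)

theory Defs
  imports "HOL-Analysis.Analysis" "HOL-Probability.Essential_Supremum"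
begin

section \<open>Lebesgue norms\<close>

definition ennreal_powr :: "ennreal \<Rightarrow> real \<Rightarrow> ennreal" where
  "ennreal_powr x p = (if x = \<infinity> then \<infinity> else ennreal (enn2real x powr p))"

text \<open>
  The exponent ranges over the extended half-line, \<open>p = \<infinity>\<close> being the essential supremum.
  Functions outside \<open>L\<^sup>p\<close>, in particular non-measurable ones, have norm \<open>\<infinity>\<close>.
\<close>

definition Lp_norm :: "ennreal \<Rightarrow> ('a::euclidean_space \<Rightarrow> complex) \<Rightarrow> ennreal" where
  "Lp_norm p f =
     (if f \<notin> borel_measurable lebesgue then \<infinity>
      else if p = \<infinity> then esssup lebesgue (\<lambda>x. ennreal (norm (f x)))
      else ennreal_powr (\<integral>\<^sup>+ x. ennreal (norm (f x) powr enn2real p) \<partial>lebesgue) (1 / enn2real p))"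

definition in_Lp :: "ennreal \<Rightarrow> ('a::euclidean_space \<Rightarrow> complex) \<Rightarrow> bool" where
  "in_Lp p f \<longleftrightarrow> Lp_norm p f < \<infinity>"

section \<open>Test functions\<close>

definition dir_deriv :: "'a::euclidean_space \<Rightarrow> ('a \<Rightarrow> complex) \<Rightarrow> 'a \<Rightarrow> complex" where
  "dir_deriv v f = (\<lambda>x. frechet_derivative f (at x) v)"

text \<open>
  Existence of all partial derivatives up to order \<open>k\<close>, each of those of order less than \<open>k\<close>
  being Frechet differentiable everywhere; for all \<open>k\<close> together this is \<open>C\<^sup>\<infinity>\<close>.
\<close>

primrec times_differentiable :: "nat \<Rightarrow> ('a::euclidean_space \<Rightarrow> complex) \<Rightarrow> bool" where
  "times_differentiable 0 f \<longleftrightarrow> continuous_on UNIV f"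
| "times_differentiable (Suc k) f \<longleftrightarrow>
     (\<forall>x. f differentiable (at x)) \<and> (\<forall>b\<in>Basis. times_differentiable k (dir_deriv b f))"

definition test_function :: "'a::euclidean_space set \<Rightarrow> ('a \<Rightarrow> complex) \<Rightarrow> bool" where
  "test_function \<Omega> \<psi> \<longleftrightarrow>
     (\<forall>k. times_differentiable k \<psi>) \<and>
     compact (closure {x. \<psi> x \<noteq> 0}) \<and> closure {x. \<psi> x \<noteq> 0} \<subseteq> \<Omega>"

definition time_deriv :: "(real \<times> 'a::euclidean_space \<Rightarrow> complex) \<Rightarrow> real \<times> 'a \<Rightarrow> complex" where
  "time_deriv \<psi> = dir_deriv (1, 0) \<psi>"

definition space_laplacian :: "(real \<times> 'a::euclidean_space \<Rightarrow> complex) \<Rightarrow> real \<times> 'a \<Rightarrow> complex" where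
  "space_laplacian \<psi> = (\<lambda>z. \<Sum>b\<in>Basis. dir_deriv (0, b) (dir_deriv (0, b) \<psi>) z)"

section \<open>The nonlinear Schrodinger equation in \<open>L\<^sup>2\<close>\<close>

text \<open>
  The equation \<open>i u\<^sub>t + \<Delta>u + \<lambda> |u|\<^sup>\<alpha> u = 0\<close> in the sense of distributions on \<open>I \<times> \<real>\<^sup>N\<close>, all
  derivatives having been moved onto the test function. The space-time pairing is written as an
  iterated integral, so that it depends on each \<open>u t\<close> only up to null sets and requires no joint
  measurability of the chosen representatives. For \<open>u\<close> in the solution class below (with
  \<open>0 < \<alpha> \<le> 4/N\<close>) the pairing converges absolutely.
\<close>

definition nls_distributional ::
    "real \<Rightarrow> real \<Rightarrow> real set \<Rightarrow> (real \<Rightarrow> 'a::euclidean_space \<Rightarrow> complex) \<Rightarrow> bool" where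
  "nls_distributional lam \<alpha> I u \<longleftrightarrow>
     (\<forall>\<psi>. test_function (I \<times> UNIV) \<psi> \<longrightarrow>
        (\<integral>t. (\<integral>x. - \<i> * u t x * time_deriv \<psi> (t, x)
                 + u t x * space_laplacian \<psi> (t, x)
                 + of_real lam * (of_real (norm (u t x) powr \<alpha>) * u t x) * \<psi> (t, x)
               \<partial>lebesgue) \<partial>lebesgue) = 0)"

definition continuous_L2 :: "real set \<Rightarrow> (real \<Rightarrow> 'a::euclidean_space \<Rightarrow> complex) \<Rightarrow> bool" where
  "continuous_L2 I u \<longleftrightarrow>
     (\<forall>t\<in>I. in_Lp 2 (u t)) \<and>
     (\<forall>t\<in>I. ((\<lambda>s. Lp_norm 2 (\<lambda>x. u s x - u t x)) \<longlongrightarrow> 0) (at t within I))"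

text \<open>
  Only the finiteness of the mixed norms is required: for \<open>u\<close> in \<open>C(I; L\<^sup>2)\<close>, the function
  \<open>t \<mapsto> \<parallel>u(t)\<parallel>\<^bsub>L^p\<^esub>\<close> is lower semicontinuous, and \<open>u\<close> is then strongly measurable into \<open>L\<^sup>p\<close>.
\<close>

definition locally_Lq_Lp ::
    "real \<Rightarrow> real \<Rightarrow> real set \<Rightarrow> (real \<Rightarrow> 'a::euclidean_space \<Rightarrow> complex) \<Rightarrow> bool" where
  "locally_Lq_Lp q p I u \<longleftrightarrow>
     (\<forall>a b. {a..b} \<subseteq> I \<longrightarrow>
        (\<integral>\<^sup>+ t \<in> {a..b}. ennreal_powr (Lp_norm (ennreal p) (u t)) q \<partial>lebesgue) < \<infinity>)"

definition nls_solution ::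
    "real \<Rightarrow> real \<Rightarrow> ('a::euclidean_space \<Rightarrow> complex) \<Rightarrow> real set \<Rightarrow> (real \<Rightarrow> 'a \<Rightarrow> complex) \<Rightarrow> bool" where
  "nls_solution lam \<alpha> \<phi> I u \<longleftrightarrow>
     continuous_L2 I u \<and>
     locally_Lq_Lp (4 * (\<alpha> + 2) / (real DIM('a) * \<alpha>)) (\<alpha> + 2) I u \<and>
     nls_distributional lam \<alpha> I u \<and>
     (AE x in lebesgue. u 0 x = \<phi> x)"

text \<open>
  The maximal existence interval is \<open>(-Tm, Tp)\<close>, where \<open>0 < Tm, Tp \<le> \<infinity>\<close>. The values of \<open>u\<close> at
  times outside this interval are irrelevant.
\<close>

definition nls_maximal_solution ::
    "real \<Rightarrow> real \<Rightarrow> ('a::euclidean_space \<Rightarrow> complex) \<Rightarrow> ereal \<Rightarrow> ereal \<Rightarrow> (real \<Rightarrow> 'a \<Rightarrow> complex) \<Rightarrow> bool" where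
  "nls_maximal_solution lam \<alpha> \<phi> Tm Tp u \<longleftrightarrow>
     0 < Tm \<and> 0 < Tp \<and>
     nls_solution lam \<alpha> \<phi> (einterval (- Tm) Tp) u \<and>
     (\<forall>Sm Sp v. Tm \<le> Sm \<and> Tp \<le> Sp \<and>
        nls_solution lam \<alpha> \<phi> (einterval (- Sm) Sp) v \<and>
        (\<forall>t\<in>einterval (- Tm) Tp. AE x in lebesgue. v t x = u t x)
        \<longrightarrow> Sm = Tm \<and> Sp = Tp)"

section \<open>Exponents\<close>

text \<open>\<open>2N/(N-2)\<close>, read as \<open>\<infinity>\<close> for \<open>N \<le> 2\<close>.\<close>

definition sobolev_exponent :: "nat \<Rightarrow> ennreal" where
  "sobolev_exponent N = (if N \<le> 2 then \<infinity> else ennreal (2 * real N / (real N - 2)))"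

text \<open>\<open>N (1/2 - 1/r)\<close>, with \<open>1/\<infinity> = 0\<close>.\<close>

definition decay_rate :: "nat \<Rightarrow> ennreal \<Rightarrow> real" where
  "decay_rate N r = real N * (1 / 2 - enn2real (1 / r))"

end

theory Submission
  imports Defs
begin

text \<open>
  The equation is tested with self-similar kernels
  \<open>k\<^sub>t(x,y) = t\<^sup>-\<^sup>N exp(-\<i>(|x|\<^sup>2 - |y|\<^sup>2)/4t) g((x+y)/2t) h((x-y)/t)\<close>, with \<open>g\<close> a wide cutoff and \<open>h\<close> a narrow
  mollifier. The quantity \<open>E(t) = \<integral>\<integral> u(x) cnj(u(y)) k\<^sub>t(x,y)\<close> is controlled by the mass of \<open>u(t)\<close> in a cone
  \<open>|x| \<le> \<rho>t\<close>, and at a fixed time it is close to the whole mass.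

  Phase and dilation are transported by the free flow, so that the linear part of the equation only
  contributes to \<open>E'\<close> the cross term in \<open>\<nabla>g \<bullet> \<nabla>h\<close>. It has size \<open>O(t\<^sup>-\<^sup>2)\<close>, with a small constant if the cutoff is
  much wider than the mollifier is narrow. The nonlinear part is at most
  \<open>\<parallel>u(t)\<parallel>\<^bsub>\<alpha>+2\<^esub>\<^sup>\<alpha>\<^sup>+\<^sup>2 = O(t\<^bsup>-N\<alpha>/2\<^esup>)\<close> up to a constant (Young's inequality); this is integrable at infinity since \<open>\<alpha> > 2/N\<close>. It also tends
  to \<open>0\<close> as the mollifier concentrates, because \<open>|u|\<^sup>\<alpha>u cnj(u)\<close> is real. By dominated convergence \<open>E\<close> stays
  bounded away from \<open>0\<close> on \<open>[t\<^sub>0,\<infinity>)\<close> for a suitable kernel: a fixed amount of mass stays in the cone, and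
  Young's inequality on the ball of radius \<open>\<rho>t\<close> turns it into lower bounds for all \<open>L\<^sup>r\<close> norms.
\<close>

section \<open>Smooth functions and bumps\<close>

text \<open>The obvious quantity, the mass of \<open>u\<close> in a moving cone, changes through the
  current Im(cnj u grad u), which has no meaning for a solution that is merely in L^2. Pulling the
  two copies of \<open>u\<close> apart, to points x and y, lets every derivative fall on the kernel.
  In the variables x+y and x-y the operator Lap_x - Lap_y is four times a mixed second derivative,
  so exactly one derivative hits the cutoff and one the mollifier; this is why a wide cutoff can pay
  for a narrow mollifier. The price is the nonlinear term. It cancels identically only on the
  diagonal x = y; after mollification a flux remains, which is small at each time separately but
  with no rate. An integrable majorant in time is therefore indispensable. Its exponent N\<alpha>/2
  is what the decay hypothesis gives at r = \<alpha>+2, and the assumed lower bound on \<alpha> is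
  what makes it exceed 1: 4/(N+2) is at least 2/N when N is at least 2, and the bound 2 equals 2/N
  when N = 1.\<close>

lemma continuous_on_if_times_differentiable_Suc:
  "times_differentiable (Suc k) f \<Longrightarrow> continuous_on UNIV f"
  by (metis UNIV_I continuous_at_imp_continuous_on differentiable_imp_continuous_within times_differentiable.simps(2))

lemma times_differentiable_SucD: "times_differentiable (Suc k) f \<Longrightarrow> times_differentiable k f"
proof (induction k arbitrary: f)
  case 0
  then show ?case using continuous_on_if_times_differentiable_Suc[of 0 f] by simp
next
  case (Suc k)
  then show ?case by (metis times_differentiable.simps(2))
qed

lemma times_differentiable_imp_continuous: "times_differentiable k f \<Longrightarrow> continuous_on UNIV f"
  by (cases k) (auto intro: continuous_on_if_times_differentiable_Suc simp del: times_differentiable.simps(2))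

definition smooth :: "('a::euclidean_space \<Rightarrow> complex) \<Rightarrow> bool" where
  "smooth f \<longleftrightarrow> (\<forall>k. times_differentiable k f)"

lemma dir_deriv_eqI:
  "(f has_derivative D) (at x) \<Longrightarrow> dir_deriv b f x = D b"
  unfolding dir_deriv_def using frechet_derivative_at by metis

lemma dir_derivI:
  assumes "\<And>x. (f has_derivative D x) (at x)"
  shows "dir_deriv b f = (\<lambda>x. D x b)"
  using assms by (intro ext dir_deriv_eqI)

lemma has_derivative_dir_deriv:
  "f differentiable (at x) \<Longrightarrow> (f has_derivative (\<lambda>v. dir_deriv v f x)) (at x)"
  unfolding dir_deriv_def by (simp add: frechet_derivative_works)

lemma times_differentiable_const: "times_differentiable k (\<lambda>x. c)"
proof (induction k arbitrary: c)
  case (Suc k)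
  have "dir_deriv b (\<lambda>x::'a. c) = (\<lambda>x. 0)" for b
    by (rule dir_derivI) (rule has_derivative_const)
  with Suc show ?case by simp
qed simp

lemma times_differentiable_add:
  "times_differentiable k f \<Longrightarrow> times_differentiable k g \<Longrightarrow> times_differentiable k (\<lambda>x. f x + g x)"
proof (induction k arbitrary: f g)
  case 0
  then show ?case by (auto intro: continuous_intros)
next
  case (Suc k)
  have "dir_deriv b (\<lambda>x. f x + g x) = (\<lambda>x. dir_deriv b f x + dir_deriv b g x)" for b
    using Suc.prems by (intro dir_derivI) (auto intro!: derivative_eq_intros has_derivative_dir_deriv)
  with Suc show ?case by simp
qed

lemma times_differentiable_mult:
  "times_differentiable k f \<Longrightarrow> times_differentiable k g \<Longrightarrow> times_differentiable k (\<lambda>x. f x * g x)"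
proof (induction k arbitrary: f g)
  case 0
  then show ?case by (auto intro: continuous_intros)
next
  case (Suc k)
  have "dir_deriv b (\<lambda>x. f x * g x) = (\<lambda>x. f x * dir_deriv b g x + dir_deriv b f x * g x)" for b
    using Suc.prems by (intro dir_derivI) (auto intro!: derivative_eq_intros has_derivative_dir_deriv)
  moreover have "times_differentiable k f" "times_differentiable k g"
    using Suc.prems by (blast intro: times_differentiable_SucD)+
  ultimately show ?case
    using Suc.prems by (auto intro!: times_differentiable_add Suc.IH)
qed

lemma smooth_const [intro!]: "smooth (\<lambda>x. c)"
  and smooth_add [intro!]: "smooth f \<Longrightarrow> smooth g \<Longrightarrow> smooth (\<lambda>x. f x + g x)"
  and smooth_mult [intro!]: "smooth f \<Longrightarrow> smooth g \<Longrightarrow> smooth (\<lambda>x. f x * g x)"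
  by (auto simp: smooth_def times_differentiable_const times_differentiable_add times_differentiable_mult)

lemma smooth_differentiable: "smooth f \<Longrightarrow> f differentiable (at x)"
  unfolding smooth_def by (metis times_differentiable.simps(2))

lemma smooth_dir_deriv: "smooth f \<Longrightarrow> b \<in> Basis \<Longrightarrow> smooth (dir_deriv b f)"
  unfolding smooth_def by (metis times_differentiable.simps(2))

lemma smooth_continuous: "smooth f \<Longrightarrow> continuous_on UNIV f"
  unfolding smooth_def using times_differentiable_imp_continuous by blast

lemma smoothI_dir_deriv:
  assumes "\<And>x. f differentiable (at x)" "\<And>b. b \<in> Basis \<Longrightarrow> smooth (dir_deriv b f)"
  shows "smooth f"
  unfolding smooth_def
proof
  fix k
  \<comment> \<open>The hypotheses give order \<open>Suc k\<close> for every \<open>k\<close>, and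
    one order is then dropped; this also covers order 0, where only continuity is asked.\<close>
  show "times_differentiable k f"
    by (rule times_differentiable_SucD) (use assms in \<open>auto simp: smooth_def\<close>)
qed

lemma smooth_bounded_linear:
  assumes "bounded_linear f"
  shows "smooth f"
proof (rule smoothI_dir_deriv)
  show "f differentiable (at x)" for x
    using assms bounded_linear_imp_differentiable by blast
  have "dir_deriv b f = (\<lambda>x. f b)" for b
    by (intro dir_derivI bounded_linear_imp_has_derivative assms)
  then show "smooth (dir_deriv b f)" for b by auto
qed

lemma smooth_inner_right [intro!]: "smooth (\<lambda>x. complex_of_real (x \<bullet> v))"
  by (rule smooth_bounded_linear) (rule bounded_linear_compose[OF bounded_linear_of_real bounded_linear_inner_left])

lemma smooth_inner_self [intro!]: "smooth (\<lambda>x::'a::euclidean_space. complex_of_real (x \<bullet> x))"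
proof -
  have "(\<lambda>x::'a. complex_of_real (x \<bullet> x)) = (\<lambda>x. \<Sum>b\<in>Basis. complex_of_real (x \<bullet> b) * complex_of_real (x \<bullet> b))"
    by (intro ext, subst euclidean_inner) simp
  moreover have "smooth (\<lambda>x::'a. \<Sum>b\<in>B. complex_of_real (x \<bullet> b) * complex_of_real (x \<bullet> b))" if "finite B" for B
    using that by (induction B rule: finite_induct) auto
  ultimately show ?thesis by simp
qed

lemma smooth_exp [intro!]:
  assumes "smooth f"
  shows "smooth (\<lambda>x. exp (f x))"
proof -
  have "times_differentiable k (\<lambda>x. exp (f x))" for k
  proof (induction k)
    case 0
    then show ?case using assms smooth_continuous by (auto intro!: continuous_intros)
  next
    case (Suc k)
    have 1: "((\<lambda>x. exp (f x)) has_derivative (\<lambda>v. exp (f x) * dir_deriv v f x)) (at x)" for x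
      by (rule has_derivative_compose[OF has_derivative_dir_deriv[OF smooth_differentiable[OF assms]]
            DERIV_exp[unfolded has_field_derivative_def]])
    have "dir_deriv b (\<lambda>x. exp (f x)) = (\<lambda>x. exp (f x) * dir_deriv b f x)" for b
      by (intro dir_derivI 1)
    moreover have "(\<lambda>x. exp (f x)) differentiable at x" for x
      using 1 by (metis differentiableI)
    ultimately show ?case
      using smooth_dir_deriv[OF assms] Suc by (auto intro!: times_differentiable_mult simp: smooth_def)
  qed
  then show ?thesis by (auto simp: smooth_def)
qed

text \<open>Indexing all derivatives of the outer function by \<open>j\<close> closes the induction:
  one differentiation replaces \<open>j\<close> by \<open>Suc j\<close> and leaves a factor that
  depends on \<open>q\<close> alone.\<close>

lemma smooth_compose_deriv_sequence:
  assumes \<phi>: "\<And>j v. (\<phi> j has_real_derivative \<phi> (Suc j) v) (at v)"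
    and q: "smooth (\<lambda>x. complex_of_real (q x))"
  shows "smooth (\<lambda>x. complex_of_real (\<phi> j (q x)))"
proof -
  have q': "continuous_on UNIV q"
    using smooth_continuous[OF q] continuous_on_Re by fastforce
  have qd: "(q has_derivative (\<lambda>v. Re (dir_deriv v (\<lambda>x. complex_of_real (q x)) x))) (at x)" for x
    using has_derivative_Re[OF has_derivative_dir_deriv[OF smooth_differentiable[OF q]]] by simp
  \<comment> \<open>A derivative of a real-valued function is real. The real chain rule produces
    only the real part of the inner derivative, and this restores the complex form.\<close>
  have qi: "dir_deriv b (\<lambda>x. complex_of_real (q x)) x = complex_of_real (Re (dir_deriv b (\<lambda>x. complex_of_real (q x)) x))" for x b
    using dir_deriv_eqI[OF has_derivative_of_real[OF qd]] .
  have "times_differentiable k (\<lambda>x. complex_of_real (\<phi> j (q x)))" for k j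
  proof (induction k arbitrary: j)
    case 0
    have "continuous_on UNIV (\<phi> j)"
      using \<phi> by (meson DERIV_isCont continuous_at_imp_continuous_on)
    then show ?case using q' by (auto intro!: continuous_intros continuous_on_compose2[of UNIV "\<phi> j" UNIV q])
  next
    case (Suc k)
    let ?q = "\<lambda>x. complex_of_real (q x)"
    have 1: "((\<lambda>x. complex_of_real (\<phi> j (q x))) has_derivative
       (\<lambda>v. complex_of_real (\<phi> (Suc j) (q x)) * dir_deriv v ?q x)) (at x)" for x
    proof -
      have "((\<lambda>x. complex_of_real (\<phi> j (q x))) has_derivative
         (\<lambda>v. complex_of_real (\<phi> (Suc j) (q x) * Re (dir_deriv v ?q x)))) (at x)"
        by (intro has_derivative_of_real has_derivative_compose[OF qd, where g="\<phi> j"] )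
           (use \<phi> in \<open>auto simp: has_field_derivative_def\<close>)
      then show ?thesis using qi by simp
    qed
    have "dir_deriv b (\<lambda>x. complex_of_real (\<phi> j (q x))) = (\<lambda>x. complex_of_real (\<phi> (Suc j) (q x)) * dir_deriv b ?q x)" for b
      by (intro dir_derivI 1)
    moreover have "(\<lambda>x. complex_of_real (\<phi> j (q x))) differentiable at x" for x
      using 1 by (metis differentiableI)
    ultimately show ?case
      using smooth_dir_deriv[OF q] Suc by (auto intro!: times_differentiable_mult simp: smooth_def)
  qed
  then show ?thesis by (auto simp: smooth_def)
qed

lemma dir_deriv_compose_linear:
  assumes "bounded_linear g" "\<And>x. f differentiable (at x)"
  shows "dir_deriv b (\<lambda>x. f (g x)) = (\<lambda>x. dir_deriv (g b) f (g x))"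
    and "(\<lambda>x. f (g x)) differentiable (at x)"
proof -
  have 1: "((\<lambda>x. f (g x)) has_derivative (\<lambda>v. dir_deriv (g v) f (g x))) (at x)" for x
    by (rule has_derivative_compose[OF bounded_linear_imp_has_derivative[OF assms(1)]
         has_derivative_dir_deriv[OF assms(2)]])
  show "dir_deriv b (\<lambda>x. f (g x)) = (\<lambda>x. dir_deriv (g b) f (g x))"
    by (intro dir_derivI 1)
  show "(\<lambda>x. f (g x)) differentiable (at x)" using 1 by (metis differentiableI)
qed

lemma dir_deriv_zero: "f differentiable (at x) \<Longrightarrow> dir_deriv 0 f x = 0"
  unfolding dir_deriv_def using frechet_derivative_works linear_0 has_derivative_linear by metis

text \<open>\<open>times_differentiable\<close> speaks only of partial derivatives along
  \<open>Basis\<close>, so \<open>g\<close> has to send basis vectors to basis vectors or to 0. The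
  two projections of a product do this, and they are what tensor products need.\<close>

lemma smooth_compose_linear:
  assumes g: "bounded_linear g" "\<And>b. b \<in> Basis \<Longrightarrow> g b \<in> insert 0 Basis"
    and f: "smooth f"
  shows "smooth (\<lambda>x. f (g x))"
proof -
  have "times_differentiable k (\<lambda>x. f (g x))" if "smooth f" for k f
    using that
  proof (induction k arbitrary: f)
    case 0
    have "continuous_on UNIV g" using g(1) by (simp add: linear_continuous_on)
    then show ?case using smooth_continuous[OF 0] by (auto intro: continuous_on_compose2)
  next
    case (Suc k)
    note d = dir_deriv_compose_linear[OF g(1) smooth_differentiable[OF Suc.prems]]
    have "times_differentiable k (dir_deriv b (\<lambda>x. f (g x)))" if "b \<in> Basis" for b
    proof (cases "g b = 0")
      case True
      then show ?thesis by (simp add: d dir_deriv_zero smooth_differentiable[OF Suc.prems] times_differentiable_const)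
    next
      case False
      then show ?thesis using g(2)[OF that] by (auto simp: d intro!: Suc.IH smooth_dir_deriv Suc.prems)
    qed
    then show ?case using d by simp
  qed
  then show ?thesis using f by (auto simp: smooth_def)
qed

section \<open>The standard bump function and its derivatives\<close>

definition bump_poly :: "real poly \<Rightarrow> real \<Rightarrow> real" where
  "bump_poly P s = (if s > 0 then poly P (1 / s) * exp (- 1 / s) else 0)"

lemma bump_poly_tendsto_0: "(bump_poly P \<longlongrightarrow> 0) (at_right 0)"
proof -
  have "((\<lambda>x::real. poly P x * exp (- x)) \<longlongrightarrow> 0) at_top"
  proof -
    have 1: "((\<lambda>x::real. x^k * exp (-x)) \<longlongrightarrow> 0) at_top" for k
      using tendsto_power_div_exp_0[of k] by (simp add: exp_minus field_simps)
    have "(\<lambda>x. poly P x * exp (-x)) = (\<lambda>x. \<Sum>i\<le>degree P. coeff P i * (x ^ i * exp (-x)))"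
      by (simp add: fun_eq_iff poly_altdef sum_distrib_right mult.assoc)
    then show ?thesis by (simp only:) (intro tendsto_null_sum tendsto_mult_right_zero 1)
  qed
  then have "((\<lambda>s. poly P (inverse s) * exp (- inverse s)) \<longlongrightarrow> 0) (at_right (0::real))"
    using filterlim_compose[OF _ filterlim_inverse_at_top_right] by fastforce
  then show ?thesis
    by (rule Lim_transform_eventually) (auto simp: bump_poly_def eventually_at_right_less inverse_eq_divide intro!: eventually_at_rightI[of 0 1])
qed

text \<open>The functions P(1/s) exp(-1/s), extended by 0, are closed under differentiation: the
  derivative replaces P(X) by X^2 (P - P'). Smoothness at the gluing point then follows for all
  orders at once.\<close>

lemma bump_poly_has_real_derivative:
  "(bump_poly P has_real_derivative bump_poly ([:0,0,1:] * (P - pderiv P)) s) (at s)"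
proof -
  consider "s < 0" | "s = 0" | "s > 0" by linarith
  then show ?thesis
  proof cases
    case 1
    have "((\<lambda>_. 0) has_real_derivative 0) (at s)" by simp
    then have "(bump_poly P has_real_derivative 0) (at s)"
      by (rule has_field_derivative_transform_within_open[where S="{..<0}"]) (use 1 in \<open>auto simp: bump_poly_def\<close>)
    then show ?thesis using 1 by (simp add: bump_poly_def)
  next
    case 3
    have "((\<lambda>s. poly P (1/s) * exp (- 1/s)) has_real_derivative bump_poly ([:0,0,1:] * (P - pderiv P)) s) (at s)"
      using 3 by (auto intro!: derivative_eq_intros poly_DERIV[THEN DERIV_chain2] simp: bump_poly_def power2_eq_square field_simps)
    then show ?thesis
      by (rule has_field_derivative_transform_within_open[where S="{0<..}"]) (use 3 in \<open>auto simp: bump_poly_def\<close>)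
  next
    case 2
    \<comment> \<open>Dividing by \<open>h\<close> multiplies the polynomial in 1/h by its variable,
      so the difference quotient is again of the form \<open>bump_poly\<close> and tends to
      0.\<close>
    have r: "((\<lambda>h. (bump_poly P h) / h) \<longlongrightarrow> 0) (at_right 0)"
      using bump_poly_tendsto_0[of "[:0,1:] * P"]
      by (rule Lim_transform_eventually) (auto simp: bump_poly_def  intro!: eventually_at_rightI[of 0 1])
    have l: "((\<lambda>h. (bump_poly P h) / h) \<longlongrightarrow> 0) (at_left 0)"
      by (rule Lim_transform_eventually[where f="\<lambda>_. 0"]) (auto simp: bump_poly_def  intro!: eventually_at_leftI[of "-1" 0])
    have "((\<lambda>h. (bump_poly P h) / h) \<longlongrightarrow> 0) (at 0)"
      using l r by (simp add: filterlim_at_split)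
    then show ?thesis using 2 by (simp add: DERIV_def bump_poly_def)
  qed
qed

primrec bump_coeff :: "nat \<Rightarrow> real poly" where
  "bump_coeff 0 = 1"
| "bump_coeff (Suc j) = [:0,0,1:] * (bump_coeff j - pderiv (bump_coeff j))"

text \<open>The \<open>j\<close>-th derivative of exp(-1/(1-v)), cut off at v = 1; the sign comes
  from the inner function 1 - v. The argument will always be a multiple of a squared length, which
  avoids differentiating the norm at the origin.\<close>

definition bump :: "nat \<Rightarrow> real \<Rightarrow> real" where
  "bump j v = (-1) ^ j * bump_poly (bump_coeff j) (1 - v)"

lemma bump_has_real_derivative: "(bump j has_real_derivative bump (Suc j) v) (at v)"
  unfolding bump_def
  by (auto intro!: derivative_eq_intros bump_poly_has_real_derivative[THEN DERIV_chain2])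

lemma bump_eq_0: "v \<ge> 1 \<Longrightarrow> bump j v = 0"
  by (simp add: bump_def bump_poly_def)

lemma bump_pos: "v < 1 \<Longrightarrow> bump 0 v > 0"
  by (simp add: bump_def bump_poly_def)

lemma bump_nonneg: "bump 0 v \<ge> 0"
  by (simp add: bump_def bump_poly_def)

lemma bump_mono: "0 \<le> v \<Longrightarrow> bump 0 v \<le> bump 0 0"
  by (auto simp add: bump_def bump_poly_def field_simps)

lemma continuous_bump: "continuous_on S (bump j)"
  using bump_has_real_derivative by (meson DERIV_isCont continuous_at_imp_continuous_on)

lemma bump_bounded: "\<exists>M. \<forall>v\<ge>0. \<bar>bump j v\<bar> \<le> M"
proof -
  have "compact (bump j ` {0..1})"
    by (intro compact_continuous_image continuous_bump) auto
  then obtain M where "\<forall>v\<in>{0..1}. \<bar>bump j v\<bar> \<le> M"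
    using compact_imp_bounded bounded_iff by (metis imageI real_norm_def)
  then have "\<bar>bump j v\<bar> \<le> max M 0" if "v \<ge> 0" for v
    using that bump_eq_0[of v j] by (cases "v \<le> 1") force+
  then show ?thesis by blast
qed

lemma smooth_bump [intro!]:
  "smooth (\<lambda>x. complex_of_real (q x)) \<Longrightarrow> smooth (\<lambda>x. complex_of_real (bump j (q x)))"
  by (rule smooth_compose_deriv_sequence[where \<phi>=bump]) (rule bump_has_real_derivative)

section \<open>Pairings with a decaying solution\<close>

lemma LIMSEQ_if_subseq_subseq:
  fixes X :: "nat \<Rightarrow> 'a::metric_space"
  assumes "\<And>s. strict_mono s \<Longrightarrow> \<exists>r. strict_mono (r::nat\<Rightarrow>nat) \<and> (\<lambda>n. X (s (r n))) \<longlonglongrightarrow> L"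
  shows "X \<longlonglongrightarrow> L"
proof (rule ccontr)
  assume "\<not> X \<longlonglongrightarrow> L"
  then obtain e where e: "e > 0" "\<And>N. \<exists>n\<ge>N. dist (X n) L \<ge> e"
    unfolding lim_sequentially by (meson not_less)
  then have "infinite {n. dist (X n) L \<ge> e}"
    unfolding infinite_nat_iff_unbounded_le by auto
  then obtain s :: "nat \<Rightarrow> nat" where s: "strict_mono s" "\<And>n. dist (X (s n)) L \<ge> e"
    using infinite_enumerate by blast
  from assms[OF s(1)] obtain r where r: "strict_mono r" "(\<lambda>n. X (s (r n))) \<longlonglongrightarrow> L"
    by blast
  then obtain n where "dist (X (s (r n))) L < e"
    using e(1) unfolding lim_sequentially by blast
  with s(2)[of "r n"] show False by simp
qed

text \<open>The decay bound degenerates at time 0, so a sequence of times has to be kept away from 0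
  as a whole, its finitely many early terms included.\<close>

lemma LIMSEQ_positive_lower_bound:
  fixes t :: "nat \<Rightarrow> real"
  assumes "t \<longlonglongrightarrow> t0" "t0 > 0" "\<And>n. t n > 0"
  shows "\<exists>a>0. a \<le> t0 \<and> (\<forall>n. a \<le> t n)"
proof -
  obtain N where N: "\<And>n. n \<ge> N \<Longrightarrow> t n > t0 / 2"
    using order_tendstoD(1)[OF assms(1), of "t0/2"] assms(2) by (auto simp: eventually_sequentially)
  define a where "a = Min (insert (t0/2) (t ` {..N}))"
  have "a > 0" using assms by (auto simp: a_def)
  moreover have "a \<le> t0 / 2" unfolding a_def by (rule Min_le) auto
  moreover have "a \<le> t n" for n
  proof (cases "n \<le> N")
    case True
    then show ?thesis unfolding a_def by (intro Min_le) auto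
  next
    case False
    then show ?thesis using N[of n] \<open>a \<le> t0 / 2\<close> by simp
  qed
  ultimately show ?thesis using assms(2) by (intro exI[of _ a]) auto
qed

lemma integrable_indicator_cball: "integrable lborel (indicator (cball x R) :: 'a::euclidean_space \<Rightarrow> real)"
  by (rule integrable_real_indicator) (use emeasure_lborel_cball_finite[of x R] in \<open>auto simp: top.not_eq_extremum\<close>)

lemma L2_AE_subseq:
  fixes f :: "nat \<Rightarrow> 'b \<Rightarrow> complex"
  assumes int: "\<And>n. integrable M (\<lambda>x. norm (f n x - g x) ^ 2)"
    and lim: "(\<lambda>n. LINT x|M. norm (f n x - g x) ^ 2) \<longlonglongrightarrow> 0"
  shows "\<exists>r. strict_mono (r::nat\<Rightarrow>nat) \<and> (AE x in M. (\<lambda>n. f (r n) x) \<longlonglongrightarrow> g x)"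
proof -
  have "(\<lambda>n. LINT x|M. norm (norm (f n x - g x) ^ 2)) \<longlonglongrightarrow> 0" using lim by simp
  from tendsto_L1_AE_subseq[OF int this] obtain r :: "nat \<Rightarrow> nat" where
    r: "strict_mono r" "AE x in M. (\<lambda>n. norm (f (r n) x - g x) ^ 2) \<longlonglongrightarrow> 0" by auto
  have "AE x in M. (\<lambda>n. f (r n) x) \<longlonglongrightarrow> g x"
    using r(2)
  proof eventually_elim
    case (elim x)
    then have "(\<lambda>n. sqrt (norm (f (r n) x - g x) ^ 2)) \<longlonglongrightarrow> sqrt 0"
      by (rule tendsto_real_sqrt)
    then have "(\<lambda>n. norm (f (r n) x - g x)) \<longlonglongrightarrow> 0" by simp
    then show ?case by (metis Lim_null tendsto_norm_zero_iff)
  qed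
  with r(1) show ?thesis by blast
qed

definition nonlinearity :: "real \<Rightarrow> complex \<Rightarrow> complex" where
  "nonlinearity \<alpha> z = of_real (norm z powr \<alpha>) * z"

lemma continuous_nonlinearity: "\<alpha> > 0 \<Longrightarrow> continuous_on S (nonlinearity \<alpha>)"
  unfolding nonlinearity_def by (intro continuous_intros continuous_on_powr') auto

text \<open>The interface between the hypotheses and the analysis: Borel representatives, and bounds
  at every positive time instead of almost every one. \<open>\<kappa>\<close> will be N\<alpha>/2;
  apart from positivity of \<alpha>, the restrictions on the exponent enter only through \<kappa> >
  1.\<close>

locale decaying_nls =
  fixes u :: "real \<Rightarrow> 'a::euclidean_space \<Rightarrow> complex" and lam \<alpha> \<kappa> M C :: real
  assumes alpha_pos: "0 < \<alpha>"
    and kappa: "1 < \<kappa>"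
    and measurable_u [measurable]: "\<And>t. u t \<in> borel_measurable borel"
    and integrable_L2: "\<And>t. 0 < t \<Longrightarrow> integrable lborel (\<lambda>x. norm (u t x) ^ 2)"
    and L2_bound: "\<And>t. 0 < t \<Longrightarrow> (LINT x|lborel. norm (u t x) ^ 2) \<le> M"
    and L2_continuous: "\<And>t. 0 < t \<Longrightarrow> ((\<lambda>s. LINT x|lborel. norm (u s x - u t x) ^ 2) \<longlongrightarrow> 0) (at t)"
    and integrable_Lp: "\<And>t. 0 < t \<Longrightarrow> integrable lborel (\<lambda>x. norm (u t x) powr (\<alpha> + 2))"
    and Lp_bound: "\<And>t. 0 < t \<Longrightarrow> (LINT x|lborel. norm (u t x) powr (\<alpha> + 2)) \<le> C * t powr - \<kappa>"
    and nls_eq: "\<And>\<psi>. test_function ({0<..} \<times> UNIV) \<psi> \<Longrightarrow>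
        (LINT t|lebesgue. LINT x|lborel. - \<i> * u t x * time_deriv \<psi> (t, x)
                 + u t x * space_laplacian \<psi> (t, x)
                 + of_real lam * nonlinearity \<alpha> (u t x) * \<psi> (t, x)) = 0"
begin

definition energy :: "complex \<Rightarrow> real" where
  "energy z = norm z ^ 2 + norm z powr (\<alpha> + 2)"

lemma energy_nonneg: "energy z \<ge> 0"
  by (simp add: energy_def)

lemma C_nonneg: "C \<ge> 0"
proof -
  have "0 \<le> (LINT x|lborel. norm (u 1 x) powr (\<alpha> + 2))" by simp
  also have "\<dots> \<le> C" using Lp_bound[of 1] by simp
  finally show ?thesis .
qed

lemma integrable_energy: "t > 0 \<Longrightarrow> integrable lborel (\<lambda>x. energy (u t x))"
  unfolding energy_def by (intro Bochner_Integration.integrable_add integrable_L2 integrable_Lp)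

lemma energy_bound:
  assumes "0 < a" "a \<le> t" shows "(LINT x|lborel. energy (u t x)) \<le> M + C * a powr - \<kappa>"
proof -
  have "t powr - \<kappa> \<le> a powr - \<kappa>"
    using assms kappa by (intro powr_mono2') auto
  then have "C * t powr - \<kappa> \<le> C * a powr - \<kappa>" using C_nonneg by (rule mult_left_mono)
  then show ?thesis
    using assms integrable_L2[of t] integrable_Lp[of t] L2_bound[of t] Lp_bound[of t]
    unfolding energy_def by simp
qed

lemma AE_subseq_tendsto:
  assumes t: "t \<longlonglongrightarrow> t0" "t0 > 0" "\<And>n. t n > 0"
  shows "\<exists>r. strict_mono (r::nat\<Rightarrow>nat) \<and> (AE x in lborel. (\<lambda>n. u (t (r n)) x) \<longlonglongrightarrow> u t0 x)"
proof -
  have int: "integrable lborel (\<lambda>x. norm (u (t n) x - u t0 x) ^ 2)" for n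
  proof (rule Bochner_Integration.integrable_bound)
    show "integrable lborel (\<lambda>x. 2 * norm (u (t n) x) ^ 2 + 2 * norm (u t0 x) ^ 2)"
      using integrable_L2 t by auto
    have "norm (a - b) ^ 2 \<le> 2 * norm a ^ 2 + 2 * norm b ^ 2" for a b :: complex
    proof -
      have "norm (a - b) ^ 2 \<le> (norm a + norm b) ^ 2"
        by (intro power_mono norm_triangle_ineq4) auto
      also have "\<dots> \<le> 2 * norm a ^ 2 + 2 * norm b ^ 2"
        using zero_le_power2[of "norm a - norm b"] by (simp add: power2_eq_square algebra_simps)
      finally show ?thesis .
    qed
    then show "AE x in lborel. norm (norm (u (t n) x - u t0 x) ^ 2) \<le> norm (2 * norm (u (t n) x) ^ 2 + 2 * norm (u t0 x) ^ 2)"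
      by simp
  qed measurable
  have "((\<lambda>s. LINT x|lborel. norm (u s x - u t0 x) ^ 2) \<longlongrightarrow> 0) (nhds t0)"
    using L2_continuous[OF t(2)] by (simp add: tendsto_nhds_iff)
  from filterlim_compose[OF this t(1)] show ?thesis by (intro L2_AE_subseq int)
qed

text \<open>Meant for the four functions that occur in pairings: z, the nonlinearity, and their
  conjugates. One condition lets linear and nonlinear terms share all convergence lemmas.\<close>

definition admissible :: "(complex \<Rightarrow> complex) \<Rightarrow> bool" where
  "admissible F \<longleftrightarrow> continuous_on UNIV F \<and> (\<forall>z. norm (F z) * norm z \<le> energy z)"

lemma admissible_id: "admissible (\<lambda>z. z)"
  and admissible_cnj: "admissible cnj"
  by (auto simp: admissible_def energy_def power2_eq_square intro!: continuous_intros)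

lemma norm_nonlinearity_mult: "norm (nonlinearity \<alpha> z) * norm z = norm z powr (\<alpha> + 2)"
  by (cases "z = 0") (use alpha_pos in \<open>auto simp: nonlinearity_def norm_mult powr_add power2_eq_square mult.assoc\<close>)

lemma admissible_nonlinearity: "admissible (nonlinearity \<alpha>)"
  and admissible_cnj_nonlinearity: "admissible (\<lambda>z. cnj (nonlinearity \<alpha> z))"
  by (auto simp: admissible_def norm_nonlinearity_mult energy_def
      intro!: continuous_intros continuous_nonlinearity alpha_pos)

lemma admissible_measurable [measurable_dest]: "admissible F \<Longrightarrow> F \<in> borel_measurable borel"
  by (auto simp: admissible_def intro: borel_measurable_continuous_onI)

lemma admissible_bounded_on_cball:
  assumes "admissible F"
  obtains S where "S \<ge> 0" "\<And>z. norm z \<le> R \<Longrightarrow> norm (F z) \<le> S"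
proof -
  have "compact (F ` cball 0 R)"
    using assms by (auto simp: admissible_def intro!: compact_continuous_image continuous_on_subset[of UNIV F])
  then obtain S where "\<forall>y\<in>F ` cball 0 R. norm y \<le> S"
    using compact_imp_bounded bounded_iff by metis
  then have "norm (F z) \<le> max S 0" if "norm z \<le> R" for z
    using that by (auto intro!: max.coboundedI1)
  then show ?thesis using that[of "max S 0"] by simp
qed

lemma admissible_growth:
  assumes "admissible F"
  obtains S where "S \<ge> 0" "\<And>z. norm (F z) \<le> S + energy z"
proof -
  obtain S where S: "S \<ge> 0" "\<And>z. norm z \<le> 1 \<Longrightarrow> norm (F z) \<le> S"
    using admissible_bounded_on_cball[OF assms] by metis
  have "norm (F z) \<le> S + energy z" for z
  proof (cases "norm z \<le> 1")
    case True
    then show ?thesis using S(2)[of z] energy_nonneg[of z] by linarith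
  next
    case False
    then have "norm (F z) * 1 \<le> norm (F z) * norm z" by (intro mult_left_mono) auto
    also have "\<dots> \<le> energy z" using assms by (auto simp: admissible_def)
    finally show ?thesis using S(1) by linarith
  qed
  with S(1) show ?thesis using that by blast
qed

text \<open>Truncates the values of \<open>u\<close>, not the space variable. It is continuous, so a
  truncated F(u) is still a continuous function of \<open>u\<close> and passes to almost everywhere
  limits.\<close>

definition cutoff :: "real \<Rightarrow> complex \<Rightarrow> real" where
  "cutoff k z = max 0 (min 1 (k + 1 - norm z))"

lemma cutoff_bounds: "0 \<le> cutoff k z" "cutoff k z \<le> 1"
  by (auto simp: cutoff_def)

lemma continuous_cutoff: "continuous_on S (cutoff k)"
  unfolding cutoff_def by (intro continuous_intros)

text \<open>As in Chebyshev's inequality: where truncation acts, the factor |z|/k is at least 1 and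
  may be inserted.\<close>

lemma truncation_error:
  assumes "admissible F" "k > 0"
  shows "norm (F z - F z * cutoff k z) \<le> energy z / k"
proof (cases "norm z \<le> k")
  case True
  then have "cutoff k z = 1" by (auto simp: cutoff_def)
  then show ?thesis using energy_nonneg[of z] assms(2) by simp
next
  case False
  have "norm (F z - F z * cutoff k z) = norm (F z) * \<bar>1 - cutoff k z\<bar>"
    by (metis (no_types, lifting) mult.right_neutral norm_mult norm_of_real of_real_1 of_real_diff right_diff_distrib)
  also have "\<dots> \<le> norm (F z) * 1"
    using cutoff_bounds[of k z] by (intro mult_left_mono) auto
  also have "\<dots> \<le> norm (F z) * (norm z / k)"
    using False assms(2) by (intro mult_left_mono) auto
  also have "\<dots> \<le> energy z / k"
    using assms by (auto simp: admissible_def intro!: divide_right_mono)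
  finally show ?thesis .
qed

lemma integrable_pairing:
  assumes F: "admissible F" and "t > 0"
    and [measurable]: "\<eta> \<in> borel_measurable borel"
    and b: "\<And>x. norm (\<eta> x) \<le> B * indicator (cball 0 R) x"
  shows "integrable lborel (\<lambda>x. F (u t x) * \<eta> x)"
proof -
  note [measurable] = admissible_measurable[OF F]
  obtain S where S: "S \<ge> 0" "\<And>z. norm (F z) \<le> S + energy z" by (rule admissible_growth[OF F]) blast
  have i: "integrable lborel (\<lambda>x. S * B * indicator (cball (0::'a) R) x + \<bar>B\<bar> * energy (u t x))"
    by (intro Bochner_Integration.integrable_add integrable_mult_right integrable_energy assms)
       (rule integrable_indicator_cball)
  show "integrable lborel (\<lambda>x. F (u t x) * \<eta> x)"
  proof (rule Bochner_Integration.integrable_bound[OF i])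
    have "norm (F (u t x)) * norm (\<eta> x) \<le> norm (S * B * indicator (cball (0::'a) R) x + \<bar>B\<bar> * energy (u t x))" for x
    proof (cases "x \<in> cball 0 R")
      case True
      then have "norm (F (u t x)) * norm (\<eta> x) \<le> (S + energy (u t x)) * B"
        using S b[of x] energy_nonneg[of "u t x"] by (intro mult_mono) auto
      moreover have "B \<ge> 0" using b[of x] True norm_ge_zero[of "\<eta> x"] by (auto simp del: norm_ge_zero)
      ultimately show ?thesis using True by (simp add: algebra_simps)
    next
      case False
      then show ?thesis using b[of x] by simp
    qed
    then show "AE x in lborel. norm (F (u t x) * \<eta> x) \<le> norm (S * B * indicator (cball (0::'a) R) x + \<bar>B\<bar> * energy (u t x))"
      by (simp add: norm_mult)
  qed measurable
qed

text \<open>\<open>L\<^sup>2\<close> convergence only gives almost everywhere convergence of subsequences; the factor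
  \<open>norm z\<close> in the definition of admissibility makes \<open>F (u t)\<close> uniformly integrable on
  bounded sets, which upgrades it to convergence of the pairings.\<close>

lemma pairing_tendsto:
  assumes F: "admissible F" and t: "t \<longlonglongrightarrow> t0" "t0 > 0" "\<And>n. t n > 0"
    and [measurable]: "\<And>n. \<eta> n \<in> borel_measurable borel" "\<eta>0 \<in> borel_measurable borel"
    and b: "\<And>n x. norm (\<eta> n x) \<le> B * indicator (cball 0 R) x"
    and lim: "\<And>x. (\<lambda>n. \<eta> n x) \<longlonglongrightarrow> \<eta>0 x"
  shows "(\<lambda>n. LINT x|lborel. F (u (t n) x) * \<eta> n x) \<longlonglongrightarrow> (LINT x|lborel. F (u t0 x) * \<eta>0 x)"
proof (rule LIMSEQ_if_subseq_subseq)
  fix s :: "nat \<Rightarrow> nat" assume s: "strict_mono s"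
  note [measurable] = admissible_measurable[OF F]
  have b0: "norm (\<eta>0 x) \<le> B * indicator (cball 0 R) x" for x
    using b lim by (intro LIMSEQ_le_const2[OF tendsto_norm[OF lim]]) auto
  obtain a where a: "a > 0" "a \<le> t0" "\<And>n. a \<le> t n"
    using LIMSEQ_positive_lower_bound[OF t] by blast
  define Q where "Q = M + C * a powr - \<kappa>"
  have Q: "(LINT x|lborel. energy (u s x)) \<le> Q" if "s \<ge> a" for s
    unfolding Q_def using a that by (intro energy_bound) auto
  have "(\<lambda>n. t (s n)) \<longlonglongrightarrow> t0" using LIMSEQ_subseq_LIMSEQ[OF t(1) s] by (simp add: o_def)
  from AE_subseq_tendsto[OF this t(2) t(3)] obtain r :: "nat \<Rightarrow> nat" where
    r: "strict_mono r" "AE x in lborel. (\<lambda>n. u (t (s (r n))) x) \<longlonglongrightarrow> u t0 x" by blast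
  define q where "q n = s (r n)" for n
  have q: "strict_mono q" using strict_mono_compose[OF s r(1)] by (simp add: q_def[abs_def])
  have B0: "norm (\<eta> n x) \<le> \<bar>B\<bar>" "norm (\<eta>0 x) \<le> \<bar>B\<bar>" for n x
    using b[of n x] b0[of x] by (cases "x \<in> cball 0 R"; simp)+
  \<comment> \<open>The constant involves neither \<open>s\<close> nor the weight: the energy is
    bounded on [a,\<infinity>), so truncating at height \<open>k\<close> costs the same at all times
    of the sequence and in the limit.\<close>
  have err: "norm ((LINT x|lborel. F (u s x) * \<eta>' x) - (LINT x|lborel. F (u s x) * cutoff k (u s x) * \<eta>' x)) \<le> \<bar>B\<bar> * Q / k"
    if [measurable]: "\<eta>' \<in> borel_measurable borel" and b': "\<And>x. norm (\<eta>' x) \<le> B * indicator (cball 0 R) x"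
      and "\<And>x. norm (\<eta>' x) \<le> \<bar>B\<bar>" and k: "k > 0" and s: "s \<ge> a" for k s \<eta>'
  proof -
    have [measurable]: "cutoff k \<in> borel_measurable borel"
      by (intro borel_measurable_continuous_onI continuous_cutoff)
    have s0: "s > 0" using a s by linarith
    have i1: "integrable lborel (\<lambda>x. F (u s x) * \<eta>' x)"
      using integrable_pairing[OF F s0 _ b'] by simp
    have i2: "integrable lborel (\<lambda>x. F (u s x) * cutoff k (u s x) * \<eta>' x)"
    proof (rule Bochner_Integration.integrable_bound[OF i1])
      show "AE x in lborel. norm (F (u s x) * complex_of_real (cutoff k (u s x)) * \<eta>' x) \<le> norm (F (u s x) * \<eta>' x)"
        using cutoff_bounds by (auto simp: norm_mult mult_left_le intro!: mult_right_mono)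
    qed measurable
    have "norm ((LINT x|lborel. F (u s x) * \<eta>' x) - (LINT x|lborel. F (u s x) * cutoff k (u s x) * \<eta>' x))
      = norm (LINT x|lborel. F (u s x) * \<eta>' x - F (u s x) * cutoff k (u s x) * \<eta>' x)"
      by (simp add: Bochner_Integration.integral_diff[OF i1 i2])
    also have "\<dots> \<le> (LINT x|lborel. norm (F (u s x) * \<eta>' x - F (u s x) * cutoff k (u s x) * \<eta>' x))"
      by (rule integral_norm_bound)
    also have "\<dots> \<le> (LINT x|lborel. \<bar>B\<bar> / k * energy (u s x))"
    proof (rule integral_mono)
      show "integrable lborel (\<lambda>x. norm (F (u s x) * \<eta>' x - F (u s x) * cutoff k (u s x) * \<eta>' x))"
        using i1 i2 by (intro integrable_norm Bochner_Integration.integrable_diff)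
      show "integrable lborel (\<lambda>x. \<bar>B\<bar> / k * energy (u s x))"
        using integrable_energy[OF s0] by simp
      have "norm (F (u s x) * \<eta>' x - F (u s x) * cutoff k (u s x) * \<eta>' x)
          = norm (F (u s x) - F (u s x) * cutoff k (u s x)) * norm (\<eta>' x)" for x
        by (simp add: left_diff_distrib flip: norm_mult)
      also have "\<dots> x \<le> energy (u s x) / k * \<bar>B\<bar>" for x
        using that k by (intro mult_mono truncation_error F) (auto simp: energy_nonneg)
      finally show "norm (F (u s x) * \<eta>' x - F (u s x) * cutoff k (u s x) * \<eta>' x) \<le> \<bar>B\<bar> / k * energy (u s x)" for x
        by (simp add: mult_ac)
    qed
    also have "\<dots> = \<bar>B\<bar> / k * (LINT x|lborel. energy (u s x))" by simp
    also have "\<dots> \<le> \<bar>B\<bar> / k * Q"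
      using k s Q by (intro mult_left_mono) auto
    finally show ?thesis by simp
  qed
  have "(\<lambda>n. LINT x|lborel. F (u (t (q n)) x) * \<eta> (q n) x) \<longlonglongrightarrow> (LINT x|lborel. F (u t0 x) * \<eta>0 x)"
  proof (rule LIMSEQ_I)
    fix e :: real assume e: "e > 0"
    have Q0: "Q \<ge> 0" using Q[of a] a by (meson Bochner_Integration.integral_nonneg energy_nonneg order.refl order.trans)
    \<comment> \<open>Brings the truncation error below e/3, once for the sequence and once for the
      limit; the summand 1 keeps \<open>k\<close> positive when B Q = 0.\<close>
    define k where "k = 3 * (\<bar>B\<bar> * Q + 1) / e"
    have k: "k > 0" using Q0 e unfolding k_def by (intro divide_pos_pos) (auto intro: add_nonneg_pos)
    have ke: "\<bar>B\<bar> * Q / k < e / 3"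
      using Q0 e k unfolding k_def by (simp add: field_simps add_nonneg_pos)
    have [measurable]: "cutoff k \<in> borel_measurable borel"
      by (intro borel_measurable_continuous_onI continuous_cutoff)
    obtain S where S: "S \<ge> 0" "\<And>z. norm z \<le> k + 1 \<Longrightarrow> norm (F z) \<le> S"
      using admissible_bounded_on_cball[OF F] by metis
    have S': "norm (F z * cutoff k z) \<le> S" for z
    proof (cases "norm z \<le> k + 1")
      case True
      have "norm (F z) * \<bar>cutoff k z\<bar> \<le> S * 1"
        using S True cutoff_bounds[of k z] by (intro mult_mono) auto
      then show ?thesis by (simp add: norm_mult)
    next
      case False
      then have "cutoff k z = 0" by (auto simp: cutoff_def)
      then show ?thesis using S by simp
    qed
    have "(\<lambda>n. LINT x|lborel. F (u (t (q n)) x) * cutoff k (u (t (q n)) x) * \<eta> (q n) x)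
        \<longlonglongrightarrow> (LINT x|lborel. F (u t0 x) * cutoff k (u t0 x) * \<eta>0 x)"
    proof (rule integral_dominated_convergence[where w="\<lambda>x. S * B * indicator (cball 0 R) x"])
      show "integrable lborel (\<lambda>x::'a. S * B * indicator (cball 0 R) x)"
        by (intro integrable_mult_right integrable_indicator_cball)
      have "continuous_on UNIV (\<lambda>z. F z * complex_of_real (cutoff k z))"
        using F by (auto simp: admissible_def intro!: continuous_intros continuous_cutoff)
      then have "isCont (\<lambda>z. F z * complex_of_real (cutoff k z)) z" for z
        by (simp add: continuous_on_eq_continuous_at)
      note c = isCont_tendsto_compose[OF this]
      have chi: "(\<lambda>n. \<eta> (q n) x) \<longlonglongrightarrow> \<eta>0 x" for x
        using LIMSEQ_subseq_LIMSEQ[OF lim q, of x] by (simp add: o_def)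
      show "AE x in lborel. (\<lambda>n. F (u (t (q n)) x) * cutoff k (u (t (q n)) x) * \<eta> (q n) x)
         \<longlonglongrightarrow> F (u t0 x) * cutoff k (u t0 x) * \<eta>0 x"
        using r(2) unfolding q_def[symmetric]
        by eventually_elim (intro tendsto_mult[OF c chi])
      show "AE x in lborel. norm (F (u (t (q n)) x) * cutoff k (u (t (q n)) x) * \<eta> (q n) x) \<le> S * B * indicator (cball 0 R) x" for n
      proof (intro AE_I2)
        fix x
        have "norm (F v * cutoff k v) * norm (\<eta> (q n) x) \<le> S * (B * indicator (cball 0 R) x)" for v
          by (intro mult_mono S' b S(1)) simp
        then show "norm (F (u (t (q n)) x) * cutoff k (u (t (q n)) x) * \<eta> (q n) x) \<le> S * B * indicator (cball 0 R) x"
          by (simp only: norm_mult mult.assoc)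
      qed
    qed measurable
    from LIMSEQ_D[OF this, of "e/3"] e obtain N where N: "\<And>n. n \<ge> N \<Longrightarrow>
       norm ((LINT x|lborel. F (u (t (q n)) x) * cutoff k (u (t (q n)) x) * \<eta> (q n) x) - (LINT x|lborel. F (u t0 x) * cutoff k (u t0 x) * \<eta>0 x)) < e/3"
      by auto
    show "\<exists>N. \<forall>n\<ge>N. norm ((LINT x|lborel. F (u (t (q n)) x) * \<eta> (q n) x) - (LINT x|lborel. F (u t0 x) * \<eta>0 x)) < e"
    proof (intro exI allI impI)
      fix n assume n: "n \<ge> N"
      have *: "norm (p - v) < e" if "norm (p - p') \<le> x" "norm (v - v') \<le> x" "x < e/3" "norm (p' - v') < e/3" for p v p' v' :: complex and x
      proof -
        have "norm (p - v) = norm ((p - p') + (p' - v') - (v - v'))" by simp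
        also have "\<dots> \<le> norm (p - p') + norm (p' - v') + norm (v - v')"
          by (meson add_mono norm_triangle_ineq norm_triangle_ineq4 order.refl order.trans)
        finally show ?thesis using that by linarith
      qed
      show "norm ((LINT x|lborel. F (u (t (q n)) x) * \<eta> (q n) x) - (LINT x|lborel. F (u t0 x) * \<eta>0 x)) < e"
        by (rule *[OF err[OF _ b B0(1) k a(3)[of "q n"]] err[OF _ b0 B0(2) k a(2)] ke N[OF n]]) measurable
    qed
  qed
  with r(1) show "\<exists>r. strict_mono r \<and> (\<lambda>n. LINT x|lborel. F (u (t (s (r n))) x) * \<eta> (s (r n)) x) \<longlonglongrightarrow> (LINT x|lborel. F (u t0 x) * \<eta>0 x)"
    unfolding q_def by blast
qed

end

section \<open>The equation tested against a fixed function\<close>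

text \<open>A smooth step from 0 to \<open>Z\<close>. Both plateaus matter: subtracting two
  translates leaves a function of compact support.\<close>

lemma bump_antiderivative:
  assumes \<delta>: "\<delta> > (0::real)"
  obtains B Z where "Z > 0" "\<And>v. (B has_real_derivative bump 0 (v\<^sup>2 / \<delta>\<^sup>2)) (at v)"
    "\<And>v. v \<le> - \<delta> \<Longrightarrow> B v = 0" "\<And>v. v \<ge> \<delta> \<Longrightarrow> B v = Z"
proof -
  define \<beta> where "\<beta> v = bump 0 (v\<^sup>2 / \<delta>\<^sup>2)" for v :: real
  have cont: "continuous_on S \<beta>" for S
    unfolding \<beta>_def using \<delta> by (intro continuous_on_compose2[OF continuous_bump] continuous_intros) auto
  have z: "\<beta> v = 0" if "\<bar>v\<bar> \<ge> \<delta>" for v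
  proof -
    have "\<delta>\<^sup>2 \<le> v\<^sup>2" using that \<delta> by (metis abs_le_square_iff abs_of_pos)
    then show ?thesis unfolding \<beta>_def using \<delta> by (intro bump_eq_0) (simp add: field_simps)
  qed
  \<comment> \<open>The base point lies strictly to the left of the support, so that every v from
    -\<delta> on is interior to the interval of integration and the derivative is two-sided.\<close>
  define B where "B v = integral {-2*\<delta>..v} \<beta>" for v
  have B0: "B v = 0" if "v \<le> -\<delta>" for v
    unfolding B_def using that z \<delta> integral_cong[of "{-2*\<delta>..v}" \<beta> "\<lambda>_. 0"] by auto
  have deriv: "(B has_real_derivative \<beta> v) (at v)" for v
  proof (cases "v < -\<delta>")
    case True
    have "((\<lambda>_. 0) has_real_derivative 0) (at v)" by simp
    then have "(B has_real_derivative 0) (at v)"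
      by (rule has_field_derivative_transform_within_open[where S="{..<-\<delta>}"]) (use True B0 in auto)
    then show ?thesis using z[of v] True \<delta> by simp
  next
    case False
    have "(B has_real_derivative \<beta> v) (at v within {-2*\<delta>..v+1})"
      unfolding B_def using False \<delta> by (intro integral_has_real_derivative cont) auto
    then show ?thesis using False \<delta> by (subst (asm) at_within_interior) auto
  qed
  have BZ: "B v = B \<delta>" if "v \<ge> \<delta>" for v
  proof (cases "v = \<delta>")
    case False
    then have "\<delta> < v" using that by simp
    then have "\<exists>w. \<delta> < w \<and> w < v \<and> B v - B \<delta> = (v - \<delta>) * \<beta> w"
      by (intro MVT2) (use deriv in auto)
    then show ?thesis using z \<delta> by auto
  qed simp
  \<comment> \<open>The mean value theorem expresses the height of the step by a value of the bump
    strictly inside its support, which is positive.\<close>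
  have "\<exists>w. -\<delta> < w \<and> w < \<delta> \<and> B \<delta> - B (-\<delta>) = (\<delta> - (-\<delta>)) * \<beta> w"
    by (intro MVT2) (use deriv \<delta> in auto)
  then obtain w where w: "-\<delta> < w" "w < \<delta>" "B \<delta> = 2 * \<delta> * \<beta> w"
    using B0[of "-\<delta>"] by auto
  have "w\<^sup>2 < \<delta>\<^sup>2" using w(1,2) by (metis abs_less_iff abs_le_square_iff abs_of_pos \<delta> not_less minus_less_iff)
  then have "\<beta> w > 0" unfolding \<beta>_def using \<delta> by (intro bump_pos) (simp add: field_simps)
  then have "B \<delta> > 0" using w \<delta> by simp
  then show ?thesis using that[of "B \<delta>" B] deriv B0 BZ unfolding \<beta>_def by blast
qed

lemma smooth_real_antiderivative:
  fixes \<theta> \<theta>' :: "real \<Rightarrow> real"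
  assumes "\<And>v. (\<theta> has_real_derivative \<theta>' v) (at v)" "smooth (\<lambda>v. complex_of_real (\<theta>' v))"
  shows "smooth (\<lambda>v. complex_of_real (\<theta> v))"
    and "dir_deriv 1 (\<lambda>v. complex_of_real (\<theta> v)) = (\<lambda>v. complex_of_real (\<theta>' v))"
proof -
  have 1: "((\<lambda>v. complex_of_real (\<theta> v)) has_derivative (\<lambda>h. complex_of_real (\<theta>' v * h))) (at v)" for v
    by (intro has_derivative_of_real) (use assms(1) in \<open>auto simp: has_field_derivative_def\<close>)
  then show 2: "dir_deriv 1 (\<lambda>v. complex_of_real (\<theta> v)) = (\<lambda>v. complex_of_real (\<theta>' v))"
    using dir_derivI[OF 1, of 1] by simp
  show "smooth (\<lambda>v. complex_of_real (\<theta> v))"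
  proof (rule smoothI_dir_deriv)
    show "(\<lambda>v. complex_of_real (\<theta> v)) differentiable at x" for x using 1 by (metis differentiableI)
  qed (use 2 assms(2) in auto)
qed

text \<open>The du Bois-Reymond lemma: antiderivatives of a difference of two concentrated bumps are
  test functions, and testing with them compares the values of \<open>\<i> h + \<integral>g\<close> at two points.\<close>

lemma weak_derivative_imp_derivative:
  fixes h g :: "real \<Rightarrow> complex"
  assumes h: "continuous_on {0<..} h" and g: "continuous_on {0<..} g"
    and test: "\<And>\<theta> \<theta>' a b. 0 < a \<Longrightarrow> a < b \<Longrightarrow> smooth (\<lambda>r. complex_of_real (\<theta> r)) \<Longrightarrow>
      (\<And>r. (\<theta> has_real_derivative \<theta>' r) (at r)) \<Longrightarrow> (\<And>r. r \<notin> {a..b} \<Longrightarrow> \<theta> r = 0) \<Longrightarrow>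
      integral {a..b} (\<lambda>r. - \<i> * \<theta>' r * h r + \<theta> r * g r) = 0"
    and t: "t > 0"
  shows "(h has_vector_derivative \<i> * g t) (at t)"
proof -
  define a b where "a = t / 2" and "b = 2 * t"
  have ab: "0 < a" "a < t" "t < b" using t by (auto simp: a_def b_def)
  have sub: "{a..b} \<subseteq> {0<..}" using ab by auto
  define G where "G s = integral {a..s} g" for s
  have G: "(G has_vector_derivative g s) (at s within {a..b})" if "s \<in> {a..b}" for s
    unfolding G_def using that by (intro integral_has_vector_derivative continuous_on_subset[OF g sub])
  have Gc: "continuous_on {a..b} G"
    using G by (meson continuous_on_eq_continuous_within has_vector_derivative_continuous)
  \<comment> \<open>Formally h' = i g, hence l' = i h' + g = 0. The aim is to show that
    \<open>l\<close> is constant near \<open>t\<close>.\<close>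
  define l where "l s = \<i> * h s + G s" for s
  have lc: "continuous_on {a..b} l"
    unfolding l_def by (intro continuous_intros Gc continuous_on_subset[OF h sub])
  have eq: "l t1 = l t2" if t12: "a < t1" "t1 < t2" "t2 < b" for t1 t2
  proof -
    have "norm (l t1 - l t2) \<le> e" if e: "e > 0" for e
    proof -
      have "\<exists>d>0. \<forall>s\<in>{a..b}. dist s t' < d \<longrightarrow> dist (l s) (l t') < e/2" if "t' \<in> {a..b}" for t'
        using lc[unfolded continuous_on_iff, rule_format, OF that, of "e/2"] e by auto
      from this[of t1] this[of t2] t12 obtain d1 d2 where
        d1: "d1 > 0" "\<And>s. s \<in> {a..b} \<Longrightarrow> dist s t1 < d1 \<Longrightarrow> dist (l s) (l t1) < e/2" and
        d2: "d2 > 0" "\<And>s. s \<in> {a..b} \<Longrightarrow> dist s t2 < d2 \<Longrightarrow> dist (l s) (l t2) < e/2"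
        by auto
      \<comment> \<open>Below both moduli of continuity of \<open>l\<close>, and small enough that
        the bumps around \<open>t1\<close> and \<open>t2\<close> fit into [a,b].\<close>
      define \<delta> where "\<delta> = Min {d1/2, d2/2, t1 - a, b - t2}"
      have \<delta>: "\<delta> > 0" "\<delta> < d1" "\<delta> < d2" "a \<le> t1 - \<delta>" "t2 + \<delta> \<le> b"
        using d1 d2 t12 by (auto simp: \<delta>_def min_def)
      obtain B Z where B: "Z > 0" "\<And>v. (B has_real_derivative bump 0 (v\<^sup>2 / \<delta>\<^sup>2)) (at v)"
        "\<And>v. v \<le> - \<delta> \<Longrightarrow> B v = 0" "\<And>v. v \<ge> \<delta> \<Longrightarrow> B v = Z"
        by (rule bump_antiderivative[OF \<delta>(1)]) blast
      define \<beta> where "\<beta> s r = bump 0 ((r - s)\<^sup>2 / \<delta>\<^sup>2)" for s r :: real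
      have \<beta>c: "continuous_on S (\<beta> s)" for S s
        unfolding \<beta>_def using \<delta>(1) by (intro continuous_on_compose2[OF continuous_bump] continuous_intros) auto
      have Bd: "((\<lambda>r. B (r - s)) has_real_derivative \<beta> s r) (at r)" for s r
        unfolding \<beta>_def by (rule DERIV_chain'[OF _ B(2), of _ 1, simplified]) (auto intro!: derivative_eq_intros)
      have \<beta>0: "\<beta> s r = 0" if "\<bar>r - s\<bar> \<ge> \<delta>" for s r
      proof -
        have "\<delta>\<^sup>2 \<le> (r - s)\<^sup>2" using that \<delta> by (metis abs_le_square_iff abs_of_pos)
        then show ?thesis unfolding \<beta>_def using \<delta> by (intro bump_eq_0) (simp add: field_simps)
      qed
      have sm: "smooth (\<lambda>r. complex_of_real (\<beta> s r))" for s
      proof -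
        have "(\<lambda>r::real. complex_of_real ((r - s)\<^sup>2 / \<delta>\<^sup>2)) =
           (\<lambda>r. (complex_of_real (r \<bullet> 1) + of_real (- s)) * (complex_of_real (r \<bullet> 1) + of_real (- s)) * of_real (1 / \<delta>\<^sup>2))"
          by (auto simp: power2_eq_square)
        moreover have "smooth (\<lambda>r. (complex_of_real (r \<bullet> 1) + of_real (- s)) * (complex_of_real (r \<bullet> 1) + of_real (- s)) * of_real (1 / \<delta>\<^sup>2))"
          by (intro smooth_mult smooth_add smooth_const smooth_inner_right)
        ultimately have "smooth (\<lambda>r::real. complex_of_real ((r - s)\<^sup>2 / \<delta>\<^sup>2))" by (simp only:)
        then show ?thesis unfolding \<beta>_def by (rule smooth_bump)
      qed
      have I\<beta>: "(\<beta> s has_integral Z) {a..b}" if "a \<le> s - \<delta>" "s + \<delta> \<le> b" for s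
      proof -
        have "(\<beta> s has_integral (B (b - s) - B (a - s))) {a..b}"
          using Bd ab by (intro fundamental_theorem_of_calculus)
             (auto simp: has_real_derivative_iff_has_vector_derivative[symmetric] intro: has_field_derivative_at_within)
        then show ?thesis using B(3)[of "a - s"] B(4)[of "b - s"] that by simp
      qed
      \<comment> \<open>The two bumps have the same integral \<open>Z\<close>, so this primitive of
        their difference returns to 0 on the right.\<close>
      define \<theta> where "\<theta> r = B (r - t1) - B (r - t2)" for r
      define \<theta>' where "\<theta>' r = \<beta> t1 r - \<beta> t2 r" for r
      have \<theta>': "(\<theta> has_real_derivative \<theta>' r) (at r)" for r
        unfolding \<theta>_def \<theta>'_def by (intro derivative_intros Bd)
      have "smooth (\<lambda>r. complex_of_real (\<beta> t1 r) + of_real (-1) * complex_of_real (\<beta> t2 r))"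
        by (intro smooth_add smooth_mult smooth_const sm)
      then have "smooth (\<lambda>r. complex_of_real (\<theta>' r))" by (simp add: \<theta>'_def)
      with \<theta>' have s\<theta>: "smooth (\<lambda>r. complex_of_real (\<theta> r))" by (rule smooth_real_antiderivative(1))
      have \<theta>0: "\<theta> r = 0" if "r \<notin> {a<..<b}" for r
      proof (cases "r \<le> a")
        case True
        then show ?thesis unfolding \<theta>_def using B(3)[of "r - t1"] B(3)[of "r - t2"] \<delta> t12 by simp
      next
        case False
        then show ?thesis unfolding \<theta>_def using that B(4)[of "r - t1"] B(4)[of "r - t2"] \<delta> t12 by simp
      qed
      have \<theta>c: "continuous_on {a..b} \<theta>" "continuous_on {a..b} \<theta>'"
        unfolding \<theta>'_def using \<theta>' by (auto intro!: continuous_intros \<beta>c) (meson DERIV_isCont continuous_at_imp_continuous_on)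
      have w: "integral {a..b} (\<lambda>r. - \<i> * \<theta>' r * h r + \<theta> r * g r) = 0"
        using ab by (intro test s\<theta> \<theta>' \<theta>0) auto
      have "((\<lambda>r. \<theta> r *\<^sub>R G r) has_vector_derivative (\<theta> r *\<^sub>R g r + \<theta>' r *\<^sub>R G r)) (at r within {a..b})" if "r \<in> {a..b}" for r
        using that by (intro has_vector_derivative_scaleR G has_field_derivative_at_within[OF \<theta>'])
      then have "((\<lambda>r. \<theta> r *\<^sub>R g r + \<theta>' r *\<^sub>R G r) has_integral (\<theta> b *\<^sub>R G b - \<theta> a *\<^sub>R G a)) {a..b}"
        using ab by (intro fundamental_theorem_of_calculus) auto
      then have p: "((\<lambda>r. \<theta> r * g r + \<theta>' r * G r) has_integral 0) {a..b}"
        using \<theta>0[of a] \<theta>0[of b] by (simp add: scaleR_conv_of_real)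
      have "((\<lambda>r. - \<i> * \<theta>' r * h r + \<theta> r * g r) has_integral 0) {a..b}"
        unfolding w[symmetric]
        by (intro integrable_integral integrable_continuous_real continuous_intros \<theta>c
            continuous_on_subset[OF g sub] continuous_on_subset[OF h sub])
      \<comment> \<open>Integration by parts has moved the derivative from \<open>G\<close> to
        \<open>\<theta>\<close>; subtracting the weak equation cancels \<theta> g and leaves
        \<open>l\<close> alone.\<close>
      from has_integral_diff[OF p this] have int0: "((\<lambda>r. \<theta>' r * l r) has_integral 0) {a..b}"
        by (simp add: l_def algebra_simps)
      have *: "((\<lambda>r. \<beta> s r * (l s - l r)) has_integral (Z * l s - integral {a..b} (\<lambda>r. \<beta> s r * l r))) {a..b}"
        if "a \<le> s - \<delta>" "s + \<delta> \<le> b" for s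
      proof -
        have "((\<lambda>r. complex_of_real (\<beta> s r)) has_integral of_real Z) {a..b}"
          using has_integral_of_real[OF I\<beta>[OF that]] .
        from has_integral_mult_left[OF this, of "l s"]
        have 1: "((\<lambda>r. \<beta> s r * l s) has_integral Z * l s) {a..b}" .
        have 2: "((\<lambda>r. \<beta> s r * l r) has_integral integral {a..b} (\<lambda>r. \<beta> s r * l r)) {a..b}"
          by (intro integrable_integral integrable_continuous_real continuous_intros lc \<beta>c)
        show ?thesis using has_integral_diff[OF 1 2] by (simp add: right_diff_distrib)
      qed
      have err: "norm (Z * l s - integral {a..b} (\<lambda>r. \<beta> s r * l r)) \<le> e / 2 * Z"
        if s: "a \<le> s - \<delta>" "s + \<delta> \<le> b" and d: "\<delta> < d" "\<And>r. r \<in> {a..b} \<Longrightarrow> dist r s < d \<Longrightarrow> dist (l r) (l s) < e/2" for s d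
      proof -
        have "norm (integral {a..b} (\<lambda>r. \<beta> s r * (l s - l r))) \<le> integral {a..b} (\<lambda>r. e / 2 * \<beta> s r)"
        proof (rule integral_norm_bound_integral)
          show "(\<lambda>r. \<beta> s r * (l s - l r)) integrable_on {a..b}" using *[OF s] by blast
          show "(\<lambda>r. e / 2 * \<beta> s r) integrable_on {a..b}" using has_integral_mult_right[OF I\<beta>[OF s], of "e/2"] by blast
          fix r assume r: "r \<in> {a..b}"
          show "norm (\<beta> s r * (l s - l r)) \<le> e / 2 * \<beta> s r"
          proof (cases "\<bar>r - s\<bar> < \<delta>")
            case True
            then have "norm (l s - l r) \<le> e / 2" using d(2)[OF r] d(1) by (simp add: dist_norm norm_minus_commute less_imp_le)
            moreover have "\<beta> s r \<ge> 0" by (simp add: \<beta>_def bump_nonneg)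
            ultimately have "\<beta> s r * norm (l s - l r) \<le> \<beta> s r * (e / 2)" by (rule mult_left_mono)
            then show ?thesis using \<open>\<beta> s r \<ge> 0\<close> by (simp add: norm_mult mult.commute)
          next
            case False then show ?thesis using \<beta>0[of r s] by simp
          qed
        qed
        also have "\<dots> = e / 2 * Z" using I\<beta>[OF s] by (simp add: integral_unique)
        finally show ?thesis using *[OF s] by (simp add: integral_unique)
      qed
      \<comment> \<open>The bump-weighted integrals of \<open>l\<close> at the two points agree, and
        each differs from \<open>Z\<close> times the value of \<open>l\<close> there by at most e
        Z/2.\<close>
      have "integral {a..b} (\<lambda>r. \<beta> t1 r * l r) - integral {a..b} (\<lambda>r. \<beta> t2 r * l r)
         = integral {a..b} (\<lambda>r. \<theta>' r * l r)"
        unfolding \<theta>'_def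
        by (subst integral_diff[symmetric]) (auto intro!: integrable_continuous_real continuous_intros lc \<beta>c simp: left_diff_distrib)
      then have "integral {a..b} (\<lambda>r. \<beta> t1 r * l r) = integral {a..b} (\<lambda>r. \<beta> t2 r * l r)"
        using int0 by (simp add: integral_unique)
      then have "Z * (l t1 - l t2) = (Z * l t1 - integral {a..b} (\<lambda>r. \<beta> t1 r * l r)) - (Z * l t2 - integral {a..b} (\<lambda>r. \<beta> t2 r * l r))"
        by (simp add: right_diff_distrib)
      also have "norm \<dots> \<le> norm (Z * l t1 - integral {a..b} (\<lambda>r. \<beta> t1 r * l r)) + norm (Z * l t2 - integral {a..b} (\<lambda>r. \<beta> t2 r * l r))"
        by (rule norm_triangle_ineq4)
      also have "\<dots> \<le> e / 2 * Z + e / 2 * Z"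
        using \<delta> d1 d2 t12 by (intro add_mono err[of t1 d1] err[of t2 d2]) auto
      also have "\<dots> = Z * e" by (simp add: algebra_simps)
      finally have "Z * norm (l t1 - l t2) \<le> Z * e" using B(1) by (simp only: norm_mult norm_of_real abs_of_pos)
      then show ?thesis using B(1) by simp
    qed
    then have "norm (l t1 - l t2) \<le> 0" by (rule field_le_epsilon) (simp only: add_0)
    then show ?thesis by simp
  qed
  have c: "l s = l t" if "s \<in> {a<..<b}" for s
    using eq[of s t] eq[of t s] that ab by (metis greaterThanLessThan_iff linorder_less_linear)
  \<comment> \<open>With \<open>l\<close> constant, \<open>h\<close> is recovered from the classical
    primitive \<open>G\<close>, which is differentiable because \<open>g\<close> is
    continuous.\<close>
  have "((\<lambda>s. - \<i> * (l t - G s)) has_vector_derivative \<i> * g t) (at t within {a..b})"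
    using has_vector_derivative_mult_right[OF has_vector_derivative_diff[OF has_vector_derivative_const G[of t]], of "- \<i>" "l t"] ab by simp
  then have "((\<lambda>s. - \<i> * (l t - G s)) has_vector_derivative \<i> * g t) (at t)"
    using ab by (simp add: at_within_Icc_at)
  then show ?thesis
  proof (rule has_vector_derivative_transform_within_open[where S="{a<..<b}"])
    fix s assume "s \<in> {a<..<b}"
    then have "l t - G s = \<i> * h s" using c[of s] unfolding l_def[of s] by (metis add_diff_cancel_right')
    then show "- \<i> * (l t - G s) = h s" by simp
  qed (use ab in auto)
qed

section \<open>Test functions with separated time and space variables\<close>

definition lap :: "('a::euclidean_space \<Rightarrow> complex) \<Rightarrow> 'a \<Rightarrow> complex" where
  "lap f x = (\<Sum>b\<in>Basis. dir_deriv b (dir_deriv b f) x)"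

lemma dir_deriv_eq_0:
  assumes "open S" "x \<in> S" "\<And>y. y \<in> S \<Longrightarrow> f y = 0"
  shows "dir_deriv b f x = 0"
proof -
  have "(f has_derivative (\<lambda>v. 0)) (at x)"
    by (rule has_derivative_transform_within_open[OF has_derivative_const assms(1,2)]) (use assms(3) in auto)
  then show ?thesis by (rule dir_deriv_eqI)
qed

lemma lap_eq_0:
  assumes "\<And>y. norm y > R \<Longrightarrow> f y = 0" "norm x > R"
  shows "lap f x = 0"
proof -
  have S: "open {y::'a. norm y > R}" by (simp add: open_Collect_less continuous_on_norm_id)
  have 1: "dir_deriv b f y = 0" if "norm y > R" for b y
    using assms that by (intro dir_deriv_eq_0[OF S]) auto
  have "dir_deriv b (dir_deriv b f) x = 0" for b
    using assms 1 by (intro dir_deriv_eq_0[OF S]) auto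
  then show ?thesis by (simp add: lap_def)
qed

lemma continuous_compact_support_bound:
  fixes f :: "'a::euclidean_space \<Rightarrow> complex"
  assumes "continuous_on UNIV f" "\<And>y. norm y > R \<Longrightarrow> f y = 0"
  obtains B where "\<And>x. norm (f x) \<le> B * indicator (cball 0 R) x"
proof -
  have "compact (f ` cball 0 R)"
    using assms by (auto intro!: compact_continuous_image continuous_on_subset[of UNIV f])
  then obtain B where B: "\<And>x. norm x \<le> R \<Longrightarrow> norm (f x) \<le> B"
    using compact_imp_bounded bounded_iff by (metis imageI mem_cball_0)
  have "norm (f x) \<le> B * indicator (cball 0 R) x" for x
    using B[of x] assms(2)[of x] by (cases "norm x \<le> R") auto
  then show ?thesis using that by blast
qed

lemma smooth_lap: "smooth f \<Longrightarrow> smooth (lap f)"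
proof -
  assume f: "smooth f"
  have "smooth (\<lambda>x. \<Sum>b\<in>B. dir_deriv b (dir_deriv b f) x)" if "finite B" "B \<subseteq> Basis" for B
    using that by (induction B rule: finite_induct) (auto intro!: smooth_dir_deriv f)
  then show ?thesis by (simp add: lap_def[abs_def])
qed

lemma dir_deriv_tensor:
  fixes f :: "'a::euclidean_space \<Rightarrow> complex" and g :: "'b::euclidean_space \<Rightarrow> complex"
  assumes f: "\<And>x. f differentiable (at x)" and g: "\<And>x. g differentiable (at x)"
  shows "dir_deriv (v, w) (\<lambda>z. f (fst z) * g (snd z)) = (\<lambda>z. f (fst z) * dir_deriv w g (snd z) + dir_deriv v f (fst z) * g (snd z))"
proof -
  have 1: "((\<lambda>z. f (fst z)) has_derivative (\<lambda>h. dir_deriv (fst h) f (fst z))) (at z)" for z :: "'a \<times> 'b"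
    by (rule has_derivative_compose[OF bounded_linear_imp_has_derivative[OF bounded_linear_fst] has_derivative_dir_deriv[OF f]])
  have 2: "((\<lambda>z. g (snd z)) has_derivative (\<lambda>h. dir_deriv (snd h) g (snd z))) (at z)" for z :: "'a \<times> 'b"
    by (rule has_derivative_compose[OF bounded_linear_imp_has_derivative[OF bounded_linear_snd] has_derivative_dir_deriv[OF g]])
  show ?thesis using dir_derivI[OF has_derivative_mult[OF 1 2], of "(v,w)"] by simp
qed

context decaying_nls begin

lemma pairing_continuous:
  assumes F: "admissible F" and c: "continuous_on UNIV \<eta>" and s: "\<And>x. norm x > R \<Longrightarrow> \<eta> x = 0"
  shows "continuous_on {0<..} (\<lambda>t. LINT x|lborel. F (u t x) * \<eta> x)"
proof -
  obtain B where "\<And>x. norm (\<eta> x) \<le> B * indicator (cball 0 R) x"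
    using continuous_compact_support_bound[OF c s] by blast
  moreover have "\<eta> \<in> borel_measurable borel" using c by (rule borel_measurable_continuous_onI)
  ultimately show ?thesis
    unfolding continuous_on_sequentially o_def by (auto intro!: pairing_tendsto[OF F])
qed

lemma integrable_pairing_continuous:
  assumes F: "admissible F" and "t > 0" and c: "continuous_on UNIV \<eta>" and s: "\<And>x. norm x > R \<Longrightarrow> \<eta> x = 0"
  shows "integrable lborel (\<lambda>x. F (u t x) * \<eta> x)"
proof -
  obtain B where "\<And>x. norm (\<eta> x) \<le> B * indicator (cball 0 R) x"
    using continuous_compact_support_bound[OF c s] by blast
  then show ?thesis using assms by (intro integrable_pairing[OF F]) (auto intro: borel_measurable_continuous_onI)
qed

text \<open>Testing with \<theta>(t) \<eta>(x) turns the distributional equation into a weak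
  ordinary differential equation for the pairing. Both sides are continuous in time, so it holds
  classically at every time.\<close>

lemma pairing_has_derivative:
  assumes \<eta>: "smooth \<eta>" and supp: "\<And>x. norm x > R \<Longrightarrow> \<eta> x = 0" and t: "t > 0"
  shows "((\<lambda>t. LINT x|lborel. u t x * \<eta> x) has_vector_derivative
     \<i> * ((LINT x|lborel. u t x * lap \<eta> x) + lam * (LINT x|lborel. nonlinearity \<alpha> (u t x) * \<eta> x))) (at t)"
proof (rule weak_derivative_imp_derivative[OF _ _ _ t])
  note l = smooth_continuous[OF smooth_lap[OF \<eta>]] lap_eq_0[where R=R and f=\<eta>, OF supp]
  note e = smooth_continuous[OF \<eta>] supp
  show h: "continuous_on {0<..} (\<lambda>t. LINT x|lborel. u t x * \<eta> x)"
    by (rule pairing_continuous[OF admissible_id e])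
  show g: "continuous_on {0<..} (\<lambda>t. (LINT x|lborel. u t x * lap \<eta> x) + lam * (LINT x|lborel. nonlinearity \<alpha> (u t x) * \<eta> x))"
    by (intro continuous_intros pairing_continuous[OF admissible_id l] pairing_continuous[OF admissible_nonlinearity e])
  fix \<theta> \<theta>' :: "real \<Rightarrow> real" and a b :: real
  assume ab: "0 < a" "a < b" and \<theta>: "smooth (\<lambda>r. complex_of_real (\<theta> r))"
    and \<theta>': "\<And>r. (\<theta> has_real_derivative \<theta>' r) (at r)" and \<theta>0: "\<And>r. r \<notin> {a..b} \<Longrightarrow> \<theta> r = 0"
  let ?\<Theta> = "\<lambda>r. complex_of_real (\<theta> r)"
  have d\<theta>: "dir_deriv 1 ?\<Theta> = (\<lambda>r. complex_of_real (\<theta>' r))"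
  proof -
    have "(?\<Theta> has_derivative (\<lambda>h. complex_of_real (\<theta>' v * h))) (at v)" for v
      by (intro has_derivative_of_real) (use \<theta>' in \<open>auto simp: has_field_derivative_def\<close>)
    from dir_derivI[OF this, of 1] show ?thesis by simp
  qed
  define \<psi> where "\<psi> z = ?\<Theta> (fst z) * \<eta> (snd z)" for z :: "real \<times> 'a"
  have psi: "\<psi> = (\<lambda>z. ?\<Theta> (fst z) * \<eta> (snd z))" by (simp add: fun_eq_iff \<psi>_def)
  note D = dir_deriv_tensor[OF smooth_differentiable[OF \<theta>]]
  have td: "time_deriv \<psi> (t, x) = \<theta>' t * \<eta> x" for t x
    unfolding time_deriv_def psi D[OF smooth_differentiable[OF \<eta>]] d\<theta>
    using smooth_differentiable[OF \<eta>] by (simp add: dir_deriv_zero)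
  have sl: "space_laplacian \<psi> (t, x) = \<theta> t * lap \<eta> x" for t x
  proof -
    have "dir_deriv (0, b) (dir_deriv (0, b) \<psi>) (t, x) = \<theta> t * dir_deriv b (dir_deriv b \<eta>) x" if "b \<in> Basis" for b
    proof -
      have 1: "dir_deriv (0, b) \<psi> = (\<lambda>z. ?\<Theta> (fst z) * dir_deriv b \<eta> (snd z))"
        unfolding psi D[OF smooth_differentiable[OF \<eta>]]
        by (simp add: dir_deriv_zero smooth_differentiable[OF \<theta>])
      show ?thesis unfolding 1 D[OF smooth_differentiable[OF smooth_dir_deriv[OF \<eta> that]]]
        by (simp add: dir_deriv_zero smooth_differentiable[OF \<theta>])
    qed
    then show ?thesis unfolding space_laplacian_def lap_def by (simp add: sum_distrib_left)
  qed
  have "smooth \<psi>"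
    unfolding psi
    by (intro smooth_mult smooth_compose_linear[OF bounded_linear_fst _ \<theta>] smooth_compose_linear[OF bounded_linear_snd _ \<eta>])
       (auto simp: Basis_prod_def)
  moreover have cl: "closure {z. \<psi> z \<noteq> 0} \<subseteq> {a..b} \<times> cball 0 R"
  proof (rule closure_minimal)
    show "{z. \<psi> z \<noteq> 0} \<subseteq> {a..b} \<times> cball 0 R"
    proof
      fix z assume "z \<in> {z. \<psi> z \<noteq> 0}"
      then have "\<theta> (fst z) \<noteq> 0" "\<eta> (snd z) \<noteq> 0" by (auto simp: \<psi>_def)
      then have "fst z \<in> {a..b}" "norm (snd z) \<le> R" using \<theta>0[of "fst z"] supp[of "snd z"] by fastforce+
      then show "z \<in> {a..b} \<times> cball 0 R" by (cases z) auto
    qed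
  qed (intro closed_Times closed_cball closed_atLeastAtMost)
  moreover have "compact (closure {z. \<psi> z \<noteq> 0})"
    by (rule compact_Int_closed[of "{a..b} \<times> cball 0 R" "closure {z. \<psi> z \<noteq> 0}", simplified Int_absorb1[OF cl]])
       (intro compact_Times compact_cball compact_Icc closed_closure)+
  ultimately have "test_function ({0<..} \<times> UNIV) \<psi>"
    using ab unfolding test_function_def smooth_def by (auto dest!: subsetD)
  from nls_eq[OF this] have eq: "(LINT t|lebesgue. LINT x|lborel. - \<i> * u t x * (\<theta>' t * \<eta> x)
       + u t x * (\<theta> t * lap \<eta> x) + of_real lam * nonlinearity \<alpha> (u t x) * (\<theta> t * \<eta> x)) = 0"
    unfolding td sl by (simp add: \<psi>_def mult.assoc)
  let ?f = "\<lambda>t. - \<i> * \<theta>' t * (LINT x|lborel. u t x * \<eta> x) +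
     \<theta> t * ((LINT x|lborel. u t x * lap \<eta> x) + lam * (LINT x|lborel. nonlinearity \<alpha> (u t x) * \<eta> x))"
  have inner: "(LINT x|lborel. - \<i> * u t x * (\<theta>' t * \<eta> x)
       + u t x * (\<theta> t * lap \<eta> x) + of_real lam * nonlinearity \<alpha> (u t x) * (\<theta> t * \<eta> x))
     = ?f t" if t: "t > 0" for t
  proof -
    note i = integrable_pairing_continuous[OF admissible_id t e, where R=R] integrable_pairing_continuous[OF admissible_id t l, where R=R]
      integrable_pairing_continuous[OF admissible_nonlinearity t e, where R=R]
    have "(LINT x|lborel. - \<i> * u t x * (\<theta>' t * \<eta> x)
       + u t x * (\<theta> t * lap \<eta> x) + of_real lam * nonlinearity \<alpha> (u t x) * (\<theta> t * \<eta> x))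
     = (LINT x|lborel. (- \<i> * \<theta>' t) * (u t x * \<eta> x)
       + \<theta> t * (u t x * lap \<eta> x) + (\<theta> t * lam) * (nonlinearity \<alpha> (u t x) * \<eta> x))"
      by (intro Bochner_Integration.integral_cong) (auto simp: algebra_simps)
    also have "\<dots> = ?f t"
      by (subst Bochner_Integration.integral_add Bochner_Integration.integral_add,
          (intro Bochner_Integration.integrable_add integrable_mult_right i; assumption)+)+
        (simp only: integral_mult_right_zero ring_distribs mult.assoc add.assoc of_real_mult)
    finally show ?thesis .
  qed
  have \<theta>'0: "\<theta>' r = 0" if "r \<notin> {a..b}" for r
  proof -
    have "((\<lambda>_. 0) has_real_derivative 0) (at r)" by simp
    then have "(\<theta> has_real_derivative 0) (at r)"
      by (rule has_field_derivative_transform_within_open[where S="- {a..b}"]) (use \<theta>0 that in auto)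
    with \<theta>' show ?thesis using DERIV_unique by blast
  qed
  \<comment> \<open>Outside [a,b] the factors \<theta> and \<theta>' vanish, which also removes the
    times t \<le> 0, where nothing is known about \<open>u\<close>.\<close>
  have "(LINT t|lebesgue. indicator {a..b} t *\<^sub>R ?f t) = 0"
    unfolding eq[symmetric]
  proof (intro Bochner_Integration.integral_cong refl)
    fix t
    show "indicator {a..b} t *\<^sub>R ?f t = (LINT x|lborel. - \<i> * u t x * (\<theta>' t * \<eta> x)
       + u t x * (\<theta> t * lap \<eta> x) + of_real lam * nonlinearity \<alpha> (u t x) * (\<theta> t * \<eta> x))"
    proof (cases "t \<in> {a..b}")
      case True
      then show ?thesis using inner[of t] ab by simp
    next
      case False
      then show ?thesis using \<theta>0[OF False] \<theta>'0[OF False] by simp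
    qed
  qed
  then have z: "set_lebesgue_integral lebesgue {a..b} ?f = 0"
    by (simp add: set_lebesgue_integral_def)
  have sub: "{a..b} \<subseteq> {0<..}" using ab by auto
  have "smooth (\<lambda>r. complex_of_real (\<theta>' r))"
    using smooth_dir_deriv[OF \<theta>, of 1] d\<theta> by simp
  then have c': "continuous_on {a..b} (\<lambda>r. complex_of_real (\<theta>' r))" "continuous_on {a..b} ?\<Theta>"
    using smooth_continuous \<theta> continuous_on_subset by blast+
  have "continuous_on {a..b} ?f"
    by (intro continuous_on_add continuous_on_mult continuous_on_const c' continuous_on_subset[OF h sub] continuous_on_subset[OF g sub])
  then have "set_integrable lebesgue {a..b} ?f"
    by (rule absolutely_integrable_continuous_real)
  from set_lebesgue_integral_eq_integral(2)[OF this] z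
  show "integral {a..b} ?f = 0" by simp
qed

end

section \<open>Kernels and the double pairing\<close>

text \<open>The mean value inequality bounds all difference quotients by the majorant
  \<open>g\<close> of the derivatives; dominated convergence along sequences does the rest.\<close>

lemma has_vector_derivative_integral:
  fixes f f' :: "real \<Rightarrow> 'b \<Rightarrow> complex"
  assumes t0: "t0 \<in> {l<..<r}"
    and int: "\<And>t. t \<in> {l<..<r} \<Longrightarrow> integrable M (f t)"
    and d: "\<And>t x. t \<in> {l<..<r} \<Longrightarrow> ((\<lambda>t. f t x) has_vector_derivative f' t x) (at t)"
    and b: "\<And>t x. t \<in> {l<..<r} \<Longrightarrow> norm (f' t x) \<le> g x" and g: "integrable M g"
    and m: "f' t0 \<in> borel_measurable M"
  shows "((\<lambda>t. LINT x|M. f t x) has_vector_derivative (LINT x|M. f' t0 x)) (at t0)"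
proof -
  let ?I = "{l<..<r}"
  let ?q = "\<lambda>s x. (f s x - f t0 x) /\<^sub>R (s - t0)"
  have eq: "(h has_vector_derivative D) (at t0) \<longleftrightarrow> ((\<lambda>s. (h s - h t0) /\<^sub>R (s - t0)) \<longlongrightarrow> D) (at t0)" for h :: "real \<Rightarrow> complex" and D
  proof -
    have "norm (((h s - h t0) - (s - t0) *\<^sub>R D) /\<^sub>R norm (s - t0)) = norm ((h s - h t0) /\<^sub>R (s - t0) - D)" if "s \<noteq> t0" for s
    proof -
      have "(h s - h t0) /\<^sub>R (s - t0) - D = ((h s - h t0) - (s - t0) *\<^sub>R D) /\<^sub>R (s - t0)"
        using that by (simp add: scaleR_diff_right)
      then show ?thesis by simp
    qed
    then have "((\<lambda>s. norm (((h s - h t0) - (s - t0) *\<^sub>R D) /\<^sub>R norm (s - t0))) \<longlongrightarrow> 0) (at t0) \<longleftrightarrow>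
      ((\<lambda>s. norm ((h s - h t0) /\<^sub>R (s - t0) - D)) \<longlongrightarrow> 0) (at t0)"
      by (intro Lim_cong_within) auto
    then show ?thesis
      unfolding has_vector_derivative_def has_derivative_at_within tendsto_norm_zero_iff Lim_null[of _ D]
      by (simp add: bounded_linear_scaleR_left)
  qed
  have T: "((\<lambda>s. LINT x|M. ?q s x) \<longlongrightarrow> (LINT x|M. f' t0 x)) (at t0 within ?I)"
    unfolding tendsto_at_iff_sequentially o_def
  proof (intro allI impI)
    fix X :: "nat \<Rightarrow> real" assume X: "\<forall>i. X i \<in> ?I - {t0}" "X \<longlonglongrightarrow> t0"
    have l: "(\<lambda>n. ?q (X n) x) \<longlonglongrightarrow> f' t0 x" for x
      using d[OF t0, of x, unfolded eq] X unfolding tendsto_at_iff_sequentially o_def by auto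
    have [measurable]: "f (X n) \<in> borel_measurable M" "f t0 \<in> borel_measurable M" "f' t0 \<in> borel_measurable M" for n
      using int X t0 m by auto
    have "norm (?q (X n) x) \<le> g x" for n x
    proof -
      have "norm (f (X n) x - f t0 x) \<le> g x * norm (X n - t0)"
      proof (rule differentiable_bound[where S="?I" and f'="\<lambda>t h. h *\<^sub>R f' t x"])
        show "((\<lambda>t. f t x) has_derivative (\<lambda>h. h *\<^sub>R f' t x)) (at t within ?I)" if "t \<in> ?I" for t
          using d[OF that, of x] by (auto simp: has_vector_derivative_def intro: has_derivative_at_withinI)
        show "onorm (\<lambda>h. h *\<^sub>R f' t x) \<le> g x" if "t \<in> ?I" for t
          using b[OF that, of x] by (intro onorm_le) (auto simp: mult.commute mult_left_mono)
      qed (use X t0 in auto)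
      moreover have "\<bar>X n - t0\<bar> > 0" using X(1) by (metis Diff_iff singletonI zero_less_abs_iff right_minus_eq)
      ultimately show ?thesis
        by (simp only: norm_scaleR abs_inverse real_norm_def mult.commute[of "inverse _"] divide_inverse[symmetric] pos_divide_le_eq)
    qed
    then show "(\<lambda>n. LINT x|M. ?q (X n) x) \<longlonglongrightarrow> (LINT x|M. f' t0 x)"
      using l g by (intro integral_dominated_convergence[where w=g]) auto
  qed
  have W: "at t0 within ?I = at t0" using t0 by (intro at_within_open) auto
  have Ev: "eventually (\<lambda>s. (LINT x|M. ?q s x) = ((LINT x|M. f s x) - (LINT x|M. f t0 x)) /\<^sub>R (s - t0)) (at t0)"
    using eventually_at_in_open[of ?I t0] t0
    by (auto elim!: eventually_mono simp: int Bochner_Integration.integral_diff)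
  have "((\<lambda>s. ((LINT x|M. f s x) - (LINT x|M. f t0 x)) /\<^sub>R (s - t0)) \<longlongrightarrow> (LINT x|M. f' t0 x)) (at t0)"
    by (rule Lim_transform_eventually[OF T[unfolded W] Ev])
  then show ?thesis by (simp add: eq)
qed

text \<open>In the quantity to be differentiated time occurs three times: in each copy of
  \<open>u\<close> and in the kernel. Every slot can be treated with the other two frozen;
  continuity of the partial derivatives at the diagonal point allows adding them up.\<close>

lemma has_vector_derivative_diagonal:
  fixes H A B C :: "real \<Rightarrow> real \<Rightarrow> real \<Rightarrow> 'b::real_normed_vector"
  assumes t: "t \<in> {l<..<r}"
    and A: "\<And>t1 t2 t3. t1 \<in> {l<..<r} \<Longrightarrow> t2 \<in> {l<..<r} \<Longrightarrow> t3 \<in> {l<..<r} \<Longrightarrow> ((\<lambda>t1. H t1 t2 t3) has_vector_derivative A t1 t2 t3) (at t1)"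
    and B: "\<And>t1 t2 t3. t1 \<in> {l<..<r} \<Longrightarrow> t2 \<in> {l<..<r} \<Longrightarrow> t3 \<in> {l<..<r} \<Longrightarrow> ((\<lambda>t2. H t1 t2 t3) has_vector_derivative B t1 t2 t3) (at t2)"
    and C: "\<And>t1 t2 t3. t1 \<in> {l<..<r} \<Longrightarrow> t2 \<in> {l<..<r} \<Longrightarrow> t3 \<in> {l<..<r} \<Longrightarrow> ((\<lambda>t3. H t1 t2 t3) has_vector_derivative C t1 t2 t3) (at t3)"
    and Ac: "((\<lambda>(t1,t2,t3). A t1 t2 t3) \<longlongrightarrow> A t t t) (at (t,t,t))"
    and Bc: "((\<lambda>(t1,t2,t3). B t1 t2 t3) \<longlongrightarrow> B t t t) (at (t,t,t))"
    and Cc: "((\<lambda>(t1,t2,t3). C t1 t2 t3) \<longlongrightarrow> C t t t) (at (t,t,t))"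
  shows "((\<lambda>t. H t t t) has_vector_derivative (A t t t + B t t t + C t t t)) (at t)"
proof -
  let ?D = "A t t t + B t t t + C t t t"
  have near: "\<exists>d>0. \<forall>t1 t2 t3. \<bar>t1 - t\<bar> < d \<longrightarrow> \<bar>t2 - t\<bar> < d \<longrightarrow> \<bar>t3 - t\<bar> < d \<longrightarrow> norm (F t1 t2 t3 - F t t t) \<le> e"
    if lim: "((\<lambda>(t1,t2,t3). F t1 t2 t3) \<longlongrightarrow> F t t t) (at (t,t,t))" and e: "e > 0"
    for F :: "real \<Rightarrow> real \<Rightarrow> real \<Rightarrow> 'b" and e
  proof -
    have "((\<lambda>(t1,t2,t3). F t1 t2 t3) \<longlongrightarrow> F t t t) (nhds (t,t,t))"
      using lim by (simp add: tendsto_nhds_iff)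
    from tendstoD[OF this e] obtain d where d: "d > 0" "\<And>z. dist z (t,t,t) < d \<Longrightarrow> dist (case z of (t1,t2,t3) \<Rightarrow> F t1 t2 t3) (F t t t) < e"
      unfolding eventually_nhds_metric by blast
    have "norm (F t1 t2 t3 - F t t t) \<le> e" if "\<bar>t1 - t\<bar> < d/3" "\<bar>t2 - t\<bar> < d/3" "\<bar>t3 - t\<bar> < d/3" for t1 t2 t3
    proof -
      have "dist (t1,t2,t3) (t,t,t) \<le> \<bar>t1 - t\<bar> + (\<bar>t2 - t\<bar> + \<bar>t3 - t\<bar>)"
        unfolding dist_Pair_Pair dist_real_def
        by (rule order_trans[OF sqrt_sum_squares_le_sum_abs]) (auto intro!: order_trans[OF sqrt_sum_squares_le_sum_abs])
      also have "\<dots> < d" using that by linarith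
      finally show ?thesis using d(2)[of "(t1,t2,t3)"] by (simp add: dist_norm)
    qed
    then show ?thesis using d(1) by (intro exI[of _ "d/3"]) auto
  qed
  show ?thesis
    unfolding has_vector_derivative_def has_derivative_within_alt
  proof (intro conjI allI impI)
    show "bounded_linear (\<lambda>x. x *\<^sub>R ?D)" by (rule bounded_linear_scaleR_left)
    fix e :: real assume "e > 0"
    then have e: "e / 3 > 0" by simp
    obtain da where da: "da > 0" "\<And>t1 t2 t3. \<bar>t1 - t\<bar> < da \<Longrightarrow> \<bar>t2 - t\<bar> < da \<Longrightarrow> \<bar>t3 - t\<bar> < da \<Longrightarrow> norm (A t1 t2 t3 - A t t t) \<le> e/3"
      using near[OF Ac e] by blast
    obtain db where db: "db > 0" "\<And>t1 t2 t3. \<bar>t1 - t\<bar> < db \<Longrightarrow> \<bar>t2 - t\<bar> < db \<Longrightarrow> \<bar>t3 - t\<bar> < db \<Longrightarrow> norm (B t1 t2 t3 - B t t t) \<le> e/3"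
      using near[OF Bc e] by blast
    obtain dc where dc: "dc > 0" "\<And>t1 t2 t3. \<bar>t1 - t\<bar> < dc \<Longrightarrow> \<bar>t2 - t\<bar> < dc \<Longrightarrow> \<bar>t3 - t\<bar> < dc \<Longrightarrow> norm (C t1 t2 t3 - C t t t) \<le> e/3"
      using near[OF Cc e] by blast
    define d where "d = Min {da, db, dc, t - l, r - t}"
    have d: "d > 0" "d \<le> da" "d \<le> db" "d \<le> dc" "d \<le> t - l" "d \<le> r - t"
      using da db dc t by (auto simp: d_def)
    have main: "norm (f s - f t - (s - t) *\<^sub>R c) \<le> e / 3 * \<bar>s - t\<bar>"
      if s: "\<bar>s - t\<bar> < d" and f: "\<And>x. x \<in> {t-d<..<t+d} \<Longrightarrow> (f has_vector_derivative f' x) (at x)"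
       and b: "\<And>x. x \<in> {t-d<..<t+d} \<Longrightarrow> norm (f' x - c) \<le> e / 3" for f f' :: "real \<Rightarrow> 'b" and c s
    proof -
      have "norm ((\<lambda>x. f x - x *\<^sub>R c) s - (\<lambda>x. f x - x *\<^sub>R c) t) \<le> e / 3 * norm (s - t)"
      proof (rule differentiable_bound[where S="{t-d<..<t+d}" and f'="\<lambda>x h. h *\<^sub>R (f' x - c)"])
        fix x assume x: "x \<in> {t-d<..<t+d}"
        have "((\<lambda>x. f x - x *\<^sub>R c) has_vector_derivative (f' x - 1 *\<^sub>R c)) (at x)"
          by (intro has_vector_derivative_diff f x) (auto intro!: derivative_eq_intros)
        then show "((\<lambda>x. f x - x *\<^sub>R c) has_derivative (\<lambda>h. h *\<^sub>R (f' x - c))) (at x within {t-d<..<t+d})"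
          by (auto simp: has_vector_derivative_def intro: has_derivative_at_withinI)
        show "onorm (\<lambda>h. h *\<^sub>R (f' x - c)) \<le> e / 3"
        proof (rule onorm_le)
          fix h
          show "norm (h *\<^sub>R (f' x - c)) \<le> e / 3 * norm h"
            using mult_left_mono[OF b[OF x] abs_ge_zero[of h]]
            unfolding norm_scaleR real_norm_def by (simp only: mult.commute)
        qed
      qed (use s d in auto)
      then show ?thesis by (simp add: scaleR_diff_left algebra_simps)
    qed
    show "\<exists>d>0. \<forall>s\<in>UNIV. norm (s - t) < d \<longrightarrow> norm (H s s s - H t t t - (s - t) *\<^sub>R ?D) \<le> e * norm (s - t)"
    proof (intro exI[of _ d] conjI d(1) ballI impI)
      fix s assume s: "norm (s - t) < d"
      have s1: "\<bar>s - t\<bar> < d" using s by simp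
      have in': "x \<in> {l<..<r}" if "\<bar>x - t\<bar> < d" for x using that d by auto
      have t1: "\<bar>t - t\<bar> < d" using d by simp
      have xd: "\<bar>x - t\<bar> < d" if "x \<in> {t-d<..<t+d}" for x using that by auto
      have 1: "norm (H s s s - H t s s - (s - t) *\<^sub>R A t t t) \<le> e/3 * \<bar>s - t\<bar>"
      proof (rule main[OF s1, where f="\<lambda>x. H x s s" and f'="\<lambda>x. A x s s"])
        fix x assume "x \<in> {t-d<..<t+d}"
        note x = xd[OF this]
        show "((\<lambda>x. H x s s) has_vector_derivative A x s s) (at x)" by (intro A in' x s1)
        show "norm (A x s s - A t t t) \<le> e/3" using x s1 d by (intro da(2)) linarith+
      qed
      have 2: "norm (H t s s - H t t s - (s - t) *\<^sub>R B t t t) \<le> e/3 * \<bar>s - t\<bar>"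
      proof (rule main[OF s1, where f="\<lambda>x. H t x s" and f'="\<lambda>x. B t x s"])
        fix x assume "x \<in> {t-d<..<t+d}"
        note x = xd[OF this]
        show "((\<lambda>x. H t x s) has_vector_derivative B t x s) (at x)" by (intro B in' x s1 t1)
        show "norm (B t x s - B t t t) \<le> e/3" using x s1 d by (intro db(2)) linarith+
      qed
      have 3: "norm (H t t s - H t t t - (s - t) *\<^sub>R C t t t) \<le> e/3 * \<bar>s - t\<bar>"
      proof (rule main[OF s1, where f="\<lambda>x. H t t x" and f'="\<lambda>x. C t t x"])
        fix x assume "x \<in> {t-d<..<t+d}"
        note x = xd[OF this]
        show "((\<lambda>x. H t t x) has_vector_derivative C t t x) (at x)" by (intro C in' x t1)
        show "norm (C t t x - C t t t) \<le> e/3" using x s1 d by (intro dc(2)) linarith+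
      qed
      \<comment> \<open>The increment is walked one slot at a time: (s,s,s), (t,s,s), (t,t,s),
        (t,t,t).\<close>
      have eq: "H s s s - H t t t - (s - t) *\<^sub>R ?D = (H s s s - H t s s - (s - t) *\<^sub>R A t t t)
         + ((H t s s - H t t s - (s - t) *\<^sub>R B t t t) + (H t t s - H t t t - (s - t) *\<^sub>R C t t t))"
        by (simp add: algebra_simps)
      have "norm (H s s s - H t t t - (s - t) *\<^sub>R ?D) \<le> e/3 * \<bar>s - t\<bar> + (e/3 * \<bar>s - t\<bar> + e/3 * \<bar>s - t\<bar>)"
        unfolding eq by (rule norm_triangle_mono[OF 1 norm_triangle_mono[OF 2 3]])
      then show "norm (H s s s - H t t t - (s - t) *\<^sub>R ?D) \<le> e * norm (s - t)" by simp
    qed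
  qed
qed

text \<open>The support radius may depend on the time interval: the kernels of interest live in a
  ball whose radius is proportional to t. Times near 0 are left out because of the factors
  1/t.\<close>

definition kernel :: "(real \<Rightarrow> 'a::euclidean_space \<Rightarrow> 'a \<Rightarrow> complex) \<Rightarrow> bool" where
  "kernel k \<longleftrightarrow> continuous_on ({0<..} \<times> UNIV) (\<lambda>(t, x, y). k t x y) \<and>
     (\<forall>a b. 0 < a \<longrightarrow> (\<exists>R. \<forall>t\<in>{a..b}. \<forall>x y. norm x > R \<or> norm y > R \<longrightarrow> k t x y = 0))"

definition adjoint_kernel :: "(real \<Rightarrow> 'a \<Rightarrow> 'a \<Rightarrow> complex) \<Rightarrow> real \<Rightarrow> 'a \<Rightarrow> 'a \<Rightarrow> complex" where
  "adjoint_kernel k t x y = cnj (k t y x)"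

lemma kernel_bound:
  assumes "kernel k" "0 < a"
  obtains B R where "B \<ge> 0" "\<And>t x y. t \<in> {a..b} \<Longrightarrow> norm (k t x y) \<le> B * indicator (cball 0 R) x * indicator (cball 0 R) y"
proof -
  obtain R where R: "\<And>t x y. t \<in> {a..b} \<Longrightarrow> norm x > R \<or> norm y > R \<Longrightarrow> k t x y = 0"
    using assms unfolding kernel_def by blast
  have "compact ((\<lambda>(t, x, y). k t x y) ` ({a..b} \<times> cball 0 R \<times> cball 0 R))"
    using assms by (intro compact_continuous_image compact_Times compact_cball compact_Icc)
      (auto simp: kernel_def intro: continuous_on_subset)
  then obtain B where B: "\<And>z. z \<in> {a..b} \<times> cball 0 R \<times> cball 0 R \<Longrightarrow> norm ((\<lambda>(t, x, y). k t x y) z) \<le> B"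
    using compact_imp_bounded bounded_iff by (metis imageI)
  have "norm (k t x y) \<le> max B 0 * indicator (cball 0 R) x * indicator (cball 0 R) y" if "t \<in> {a..b}" for t x y
    using R[OF that, of x y] B[of "(t,x,y)"] that by (cases "norm x \<le> R"; cases "norm y \<le> R") auto
  then show ?thesis using that[of "max B 0" R] by auto
qed

lemma kernel_support:
  assumes "kernel k" "0 < t"
  obtains R where "\<And>x y. norm x > R \<or> norm y > R \<Longrightarrow> k t x y = 0"
  using assms unfolding kernel_def by (metis atLeastAtMost_iff order.refl)

lemma kernel_continuous:
  assumes "kernel k" "0 < t"
  shows "continuous_on UNIV (\<lambda>(x, y). k t x y)"
proof -
  have "continuous_on UNIV ((\<lambda>(t, x, y). k t x y) \<circ> (\<lambda>z. (t, z)))"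
    using assms unfolding kernel_def
    by (intro continuous_on_compose continuous_intros) (auto intro: continuous_on_subset)
  then show ?thesis by (simp add: o_def)
qed

lemma kernel_continuous_section:
  assumes "kernel k" "0 < t"
  shows "continuous_on UNIV (\<lambda>x. k t x y)"
proof -
  have "continuous_on UNIV (\<lambda>x. (x, y))" by (intro continuous_intros)
  from continuous_on_compose2[OF kernel_continuous[OF assms] this] show ?thesis by simp
qed

lemma kernel_measurable:
  assumes "kernel k" "0 < t"
  shows "(\<lambda>z. k t (fst z) (snd z)) \<in> borel_measurable (borel \<Otimes>\<^sub>M borel)"
  using borel_measurable_continuous_onI[OF kernel_continuous[OF assms]]
  by (simp add: borel_prod case_prod_beta')

lemma kernel_tendsto:
  assumes "kernel k" "t \<longlonglongrightarrow> t0" "0 < t0" "\<And>n. 0 < t n"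
  shows "(\<lambda>n. k (t n) x y) \<longlonglongrightarrow> k t0 x y"
proof -
  have c: "continuous_on ({0<..} \<times> UNIV) (\<lambda>(t, x, y). k t x y)" using assms(1) unfolding kernel_def by (rule conjunct1)
  have T: "(\<lambda>n. (t n, x, y)) \<longlonglongrightarrow> (t0, x, y)" by (rule tendsto_Pair[OF assms(2) tendsto_const])
  have "(\<lambda>n. (\<lambda>(t, x, y). k t x y) (t n, x, y)) \<longlonglongrightarrow> (\<lambda>(t, x, y). k t x y) (t0, x, y)"
    using assms(3,4) by (intro continuous_on_tendsto_compose[OF c T]) auto
  then show ?thesis by simp
qed

lemma kernel_adjoint: "kernel k \<Longrightarrow> kernel (adjoint_kernel k)"
proof -
  assume k: "kernel k"
  have c: "continuous_on ({0<..} \<times> UNIV) (\<lambda>(t, x, y). k t x y)" using k unfolding kernel_def by (rule conjunct1)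
  have s: "continuous_on ({0<..} \<times> UNIV) (\<lambda>z::real \<times> 'a \<times> 'a. (fst z, snd (snd z), fst (snd z)))"
    by (intro continuous_intros)
  have "(\<lambda>z::real \<times> 'a \<times> 'a. (fst z, snd (snd z), fst (snd z))) ` ({0<..} \<times> UNIV) \<subseteq> {0<..} \<times> UNIV" by auto
  from continuous_on_cnj[OF continuous_on_compose2[OF c s this]]
  have "continuous_on ({0<..} \<times> UNIV) (\<lambda>(t, x, y). cnj (k t y x))" by (simp add: case_prod_beta')
  moreover have "\<exists>R. \<forall>t\<in>{a..b}. \<forall>x y. norm x > R \<or> norm y > R \<longrightarrow> cnj (k t y x) = 0" if "0 < a" for a b
    using k \<open>0 < a\<close> unfolding kernel_def complex_cnj_zero_iff by blast
  ultimately show ?thesis unfolding kernel_def adjoint_kernel_def by blast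
qed

lemma kernel_add: "kernel k \<Longrightarrow> kernel l \<Longrightarrow> kernel (\<lambda>t x y. k t x y + l t x y)"
proof -
  assume k: "kernel k" and l: "kernel l"
  have "\<exists>R. \<forall>t\<in>{a..b}. \<forall>x y. norm x > R \<or> norm y > R \<longrightarrow> k t x y + l t x y = 0" if "0 < a" for a b
  proof -
    obtain R where "\<forall>t\<in>{a..b}. \<forall>x y. norm x > R \<or> norm y > R \<longrightarrow> k t x y = 0"
      using k[unfolded kernel_def, THEN conjunct2, rule_format, OF \<open>0 < a\<close>] by blast
    moreover obtain S where "\<forall>t\<in>{a..b}. \<forall>x y. norm x > S \<or> norm y > S \<longrightarrow> l t x y = 0"
      using l[unfolded kernel_def, THEN conjunct2, rule_format, OF \<open>0 < a\<close>] by blast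
    ultimately have "\<forall>t\<in>{a..b}. \<forall>x y. norm x > max R S \<or> norm y > max R S \<longrightarrow> k t x y + l t x y = 0"
      by (metis add.left_neutral max_less_iff_conj)
    then show ?thesis by blast
  qed
  moreover have "continuous_on ({0<..} \<times> UNIV) (\<lambda>z. (\<lambda>(t, x, y). k t x y) z + (\<lambda>(t, x, y). l t x y) z)"
    using k l unfolding kernel_def by (intro continuous_on_add) (rule conjunct1, assumption)+
  ultimately show ?thesis unfolding kernel_def by (simp add: case_prod_beta')
qed

lemma kernel_mult_const: "kernel k \<Longrightarrow> kernel (\<lambda>t x y. c * k t x y)"
proof -
  assume k: "kernel k"
  have "continuous_on ({0<..} \<times> UNIV) (\<lambda>z. c * (\<lambda>(t, x, y). k t x y) z)"
    using k unfolding kernel_def by (intro continuous_on_mult continuous_on_const) (rule conjunct1)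
  moreover have "\<exists>R. \<forall>t\<in>{a..b}. \<forall>x y. norm x > R \<or> norm y > R \<longrightarrow> c * k t x y = 0" if "0 < a" for a b
    using k \<open>0 < a\<close> unfolding kernel_def mult_eq_0_iff by blast
  ultimately show ?thesis unfolding kernel_def by (simp add: case_prod_beta')
qed

text \<open>Convergence of pairings is available along sequences only; the three times may tend to
  \<open>t\<close> independently of each other.\<close>

lemma tendsto_at_diagonal:
  fixes F :: "real \<Rightarrow> real \<Rightarrow> real \<Rightarrow> 'b::metric_space"
  assumes t: "t > 0"
    and lim: "\<And>X Y Z. X \<longlonglongrightarrow> t \<Longrightarrow> Y \<longlonglongrightarrow> t \<Longrightarrow> Z \<longlonglongrightarrow> t \<Longrightarrow> (\<And>n. X n > 0) \<Longrightarrow> (\<And>n. Y n > 0) \<Longrightarrow> (\<And>n. Z n > 0)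
       \<Longrightarrow> (\<lambda>n. F (X n) (Y n) (Z n)) \<longlonglongrightarrow> F t t t"
  shows "((\<lambda>(a, b, c). F a b c) \<longlongrightarrow> F t t t) (at (t, t, t))"
proof -
  let ?S = "{0<..} \<times> {0<..} \<times> {0<..} :: (real \<times> real \<times> real) set"
  have "((\<lambda>(a, b, c). F a b c) \<longlongrightarrow> F t t t) (at (t, t, t) within ?S)"
    unfolding tendsto_at_iff_sequentially o_def
  proof (intro allI impI)
    fix X assume X: "\<forall>i. X i \<in> ?S - {(t, t, t)}" "X \<longlonglongrightarrow> (t, t, t)"
    have "fst (X n) > 0" "fst (snd (X n)) > 0" "snd (snd (X n)) > 0" for n
      using X(1)[rule_format, of n] by auto
    moreover have "(\<lambda>n. fst (X n)) \<longlonglongrightarrow> t" "(\<lambda>n. fst (snd (X n))) \<longlonglongrightarrow> t" "(\<lambda>n. snd (snd (X n))) \<longlonglongrightarrow> t"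
      using tendsto_fst[OF X(2)] tendsto_fst[OF tendsto_snd[OF X(2)]] tendsto_snd[OF tendsto_snd[OF X(2)]] by simp_all
    ultimately show "(\<lambda>n. case X n of (a, b, c) \<Rightarrow> F a b c) \<longlonglongrightarrow> F t t t"
      using lim by (simp add: case_prod_beta')
  qed
  moreover have "at (t, t, t) within ?S = at (t, t, t)"
    using t by (intro at_within_open open_Times) auto
  ultimately show ?thesis by (simp only:)
qed

section \<open>Double pairings of the solution with a kernel\<close>

context decaying_nls begin

text \<open>The bound is linear in \<open>B\<close>, which may thus vary with a parameter: for
  kernels it is applied with \<open>B * indicator (cball 0 R) y\<close>, and the result is again
  compactly supported in y.\<close>

lemma pairing_uniform_bound:
  assumes F: "admissible F" and a: "0 < a"
  obtains Q where "Q \<ge> 0" "\<And>t \<eta> B. a \<le> t \<Longrightarrow> \<eta> \<in> borel_measurable borel \<Longrightarrow>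
     (\<And>x. norm (\<eta> x) \<le> B * indicator (cball 0 R) x) \<Longrightarrow> B \<ge> 0 \<Longrightarrow> norm (LINT x|lborel. F (u t x) * \<eta> x) \<le> B * Q"
proof -
  obtain S where S: "S \<ge> 0" "\<And>z. norm (F z) \<le> S + energy z"
    by (rule admissible_growth[OF F]) blast
  define Q where "Q = S * (LINT x|lborel. indicator (cball (0::'a) R) x) + (M + C * a powr - \<kappa>)"
  have bound: "norm (LINT x|lborel. F (u t x) * \<eta> x) \<le> B * Q"
    if t: "a \<le> t" and m: "\<eta> \<in> borel_measurable borel" and b: "\<And>x. norm (\<eta> x) \<le> B * indicator (cball 0 R) x" and B: "B \<ge> 0" for t \<eta> B
  proof -
    have t0: "t > 0" using a t by linarith
    note i = integrable_pairing[OF F t0 m b]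
    have "norm (LINT x|lborel. F (u t x) * \<eta> x) \<le> (LINT x|lborel. norm (F (u t x) * \<eta> x))"
      by (rule integral_norm_bound)
    also have "\<dots> \<le> (LINT x|lborel. B * (S * indicator (cball 0 R) x + energy (u t x)))"
    proof (rule integral_mono)
      show "integrable lborel (\<lambda>x. norm (F (u t x) * \<eta> x))" using i by (rule integrable_norm)
      show "integrable lborel (\<lambda>x. B * (S * indicator (cball 0 R) x + energy (u t x)))"
        by (intro integrable_mult_right Bochner_Integration.integrable_add integrable_indicator_cball integrable_energy t0)
      fix x
      show "norm (F (u t x) * \<eta> x) \<le> B * (S * indicator (cball 0 R) x + energy (u t x))"
      proof (cases "x \<in> cball 0 R")
        case True
        then have "norm (\<eta> x) \<le> B" using b[of x] by simp
        then have "norm (\<eta> x) * norm (F (u t x)) \<le> B * (S + energy (u t x))"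
          using S(2) B by (intro mult_mono) auto
        then show ?thesis using True by (simp add: norm_mult mult.commute)
      next
        case False
        then have "norm (\<eta> x) \<le> 0" using b[of x] by simp
        then show ?thesis using B S energy_nonneg[of "u t x"] by (simp add: norm_mult False)
      qed
    qed
    also have "\<dots> = B * (S * (LINT x|lborel. indicator (cball (0::'a) R) x) + (LINT x|lborel. energy (u t x)))"
      using integrable_energy[OF t0] integrable_indicator_cball[of "0::'a" R] by simp
    also have "\<dots> \<le> B * Q"
      unfolding Q_def using B energy_bound[OF a t] by (intro mult_left_mono add_left_mono) auto
    finally show ?thesis .
  qed
  have "0 \<le> Q" using bound[of a "\<lambda>_. 0" 1] by simp
  with bound show ?thesis using that by blast
qed

text \<open>An iterated integral, because the inner one is itself a bounded weight of compact
  support in y, so the results on single pairings apply twice. The two times are kept apart for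
  differentiation slot by slot.\<close>

definition pair :: "(complex \<Rightarrow> complex) \<Rightarrow> (complex \<Rightarrow> complex) \<Rightarrow> real \<Rightarrow> real \<Rightarrow> ('a \<Rightarrow> 'a \<Rightarrow> complex) \<Rightarrow> complex" where
  "pair F G t1 t2 K = (LINT y|lborel. G (u t2 y) * (LINT x|lborel. F (u t1 x) * K x y))"

lemma kernel_measurable':
  fixes k :: "real \<Rightarrow> 'a \<Rightarrow> 'a \<Rightarrow> complex"
  assumes "kernel k" "0 < t"
  shows "(\<lambda>(y, x). k t x y) \<in> borel_measurable (borel \<Otimes>\<^sub>M borel)" "(\<lambda>x. k t x y) \<in> borel_measurable borel"
proof -
  show "(\<lambda>(y, x). k t x y) \<in> borel_measurable (borel \<Otimes>\<^sub>M borel)"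
    using measurable_compose[OF _ kernel_measurable[OF assms], of "\<lambda>z. (snd z, fst z)" "borel \<Otimes>\<^sub>M borel"]
    by (simp add: case_prod_beta')
  show "(\<lambda>x. k t x y) \<in> borel_measurable borel"
    using measurable_compose[OF _ kernel_measurable[OF assms], of "\<lambda>x. (x, y)" borel] by simp
qed

lemma inner_pairing_measurable:
  assumes F: "admissible F" and k: "kernel k" "0 < t3"
  shows "(\<lambda>y. LINT x|lborel. F (u t1 x) * k t3 x y) \<in> borel_measurable borel"
proof -
  note [measurable] = admissible_measurable[OF F] kernel_measurable'(1)[OF k]
  have "(\<lambda>(y, x). F (u t1 x) * (\<lambda>(y, x). k t3 x y) (y, x)) \<in> borel_measurable (borel \<Otimes>\<^sub>M lborel)"
    by measurable
  then show ?thesis using lborel.borel_measurable_lebesgue_integral[of "\<lambda>y x. F (u t1 x) * k t3 x y" borel] by simp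
qed

lemma inner_pairing_bound:
  assumes F: "admissible F" and k: "kernel k" and a: "0 < a"
  obtains B R where "B \<ge> 0" "\<And>t1 t3 y. a \<le> t1 \<Longrightarrow> t3 \<in> {a..b} \<Longrightarrow> norm (LINT x|lborel. F (u t1 x) * k t3 x y) \<le> B * indicator (cball 0 R) y"
proof -
  obtain B R where B: "B \<ge> 0" "\<And>t x y. t \<in> {a..b} \<Longrightarrow> norm (k t x y) \<le> B * indicator (cball 0 R) x * indicator (cball 0 R) y"
    using kernel_bound[OF k a] by blast
  obtain Q where Q: "Q \<ge> 0" "\<And>t \<eta> B. a \<le> t \<Longrightarrow> \<eta> \<in> borel_measurable borel \<Longrightarrow>
     (\<And>x. norm (\<eta> x) \<le> B * indicator (cball 0 R) x) \<Longrightarrow> B \<ge> 0 \<Longrightarrow> norm (LINT x|lborel. F (u t x) * \<eta> x) \<le> B * Q"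
    using pairing_uniform_bound[OF F a, of R] by blast
  have "norm (LINT x|lborel. F (u t1 x) * k t3 x y) \<le> (B * Q) * indicator (cball 0 R) y"
    if "a \<le> t1" "t3 \<in> {a..b}" for t1 t3 y
  proof -
    have "norm (LINT x|lborel. F (u t1 x) * k t3 x y) \<le> (B * indicator (cball 0 R) y) * Q"
      using that a B by (intro Q(2) kernel_measurable'(2)[OF k]) (auto simp: mult_ac)
    then show ?thesis by (simp add: mult_ac)
  qed
  then show ?thesis using that[of "B * Q" R] B(1) Q(1) by auto
qed

text \<open>The inner pairings converge for each y and have a common bound and a common support;
  they are therefore legitimate weights for a second application of
  \<open>pairing_tendsto\<close>.\<close>

lemma pair_tendsto:
  assumes F: "admissible F" and G: "admissible G" and k: "kernel k" and t: "t > 0"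
    and X: "X \<longlonglongrightarrow> t" "\<And>n. X n > 0" and Y: "Y \<longlonglongrightarrow> t" "\<And>n. Y n > 0" and Z: "Z \<longlonglongrightarrow> t" "\<And>n. Z n > 0"
  shows "(\<lambda>n. pair F G (X n) (Y n) (k (Z n))) \<longlonglongrightarrow> pair F G t t (k t)"
proof -
  obtain a1 a3 where a: "a1 > 0" "\<And>n. a1 \<le> X n" "a3 > 0" "\<And>n. a3 \<le> Z n"
    using LIMSEQ_positive_lower_bound[OF X(1) t X(2)] LIMSEQ_positive_lower_bound[OF Z(1) t Z(2)] by blast
  obtain b where b: "\<And>n. Z n \<le> b"
    using convergent_imp_Bseq[OF convergentI[OF Z(1)]] unfolding Bseq_def by (metis abs_le_iff real_norm_def)
  define a where "a = min a1 a3"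
  have a': "a > 0" "\<And>n. a \<le> X n" "\<And>n. Z n \<in> {a..b}"
    using a b by (auto simp: a_def min_le_iff_disj)
  obtain B R where B: "B \<ge> 0" "\<And>t x y. t \<in> {a..b} \<Longrightarrow> norm (k t x y) \<le> B * indicator (cball 0 R) x * indicator (cball 0 R) y"
    using kernel_bound[OF k a'(1)] by blast
  obtain B' R' where B': "B' \<ge> 0" "\<And>t1 t3 y. a \<le> t1 \<Longrightarrow> t3 \<in> {a..b} \<Longrightarrow> norm (LINT x|lborel. F (u t1 x) * k t3 x y) \<le> B' * indicator (cball 0 R') y"
    using inner_pairing_bound[OF F k a'(1)] by blast
  have kb: "norm (k (Z n) x y) \<le> B * indicator (cball 0 R) x" for n x y
    by (rule order_trans[OF B(2)[OF a'(3), of n x y]]) (use B(1) in \<open>auto simp: indicator_def\<close>)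
  show ?thesis
    unfolding pair_def
  proof (rule pairing_tendsto[OF G Y(1) t Y(2)])
    show "(\<lambda>y. LINT x|lborel. F (u (X n) x) * k (Z n) x y) \<in> borel_measurable borel" for n
      by (rule inner_pairing_measurable[OF F k Z(2)])
    show "(\<lambda>y. LINT x|lborel. F (u t x) * k t x y) \<in> borel_measurable borel"
      by (rule inner_pairing_measurable[OF F k t])
    show "norm (LINT x|lborel. F (u (X n) x) * k (Z n) x y) \<le> B' * indicator (cball 0 R') y" for n y
      by (rule B'(2)[OF a'(2,3)])
    show "(\<lambda>n. LINT x|lborel. F (u (X n) x) * k (Z n) x y) \<longlonglongrightarrow> (LINT x|lborel. F (u t x) * k t x y)" for y
      by (rule pairing_tendsto[OF F X(1) t X(2) kernel_measurable'(2)[OF k Z(2)] kernel_measurable'(2)[OF k t] kb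
          kernel_tendsto[OF k Z(1) t Z(2)]])
  qed
qed

lemma outer_integrable:
  assumes F: "admissible F" and G: "admissible G" and k: "kernel k" and t: "t1 > 0" "t2 > 0" "t3 > 0"
  shows "integrable lborel (\<lambda>y. G (u t2 y) * (LINT x|lborel. F (u t1 x) * k t3 x y))"
proof -
  define a where "a = min t1 t3"
  have a: "a > 0" "a \<le> t1" "t3 \<in> {a..t3}" using t by (auto simp: a_def)
  obtain B R where B: "B \<ge> 0" "\<And>s1 s3 y. a \<le> s1 \<Longrightarrow> s3 \<in> {a..t3} \<Longrightarrow> norm (LINT x|lborel. F (u s1 x) * k s3 x y) \<le> B * indicator (cball 0 R) y"
    using inner_pairing_bound[OF F k a(1)] by blast
  show ?thesis
    by (rule integrable_pairing[OF G t(2) inner_pairing_measurable[OF F k t(3)] B(2)[OF a(2,3)]])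
qed

lemma inner_integrable:
  assumes F: "admissible F" and k: "kernel k" and t: "t1 > 0" "t3 > 0"
  shows "integrable lborel (\<lambda>x. F (u t1 x) * k t3 x y)"
proof -
  obtain R where R: "\<And>x y. norm x > R \<or> norm y > R \<Longrightarrow> k t3 x y = 0"
    using kernel_support[OF k t(2)] by blast
  show ?thesis
    using R by (intro integrable_pairing_continuous[OF F t(1) kernel_continuous_section[OF k t(2)], where R=R]) auto
qed

text \<open>Absolute integrability on the product allows exchanging the two integrals, on which
  Hermitian symmetry rests, and makes the pairing accessible to Schur-type bounds.\<close>

lemma pair_integrable_product:
  assumes F: "admissible F" and G: "admissible G" and k: "kernel k" and t: "t1 > 0" "t2 > 0" "t3 > 0"
  shows "integrable (lborel \<Otimes>\<^sub>M lborel) (\<lambda>(x, y). F (u t1 x) * G (u t2 y) * k t3 x y)"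
proof -
  obtain B R where B0: "B \<ge> 0" "\<And>t x y. t \<in> {t3..t3} \<Longrightarrow> norm (k t x y) \<le> B * indicator (cball 0 R) x * indicator (cball 0 R) y"
    using kernel_bound[OF k t(3)] by blast
  note B = B0(1) B0(2)[of t3, simplified]
  note [measurable] = admissible_measurable[OF F] admissible_measurable[OF G] kernel_measurable[OF k t(3)]
  have [measurable]: "(indicator (cball 0 R) :: 'a \<Rightarrow> complex) \<in> borel_measurable borel" by (rule borel_measurable_indicator) simp
  have i: "integrable lborel (\<lambda>x. F (u s x) * indicator (cball 0 R) x)" if "admissible F" "s > 0" for F s
    using that by (intro integrable_pairing[where B=1 and R=R]) (auto simp: indicator_def)
  have p: "integrable (lborel \<Otimes>\<^sub>M lborel) (\<lambda>(x, y). (F (u t1 x) * indicator (cball 0 R) x) * (G (u t2 y) * indicator (cball 0 R) y))"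
  proof (rule lborel_pair.Fubini_integrable)
    show "integrable lborel (\<lambda>x. LINT y|lborel. norm (case (x, y) of (x, y) \<Rightarrow> (F (u t1 x) * indicator (cball 0 R) x) * (G (u t2 y) * indicator (cball 0 R) y)))"
      using integrable_norm[OF i[OF F t(1)]] by (simp add: norm_mult)
    show "AE x in lborel. integrable lborel (\<lambda>y. case (x, y) of (x, y) \<Rightarrow> (F (u t1 x) * indicator (cball 0 R) x) * (G (u t2 y) * indicator (cball 0 R) y))"
      using i[OF G t(2)] by simp
  qed measurable
  show ?thesis
  proof (rule Bochner_Integration.integrable_bound[OF integrable_mult_right[OF p, of "complex_of_real B"]])
    have "(\<lambda>(x, y). F (u t1 x) * G (u t2 y) * k t3 x y) = (\<lambda>z. F (u t1 (fst z)) * G (u t2 (snd z)) * k t3 (fst z) (snd z))"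
      by (simp add: case_prod_beta')
    also have "\<dots> \<in> borel_measurable (lborel \<Otimes>\<^sub>M lborel)" by measurable
    finally show "(\<lambda>(x, y). F (u t1 x) * G (u t2 y) * k t3 x y) \<in> borel_measurable (lborel \<Otimes>\<^sub>M lborel)" .
    have "norm (F (u t1 x) * G (u t2 y)) * norm (k t3 x y) \<le> norm (F (u t1 x) * G (u t2 y)) * (B * indicator (cball 0 R) x * indicator (cball 0 R) y)" for x y
      by (intro mult_left_mono B(2)) auto
    moreover have "norm (indicator (cball 0 R) x :: complex) = indicator (cball 0 R) x" for x :: 'a
      by (simp add: indicator_def)
    ultimately have "norm (F (u t1 x) * G (u t2 y) * k t3 x y) \<le> norm (B * ((F (u t1 x) * indicator (cball 0 R) x) * (G (u t2 y) * indicator (cball 0 R) y)))" for x y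
      using B(1) by (simp add: norm_mult mult_ac)
    then show "AE z in lborel \<Otimes>\<^sub>M lborel. norm (case z of (x, y) \<Rightarrow> F (u t1 x) * G (u t2 y) * k t3 x y) \<le>
       norm (complex_of_real B * (case z of (x, y) \<Rightarrow> F (u t1 x) * indicator (cball 0 R) x * (G (u t2 y) * indicator (cball 0 R) y)))"
      by (auto simp: case_prod_beta')
  qed
qed

lemma pair_eq_product:
  assumes F: "admissible F" and G: "admissible G" and k: "kernel k" and t: "t1 > 0" "t2 > 0" "t3 > 0"
  shows "pair F G t1 t2 (k t3) = (LINT z|(lborel \<Otimes>\<^sub>M lborel). F (u t1 (fst z)) * G (u t2 (snd z)) * k t3 (fst z) (snd z))"
proof -
  have "pair F G t1 t2 (k t3) = (LINT y|lborel. LINT x|lborel. F (u t1 x) * G (u t2 y) * k t3 x y)"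
    unfolding pair_def by (simp flip: integral_mult_right_zero add: mult_ac)
  also have "\<dots> = (LINT z|(lborel \<Otimes>\<^sub>M lborel). case_prod (\<lambda>x y. F (u t1 x) * G (u t2 y) * k t3 x y) z)"
    by (rule lborel_pair.integral_snd[OF pair_integrable_product[OF assms]])
  finally show ?thesis by (simp add: case_prod_beta')
qed

lemma pair_cnj:
  assumes k: "kernel k" and t: "t1 > 0" "t2 > 0" "t3 > 0"
  shows "cnj (pair (\<lambda>z. z) cnj t1 t2 (k t3)) = pair (\<lambda>z. z) cnj t2 t1 (adjoint_kernel k t3)"
proof -
  note i = pair_integrable_product[OF admissible_id admissible_cnj k t]
  have "pair (\<lambda>z. z) cnj t1 t2 (k t3) = (LINT y|lborel. LINT x|lborel. u t1 x * cnj (u t2 y) * k t3 x y)"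
    unfolding pair_def by (simp flip: integral_mult_right_zero add: mult_ac)
  also have "\<dots> = (LINT x|lborel. LINT y|lborel. u t1 x * cnj (u t2 y) * k t3 x y)"
    by (rule lborel_pair.Fubini_integral[OF i])
  finally have "cnj (pair (\<lambda>z. z) cnj t1 t2 (k t3)) = (LINT x|lborel. LINT y|lborel. cnj (u t1 x * cnj (u t2 y) * k t3 x y))"
    by (simp add: Bochner_Integration.integral_cnj[symmetric] del: Bochner_Integration.integral_cnj)
  also have "\<dots> = pair (\<lambda>z. z) cnj t2 t1 (adjoint_kernel k t3)"
    unfolding pair_def adjoint_kernel_def by (simp flip: integral_mult_right_zero add: mult_ac)
  finally show ?thesis .
qed

lemma pair_add:
  assumes F: "admissible F" and G: "admissible G" and k: "kernel k" and l: "kernel l" and t: "t1 > 0" "t2 > 0" "t3 > 0"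
  shows "pair F G t1 t2 (\<lambda>x y. k t3 x y + l t3 x y) = pair F G t1 t2 (k t3) + pair F G t1 t2 (l t3)"
  unfolding pair_def
  using inner_integrable[OF F k t(1,3)] inner_integrable[OF F l t(1,3)] outer_integrable[OF F G k t] outer_integrable[OF F G l t]
  by (simp add: distrib_left)

lemma pair_mult_const: "pair F G t1 t2 (\<lambda>x y. c * K x y) = c * pair F G t1 t2 K"
  unfolding pair_def by (simp add: mult.left_commute[of _ c])

end

text \<open>Only the Laplacian in the first variable is needed; the one in the second is its
  conjugate with the variables swapped, by Hermitian symmetry of the kernel.\<close>

definition kernel_lap :: "(real \<Rightarrow> 'a::euclidean_space \<Rightarrow> 'a \<Rightarrow> complex) \<Rightarrow> real \<Rightarrow> 'a \<Rightarrow> 'a \<Rightarrow> complex" where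
  "kernel_lap k t x y = lap (\<lambda>x. k t x y) x"

section \<open>Time derivative of the diagonal pairing\<close>

context decaying_nls begin

lemma pair_has_derivative_time_kernel:
  assumes F: "admissible F" and G: "admissible G" and k: "kernel k" and k': "kernel k'"
    and d: "\<And>t x y. t > 0 \<Longrightarrow> ((\<lambda>t. k t x y) has_vector_derivative k' t x y) (at t)"
    and t: "t1 > 0" "t2 > 0" "t3 > 0"
  shows "((\<lambda>t3. pair F G t1 t2 (k t3)) has_vector_derivative pair F G t1 t2 (k' t3)) (at t3)"
proof -
  define a b where "a = t3 / 2" and "b = 2 * t3"
  have ab: "0 < a" "t3 \<in> {a<..<b}" "\<And>s. s \<in> {a<..<b} \<Longrightarrow> 0 < s \<and> s \<in> {a..b}" using t by (auto simp: a_def b_def)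
  obtain B R where B: "B \<ge> 0" "\<And>t x y. t \<in> {a..b} \<Longrightarrow> norm (k' t x y) \<le> B * indicator (cball 0 R) x * indicator (cball 0 R) y"
    using kernel_bound[OF k' ab(1)] by blast
  have i: "integrable lborel (\<lambda>x. F (u s x) * indicator (cball 0 R) x)" if "admissible F" "s > 0" for F s
    using that by (intro integrable_pairing[where B=1 and R=R] borel_measurable_indicator) (auto simp: indicator_def)
  have n: "norm (indicator (cball 0 R) x :: complex) = indicator (cball 0 R) x" for x :: 'a
    by (simp add: indicator_def)
  have inner: "((\<lambda>s. LINT x|lborel. F (u t1 x) * k s x y) has_vector_derivative (LINT x|lborel. F (u t1 x) * k' s x y)) (at s)"
    if s: "s \<in> {a<..<b}" for s y
  proof (rule has_vector_derivative_integral[OF s])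
    show "integrable lborel (\<lambda>x. F (u t1 x) * k s x y)" if "s \<in> {a<..<b}" for s
      using ab(3)[OF that] t by (intro inner_integrable[OF F k]) auto
    show "((\<lambda>s. F (u t1 x) * k s x y) has_vector_derivative F (u t1 x) * k' s x y) (at s)" if "s \<in> {a<..<b}" for s x
      using ab(3)[OF that] by (intro has_vector_derivative_mult_right d) auto
    show "norm (F (u t1 x) * k' s x y) \<le> B * norm (F (u t1 x) * indicator (cball 0 R) x)" if "s \<in> {a<..<b}" for s x
    proof -
      have "norm (k' s x y) \<le> B * indicator (cball 0 R) x"
        by (rule order_trans[OF B(2)]) (use ab(3)[OF that] B(1) in \<open>auto simp: indicator_def\<close>)
      from mult_left_mono[OF this norm_ge_zero[of "F (u t1 x)"]] show ?thesis
        by (simp add: norm_mult n mult_ac)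
    qed
    show "integrable lborel (\<lambda>x. B * norm (F (u t1 x) * indicator (cball 0 R) x))"
      by (intro integrable_mult_right integrable_norm i[OF F t(1)])
    show "(\<lambda>x. F (u t1 x) * k' s x y) \<in> borel_measurable lborel"
      using ab(3)[OF s] t by (intro borel_measurable_integrable inner_integrable[OF F k']) auto
  qed
  have m: "0 < min a t1" using ab t by simp
  obtain B' R' where B': "B' \<ge> 0" "\<And>s1 s3 y. min a t1 \<le> s1 \<Longrightarrow> s3 \<in> {min a t1..b} \<Longrightarrow> norm (LINT x|lborel. F (u s1 x) * k' s3 x y) \<le> B' * indicator (cball 0 R') y"
    using inner_pairing_bound[OF F k' m] by blast
  have i': "integrable lborel (\<lambda>x. G (u t2 x) * indicator (cball 0 R') x)"
    using t by (intro integrable_pairing[OF G, where B=1 and R=R'] borel_measurable_indicator) (auto simp: indicator_def)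
  have n': "norm (indicator (cball 0 R') x :: complex) = indicator (cball 0 R') x" for x :: 'a
    by (simp add: indicator_def)
  show ?thesis
    unfolding pair_def
  proof (rule has_vector_derivative_integral[OF ab(2)])
    show "integrable lborel (\<lambda>y. G (u t2 y) * (LINT x|lborel. F (u t1 x) * k s x y))" if "s \<in> {a<..<b}" for s
      using ab(3)[OF that] t by (intro outer_integrable[OF F G k]) auto
    show "((\<lambda>s. G (u t2 y) * (LINT x|lborel. F (u t1 x) * k s x y)) has_vector_derivative G (u t2 y) * (LINT x|lborel. F (u t1 x) * k' s x y)) (at s)"
      if "s \<in> {a<..<b}" for s y
      by (rule has_vector_derivative_mult_right[OF inner[OF that]])
    show "norm (G (u t2 y) * (LINT x|lborel. F (u t1 x) * k' s x y)) \<le> B' * norm (G (u t2 y) * indicator (cball 0 R') y)"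
      if "s \<in> {a<..<b}" for s y
    proof -
      have "norm (LINT x|lborel. F (u t1 x) * k' s x y) \<le> B' * indicator (cball 0 R') y"
        by (rule B'(2)) (use ab(3)[OF that] in \<open>auto simp: min_le_iff_disj\<close>)
      from mult_left_mono[OF this norm_ge_zero[of "G (u t2 y)"]] show ?thesis
        by (simp add: norm_mult n' mult_ac)
    qed
    show "integrable lborel (\<lambda>y. B' * norm (G (u t2 y) * indicator (cball 0 R') y))"
      by (intro integrable_mult_right integrable_norm i')
    show "(\<lambda>y. G (u t2 y) * (LINT x|lborel. F (u t1 x) * k' t3 x y)) \<in> borel_measurable lborel"
      by (intro borel_measurable_integrable outer_integrable[OF F G k'] t)
  qed
qed

text \<open>For fixed y the section of the kernel is an admissible spatial test function, so the
  equation for single pairings applies. Its right-hand side is bounded with compact support in y,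
  uniformly for times near \<open>t1\<close>, and this permits differentiation under the outer
  integral.\<close>

lemma pair_has_derivative_fst:
  assumes k: "kernel k" and l: "kernel (kernel_lap k)" and sm: "\<And>t y. t > 0 \<Longrightarrow> smooth (\<lambda>x. k t x y)"
    and t: "t1 > 0" "t2 > 0" "t3 > 0"
  shows "((\<lambda>t1. pair (\<lambda>z. z) cnj t1 t2 (k t3)) has_vector_derivative
     \<i> * (pair (\<lambda>z. z) cnj t1 t2 (kernel_lap k t3) + lam * pair (nonlinearity \<alpha>) cnj t1 t2 (k t3))) (at t1)"
proof -
  define a where "a = min (t1 / 2) t3"
  have a: "0 < a" "t1 \<in> {t1/2<..<2*t1}" "t3 \<in> {a..t3}" "\<And>s. s \<in> {t1/2<..<2*t1} \<Longrightarrow> 0 < s \<and> a \<le> s"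
    using t by (auto simp: a_def min_le_iff_disj)
  obtain R where R: "\<And>x y. norm x > R \<or> norm y > R \<Longrightarrow> k t3 x y = 0"
    using kernel_support[OF k t(3)] by blast
  let ?D = "\<lambda>s y. \<i> * ((LINT x|lborel. u s x * kernel_lap k t3 x y) + lam * (LINT x|lborel. nonlinearity \<alpha> (u s x) * k t3 x y))"
  have inner: "((\<lambda>s. LINT x|lborel. u s x * k t3 x y) has_vector_derivative ?D s y) (at s)" if "s \<in> {t1/2<..<2*t1}" for s y
    using pairing_has_derivative[OF sm[OF t(3)], of R y s] R a(4)[OF that] unfolding kernel_lap_def by auto
  obtain B1 R1 where B1: "B1 \<ge> 0" "\<And>s1 s3 y. a \<le> s1 \<Longrightarrow> s3 \<in> {a..t3} \<Longrightarrow> norm (LINT x|lborel. u s1 x * kernel_lap k s3 x y) \<le> B1 * indicator (cball 0 R1) y"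
    using inner_pairing_bound[OF admissible_id l a(1)] by blast
  obtain B2 R2 where B2: "B2 \<ge> 0" "\<And>s1 s3 y. a \<le> s1 \<Longrightarrow> s3 \<in> {a..t3} \<Longrightarrow> norm (LINT x|lborel. nonlinearity \<alpha> (u s1 x) * k s3 x y) \<le> B2 * indicator (cball 0 R2) y"
    using inner_pairing_bound[OF admissible_nonlinearity k a(1)] by blast
  have i: "integrable lborel (\<lambda>y. cnj (u t2 y) * indicator (cball 0 R) y)" for R
    using t by (intro integrable_pairing[OF admissible_cnj, where B=1 and R=R] borel_measurable_indicator) (auto simp: indicator_def)
  have n: "norm (indicator (cball 0 R) x :: complex) = indicator (cball 0 R) x" for x :: 'a and R
    by (simp add: indicator_def)
  have eq: "(LINT y|lborel. cnj (u t2 y) * ?D s y) = \<i> * (pair (\<lambda>z. z) cnj s t2 (kernel_lap k t3) + lam * pair (nonlinearity \<alpha>) cnj s t2 (k t3))"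
    and ii: "integrable lborel (\<lambda>y. cnj (u t2 y) * ?D s y)" if s: "s > 0" for s
  proof -
    note o = outer_integrable[OF admissible_id admissible_cnj l s t(2,3)] outer_integrable[OF admissible_nonlinearity admissible_cnj k s t(2,3)]
    have *: "(\<lambda>y. cnj (u t2 y) * ?D s y) = (\<lambda>y. \<i> * (cnj (u t2 y) * (LINT x|lborel. u s x * kernel_lap k t3 x y)
       + lam * (cnj (u t2 y) * (LINT x|lborel. nonlinearity \<alpha> (u s x) * k t3 x y))))"
      by (simp add: fun_eq_iff distrib_left mult.left_commute)
    show "integrable lborel (\<lambda>y. cnj (u t2 y) * ?D s y)"
      unfolding * by (intro integrable_mult_right Bochner_Integration.integrable_add o)
    show "(LINT y|lborel. cnj (u t2 y) * ?D s y) = \<i> * (pair (\<lambda>z. z) cnj s t2 (kernel_lap k t3) + lam * pair (nonlinearity \<alpha>) cnj s t2 (k t3))"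
      unfolding * pair_def integral_mult_right_zero
      by (subst Bochner_Integration.integral_add) (intro integrable_mult_right o | simp only: integral_mult_right_zero)+
  qed
  have "((\<lambda>s. LINT y|lborel. cnj (u t2 y) * (LINT x|lborel. u s x * k t3 x y)) has_vector_derivative (LINT y|lborel. cnj (u t2 y) * ?D t1 y)) (at t1)"
  proof (rule has_vector_derivative_integral[OF a(2)])
    show "integrable lborel (\<lambda>y. cnj (u t2 y) * (LINT x|lborel. u s x * k t3 x y))" if "s \<in> {t1/2<..<2*t1}" for s
      using a(4)[OF that] t by (intro outer_integrable[OF admissible_id admissible_cnj k]) auto
    show "((\<lambda>s. cnj (u t2 y) * (LINT x|lborel. u s x * k t3 x y)) has_vector_derivative cnj (u t2 y) * ?D s y) (at s)"
      if "s \<in> {t1/2<..<2*t1}" for s y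
      by (rule has_vector_derivative_mult_right[OF inner[OF that]])
    show "norm (cnj (u t2 y) * ?D s y) \<le> B1 * norm (cnj (u t2 y) * indicator (cball 0 R1) y) + \<bar>lam\<bar> * B2 * norm (cnj (u t2 y) * indicator (cball 0 R2) y)"
      if "s \<in> {t1/2<..<2*t1}" for s y
    proof -
      have s: "a \<le> s" using a(4)[OF that] by simp
      have "norm (?D s y) \<le> B1 * indicator (cball 0 R1) y + \<bar>lam\<bar> * (B2 * indicator (cball 0 R2) y)"
        unfolding norm_mult norm_ii mult_1
        by (rule order_trans[OF norm_triangle_ineq])
           (auto simp: norm_mult intro!: add_mono mult_left_mono B1(2)[OF s a(3)] B2(2)[OF s a(3)])
      then have "norm (cnj (u t2 y)) * norm (?D s y) \<le> norm (cnj (u t2 y)) * (B1 * indicator (cball 0 R1) y + \<bar>lam\<bar> * (B2 * indicator (cball 0 R2) y))"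
        by (rule mult_left_mono) simp
      then show ?thesis
        unfolding norm_mult[of "cnj (u t2 y)" "?D s y"] by (simp only: norm_mult n ring_distribs mult_ac)
    qed
    show "integrable lborel (\<lambda>y. B1 * norm (cnj (u t2 y) * indicator (cball 0 R1) y) + \<bar>lam\<bar> * B2 * norm (cnj (u t2 y) * indicator (cball 0 R2) y))"
      by (intro integrable_mult_right integrable_norm i Bochner_Integration.integrable_add)
    show "(\<lambda>y. cnj (u t2 y) * ?D t1 y) \<in> borel_measurable lborel"
      by (intro borel_measurable_integrable ii t)
  qed
  then show ?thesis unfolding eq[OF t(1)] by (simp add: pair_def)
qed

text \<open>Conjugation swaps the two copies of \<open>u\<close> and fixes a Hermitian kernel, so
  this is the conjugate of the derivative in the first slot.\<close>

lemma pair_has_derivative_snd: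
  assumes k: "kernel k" and l: "kernel (kernel_lap k)" and sm: "\<And>t y. t > 0 \<Longrightarrow> smooth (\<lambda>x. k t x y)"
    and herm: "\<And>t x y. k t y x = cnj (k t x y)"
    and t: "t1 > 0" "t2 > 0" "t3 > 0"
  shows "((\<lambda>t2. pair (\<lambda>z. z) cnj t1 t2 (k t3)) has_vector_derivative
     cnj (\<i> * (pair (\<lambda>z. z) cnj t2 t1 (kernel_lap k t3) + lam * pair (nonlinearity \<alpha>) cnj t2 t1 (k t3)))) (at t2)"
proof -
  have adj: "adjoint_kernel k = k"
    unfolding adjoint_kernel_def by (intro ext) (metis herm complex_cnj_cnj)
  have "((\<lambda>s. cnj (pair (\<lambda>z. z) cnj s t1 (k t3))) has_vector_derivative
     cnj (\<i> * (pair (\<lambda>z. z) cnj t2 t1 (kernel_lap k t3) + lam * pair (nonlinearity \<alpha>) cnj t2 t1 (k t3)))) (at t2)"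
    by (intro has_vector_derivative_cnj pair_has_derivative_fst assms)
  then show ?thesis
    by (rule has_vector_derivative_transform_within_open[where S="{0<..}"])
       (use t pair_cnj[OF k] adj in auto)
qed

text \<open>The remainder kernel collects everything that the linear flow does to \<open>k\<close>; for a kernel
  transported by the free flow it vanishes.\<close>

lemma pair_diagonal_has_derivative:
  assumes k: "kernel k" and l: "kernel (kernel_lap k)" and k': "kernel k'"
    and sm: "\<And>t y. t > 0 \<Longrightarrow> smooth (\<lambda>x. k t x y)"
    and d: "\<And>t x y. t > 0 \<Longrightarrow> ((\<lambda>t. k t x y) has_vector_derivative k' t x y) (at t)"
    and herm: "\<And>t x y. k t y x = cnj (k t x y)"
    and t: "t > 0"
  shows "((\<lambda>t. pair (\<lambda>z. z) cnj t t (k t)) has_vector_derivative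
     pair (\<lambda>z. z) cnj t t (\<lambda>x y. k' t x y + \<i> * (kernel_lap k t x y - cnj (kernel_lap k t y x)))
     + 2 * Re (\<i> * lam * pair (nonlinearity \<alpha>) cnj t t (k t))) (at t)"
proof -
  let ?A = "\<lambda>t1 t2 t3. \<i> * (pair (\<lambda>z. z) cnj t1 t2 (kernel_lap k t3) + lam * pair (nonlinearity \<alpha>) cnj t1 t2 (k t3))"
  let ?B = "\<lambda>t1 t2 t3. cnj (\<i> * (pair (\<lambda>z. z) cnj t2 t1 (kernel_lap k t3) + lam * pair (nonlinearity \<alpha>) cnj t2 t1 (k t3)))"
  let ?C = "\<lambda>t1 t2 t3. pair (\<lambda>z. z) cnj t1 t2 (k' t3)"
  have "((\<lambda>t. pair (\<lambda>z. z) cnj t t (k t)) has_vector_derivative (?A t t t + ?B t t t + ?C t t t)) (at t)"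
  proof (rule has_vector_derivative_diagonal[where l=0 and r="t+1" and A="?A" and B="?B" and C="?C" and
      H="\<lambda>t1 t2 t3. pair (\<lambda>z. z) cnj t1 t2 (k t3)"])
    show "t \<in> {0<..<t+1}" using t by simp
    fix t1 t2 t3 assume "t1 \<in> {0<..<t+1}" "t2 \<in> {0<..<t+1}" "t3 \<in> {0<..<t+1}"
    then have p: "t1 > 0" "t2 > 0" "t3 > 0" by auto
    show "((\<lambda>t1. pair (\<lambda>z. z) cnj t1 t2 (k t3)) has_vector_derivative ?A t1 t2 t3) (at t1)"
      by (rule pair_has_derivative_fst[OF k l sm p])
    show "((\<lambda>t2. pair (\<lambda>z. z) cnj t1 t2 (k t3)) has_vector_derivative ?B t1 t2 t3) (at t2)"
      by (rule pair_has_derivative_snd[OF k l sm herm p])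
    show "((\<lambda>t3. pair (\<lambda>z. z) cnj t1 t2 (k t3)) has_vector_derivative ?C t1 t2 t3) (at t3)"
      by (rule pair_has_derivative_time_kernel[OF admissible_id admissible_cnj k k' d p])
  next
    show "((\<lambda>(t1, t2, t3). ?A t1 t2 t3) \<longlongrightarrow> ?A t t t) (at (t, t, t))"
      by (rule tendsto_at_diagonal[OF t, of ?A])
         (intro tendsto_mult tendsto_add tendsto_const pair_tendsto admissible_id admissible_cnj admissible_nonlinearity k l t; assumption)
    show "((\<lambda>(t1, t2, t3). ?B t1 t2 t3) \<longlongrightarrow> ?B t t t) (at (t, t, t))"
      by (rule tendsto_at_diagonal[OF t, of ?B])
         (intro tendsto_cnj tendsto_mult tendsto_add tendsto_const pair_tendsto admissible_id admissible_cnj admissible_nonlinearity k l t; assumption)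
    show "((\<lambda>(t1, t2, t3). ?C t1 t2 t3) \<longlongrightarrow> ?C t t t) (at (t, t, t))"
      by (rule tendsto_at_diagonal[OF t, of ?C])
         (intro pair_tendsto admissible_id admissible_cnj k' t; assumption)
  qed
  \<comment> \<open>On the diagonal \<open>?B\<close> is the conjugate of \<open>?A\<close>: the
    nonlinear parts add up to twice a real part, and the two Laplacians combine into a
    commutator.\<close>
  moreover have "?A t t t + ?B t t t + ?C t t t =
     pair (\<lambda>z. z) cnj t t (\<lambda>x y. k' t x y + \<i> * (kernel_lap k t x y - cnj (kernel_lap k t y x)))
     + 2 * Re (\<i> * lam * pair (nonlinearity \<alpha>) cnj t t (k t))"
  proof -
    let ?P = "pair (\<lambda>z. z) cnj t t" and ?N = "pair (nonlinearity \<alpha>) cnj t t (k t)"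
    note a = kernel_adjoint[OF l]
    have "?P (\<lambda>x y. k' t x y + (\<i> * kernel_lap k t x y + - \<i> * adjoint_kernel (kernel_lap k) t x y))
       = ?P (k' t) + (\<i> * ?P (kernel_lap k t) + - \<i> * ?P (adjoint_kernel (kernel_lap k) t))"
      using pair_add[OF admissible_id admissible_cnj k' kernel_add[OF kernel_mult_const[OF l, of \<i>] kernel_mult_const[OF a, of "- \<i>"]] t t t]
        pair_add[OF admissible_id admissible_cnj kernel_mult_const[OF l, of \<i>] kernel_mult_const[OF a, of "- \<i>"] t t t]
      by (simp only: pair_mult_const)
    moreover have "(\<lambda>x y. k' t x y + (\<i> * kernel_lap k t x y + - \<i> * adjoint_kernel (kernel_lap k) t x y))
       = (\<lambda>x y. k' t x y + \<i> * (kernel_lap k t x y - cnj (kernel_lap k t y x)))"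
      by (simp add: adjoint_kernel_def fun_eq_iff algebra_simps)
    ultimately have P: "?P (\<lambda>x y. k' t x y + \<i> * (kernel_lap k t x y - cnj (kernel_lap k t y x)))
       = ?P (k' t) + (\<i> * ?P (kernel_lap k t) + - \<i> * cnj (?P (kernel_lap k t)))"
      by (simp add: pair_cnj[OF l t t t])
    have R: "complex_of_real (2 * Re z) = z + cnj z" for z by (simp add: complex_add_cnj)
    show ?thesis unfolding P of_real_mult[symmetric] R
      by (simp add: algebra_simps complex_add_cnj[symmetric])
  qed
  ultimately show ?thesis by (simp only:)
qed

end

section \<open>Approximation of the identity\<close>

text \<open>The crude constant works for every exponent p > 0, and only its finiteness matters, so
  no convexity is used.\<close>

lemma powr_add_le:
  fixes a b p :: real assumes "a \<ge> 0" "b \<ge> 0" "p > 0"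
  shows "(a + b) powr p \<le> 2 powr p * (a powr p + b powr p)"
proof -
  have "(a + b) powr p \<le> (2 * max a b) powr p" using assms by (intro powr_mono2) auto
  also have "\<dots> = 2 powr p * max a b powr p" by (simp add: powr_mult)
  also have "\<dots> \<le> 2 powr p * (a powr p + b powr p)" by (intro mult_left_mono) (auto simp: max_def)
  finally show ?thesis .
qed

lemma norm_diff_powr_le:
  fixes x y z :: "'b::real_normed_vector" assumes "p > 0"
  shows "norm (x - z) powr p \<le> 2 powr p * (norm (x - y) powr p + norm (y - z) powr p)"
proof -
  have "norm (x - z) powr p \<le> (norm (x - y) + norm (y - z)) powr p"
    using assms norm_triangle_ineq[of "x - y" "y - z"] by (intro powr_mono2) auto
  also have "\<dots> \<le> 2 powr p * (norm (x - y) powr p + norm (y - z) powr p)"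
    using assms by (intro powr_add_le) auto
  finally show ?thesis .
qed

lemma nn_integral_norm_diff_powr_le:
  fixes f g h :: "'a::euclidean_space \<Rightarrow> complex"
  assumes [measurable]: "f \<in> borel_measurable borel" "g \<in> borel_measurable borel" "h \<in> borel_measurable borel" and p: "p > 0"
  shows "(\<integral>\<^sup>+x. ennreal (norm (f x - h x) powr p) \<partial>lborel) \<le> ennreal (2 powr p) *
    ((\<integral>\<^sup>+x. ennreal (norm (f x - g x) powr p) \<partial>lborel) + (\<integral>\<^sup>+x. ennreal (norm (g x - h x) powr p) \<partial>lborel))"
proof -
  have "(\<integral>\<^sup>+x. ennreal (norm (f x - h x) powr p) \<partial>lborel) \<le>
    (\<integral>\<^sup>+x. ennreal (2 powr p) * (ennreal (norm (f x - g x) powr p) + ennreal (norm (g x - h x) powr p)) \<partial>lborel)"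
    using norm_diff_powr_le[OF p]
    by (intro nn_integral_mono) (simp add: ennreal_mult'[symmetric] ennreal_plus[symmetric] del: ennreal_plus)
  also have "\<dots> = ennreal (2 powr p) *
    ((\<integral>\<^sup>+x. ennreal (norm (f x - g x) powr p) \<partial>lborel) + (\<integral>\<^sup>+x. ennreal (norm (g x - h x) powr p) \<partial>lborel))"
    by (simp add: nn_integral_cmult nn_integral_add)
  finally show ?thesis .
qed

section \<open>Density of compactly supported continuous functions\<close>

lemma bounded_approximation_by_continuous:
  fixes w :: "'a::euclidean_space \<Rightarrow> complex"
  assumes [measurable]: "w \<in> borel_measurable borel" and M: "M > 0" and p: "p > 0" and e: "e > 0"
    and b: "\<And>x. norm (w x) \<le> M" and s: "\<And>x. norm x > M \<Longrightarrow> w x = 0"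
  shows "\<exists>g. continuous_on UNIV g \<and> (\<forall>x. norm x > M + 1 \<longrightarrow> g x = 0) \<and>
     (\<integral>\<^sup>+x. ennreal (norm (w x - g x) powr p) \<partial>lborel) < ennreal e"
proof -
  have "w \<in> borel_measurable (lebesgue_on UNIV)" by (simp add: lebesgue_on_UNIV_eq measurable_completion)
  then have "w measurable_on UNIV" by (subst measurable_on_iff_borel_measurable) auto
  then obtain N g where N: "negligible N" and g: "\<And>n. continuous_on UNIV (g n)"
    and lim: "\<And>x. x \<notin> N \<Longrightarrow> (\<lambda>n. g n x) \<longlonglongrightarrow> w x"
    unfolding measurable_on_def by auto
  \<comment> \<open>The continuous functions \<open>g n\<close> converge almost everywhere but need
    be neither bounded nor compactly supported. The radial retraction \<open>cl\<close> and the
    spatial cutoff \<open>c\<close> supply a majorant without changing the limit, since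
    \<open>w\<close> has its values and its support within radius \<open>M\<close>.\<close>
  define cl where "cl z = complex_of_real (M / max M (norm z)) * z" for z :: complex
  have cl_cont: "continuous_on UNIV cl"
    unfolding cl_def using M by (intro continuous_intros) auto
  have cl_bound: "norm (cl z) \<le> M" for z
  proof -
    have "norm (cl z) = \<bar>M / max M (norm z)\<bar> * norm z" unfolding cl_def norm_mult norm_of_real ..
    also have "\<dots> = M * (norm z / max M (norm z))" using M by simp
    also have "\<dots> \<le> M * 1" using M by (intro mult_left_mono) (auto simp: divide_le_eq)
    finally show ?thesis by simp
  qed
  have cl_id: "cl z = z" if "norm z \<le> M" for z using that M by (simp add: cl_def max_def)
  define c where "c x = max 0 (min 1 (M + 1 - norm x))" for x :: 'a
  have c_cont: "continuous_on UNIV c" unfolding c_def by (intro continuous_intros)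
  have c: "0 \<le> c x" "c x \<le> 1" "norm x \<le> M \<Longrightarrow> c x = 1" "norm x > M + 1 \<Longrightarrow> c x = 0" for x
    by (auto simp: c_def)
  define G where "G n x = complex_of_real (c x) * cl (g n x)" for n x
  have G_cont: "continuous_on UNIV (G n)" for n
    unfolding G_def by (intro continuous_intros c_cont continuous_on_compose2[OF cl_cont g]) auto
  have [measurable]: "G n \<in> borel_measurable borel" for n
    using G_cont by (rule borel_measurable_continuous_onI)
  have "AE x in lebesgue. x \<notin> N"
    using N by (intro AE_not_in) (simp add: negligible_iff_null_sets)
  then have AE: "AE x in lborel. x \<notin> N"
    by (simp add: AE_completion_iff)
  have "(\<lambda>n. \<integral>\<^sup>+x. ennreal (norm (w x - G n x) powr p) \<partial>lborel) \<longlonglongrightarrow> (\<integral>\<^sup>+x. 0 \<partial>(lborel :: 'a measure))"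
  proof (rule nn_integral_dominated_convergence[where w="\<lambda>x. ennreal ((2 * M) powr p) * indicator (cball 0 (M + 1)) x"])
    show "(\<integral>\<^sup>+x. ennreal ((2 * M) powr p) * indicator (cball 0 (M + 1)) x \<partial>(lborel :: 'a measure)) < \<infinity>"
      using emeasure_lborel_cball_finite[of "0::'a" "M+1"]
      by (simp add: nn_integral_cmult_indicator ennreal_mult_less_top top.not_eq_extremum)
    show "AE x in lborel. ennreal (norm (w x - G n x) powr p) \<le> ennreal ((2 * M) powr p) * indicator (cball 0 (M + 1)) x" for n
    proof (intro AE_I2)
      fix x :: 'a
      show "ennreal (norm (w x - G n x) powr p) \<le> ennreal ((2 * M) powr p) * indicator (cball 0 (M + 1)) x"
      proof (cases "norm x \<le> M + 1")
        case True
        have "norm (G n x) \<le> 1 * M" unfolding G_def norm_mult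
          using c[of x] cl_bound M by (intro mult_mono) auto
        then have "norm (w x - G n x) \<le> 2 * M" using b[of x] norm_triangle_ineq4[of "w x" "G n x"] by linarith
        then show ?thesis using True p by (auto intro!: ennreal_leI powr_mono2)
      next
        case False
        then show ?thesis using c(4)[of x] s[of x] by (simp add: G_def)
      qed
    qed
    show "AE x in lborel. (\<lambda>n. ennreal (norm (w x - G n x) powr p)) \<longlonglongrightarrow> 0"
      using AE
    proof eventually_elim
      case (elim x)
      have "(\<lambda>n. G n x) \<longlonglongrightarrow> complex_of_real (c x) * cl (w x)"
        unfolding G_def using cl_cont
        by (intro tendsto_mult tendsto_const isCont_tendsto_compose[OF _ lim[OF elim]]) (simp add: continuous_on_eq_continuous_at)
      also have "complex_of_real (c x) * cl (w x) = w x"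
        using cl_id[OF b[of x]] c(3)[of x] s[of x] by (cases "norm x \<le> M") auto
      finally have "(\<lambda>n. norm (w x - G n x)) \<longlonglongrightarrow> norm (w x - w x)"
        by (intro tendsto_intros)
      then have "(\<lambda>n. norm (w x - G n x) powr p) \<longlonglongrightarrow> 0 powr p"
        using p by (intro tendsto_powr') auto
      then show ?case using p tendsto_ennrealI by fastforce
    qed
    show "(\<lambda>x. ennreal (norm (w x - G n x) powr p)) \<in> borel_measurable lborel" for n by simp
    show "(\<lambda>x::'a. 0 :: ennreal) \<in> borel_measurable lborel" by simp
    show "(\<lambda>x::'a. ennreal ((2 * M) powr p) * indicator (cball 0 (M + 1)) x) \<in> borel_measurable lborel"
      by (intro borel_measurable_times_ennreal borel_measurable_const borel_measurable_indicator) simp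
  qed
  then have "(\<lambda>n. \<integral>\<^sup>+x. ennreal (norm (w x - G n x) powr p) \<partial>lborel) \<longlonglongrightarrow> 0" by simp
  then have "eventually (\<lambda>n. (\<integral>\<^sup>+x. ennreal (norm (w x - G n x) powr p) \<partial>lborel) < ennreal e) sequentially"
    using e by (intro order_tendstoD(2)) auto
  then obtain n where "(\<integral>\<^sup>+x. ennreal (norm (w x - G n x) powr p) \<partial>lborel) < ennreal e"
    using eventually_happens by force
  then show ?thesis using G_cont[of n] c(4) by (intro exI[of _ "G n"]) (auto simp: G_def)
qed

lemma Lp_approximation_by_continuous:
  fixes w :: "'a::euclidean_space \<Rightarrow> complex"
  assumes [measurable]: "w \<in> borel_measurable borel" and p: "p > 0" and e: "e > 0"
    and fin: "(\<integral>\<^sup>+x. ennreal (norm (w x) powr p) \<partial>lborel) < \<infinity>"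
  shows "\<exists>g R. continuous_on UNIV g \<and> (\<forall>x. norm x > R \<longrightarrow> g x = 0) \<and>
     (\<integral>\<^sup>+x. ennreal (norm (w x - g x) powr p) \<partial>lborel) \<le> ennreal e"
proof -
  define W where "W n x = (if norm (w x) \<le> real (Suc n) \<and> norm x \<le> real (Suc n) then w x else 0)" for n x
  have [measurable]: "W n \<in> borel_measurable borel" for n unfolding W_def by measurable
  \<comment> \<open>Two errors of size \<open>d\<close>, one from truncating and one from smoothing,
    with the factor \<open>2 powr p\<close> of the weak triangle inequality.\<close>
  define d where "d = e / (2 * 2 powr p)"
  have d: "d > 0" using e by (simp add: d_def)
  have "(\<lambda>n. \<integral>\<^sup>+x. ennreal (norm (w x - W n x) powr p) \<partial>lborel) \<longlonglongrightarrow> (\<integral>\<^sup>+x. 0 \<partial>(lborel :: 'a measure))"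
  proof (rule nn_integral_dominated_convergence[where w="\<lambda>x. ennreal (norm (w x) powr p)"])
    show "AE x in lborel. (\<lambda>n. ennreal (norm (w x - W n x) powr p)) \<longlonglongrightarrow> 0"
    proof (intro AE_I2 tendsto_eventually)
      fix x
      obtain n0 where n0: "norm (w x) \<le> real n0" "norm x \<le> real n0"
        using real_arch_simple[of "max (norm (w x)) (norm x)"] by auto
      show "\<forall>\<^sub>F n in sequentially. ennreal (norm (w x - W n x) powr p) = 0"
        using eventually_ge_at_top[of n0]
      proof eventually_elim
        case (elim n)
        then have "norm (w x) \<le> real (Suc n)" "norm x \<le> real (Suc n)" using n0 by linarith+
        then show ?case by (simp add: W_def)
      qed
    qed
  qed (use fin p in \<open>auto simp: W_def\<close>)
  then have "(\<lambda>n. \<integral>\<^sup>+x. ennreal (norm (w x - W n x) powr p) \<partial>lborel) \<longlonglongrightarrow> 0" by simp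
  then have "eventually (\<lambda>n. (\<integral>\<^sup>+x. ennreal (norm (w x - W n x) powr p) \<partial>lborel) < ennreal d) sequentially"
    using d by (intro order_tendstoD(2)) auto
  then obtain n where n: "(\<integral>\<^sup>+x. ennreal (norm (w x - W n x) powr p) \<partial>lborel) < ennreal d"
    using eventually_happens by force
  obtain g where g: "continuous_on UNIV g" "\<And>x. norm x > real (Suc n) + 1 \<Longrightarrow> g x = 0"
     "(\<integral>\<^sup>+x. ennreal (norm (W n x - g x) powr p) \<partial>lborel) < ennreal d"
  proof -
    have "\<exists>g. continuous_on UNIV g \<and> (\<forall>x. norm x > real (Suc n) + 1 \<longrightarrow> g x = 0) \<and>
      (\<integral>\<^sup>+x. ennreal (norm (W n x - g x) powr p) \<partial>lborel) < ennreal d"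
      by (rule bounded_approximation_by_continuous) (use p d in \<open>auto simp: W_def\<close>)
    then show ?thesis using that by blast
  qed
  have [measurable]: "g \<in> borel_measurable borel" using g(1) by (rule borel_measurable_continuous_onI)
  have "(\<integral>\<^sup>+x. ennreal (norm (w x - g x) powr p) \<partial>lborel) \<le> ennreal (2 powr p) * (ennreal d + ennreal d)"
    by (rule order_trans[OF nn_integral_norm_diff_powr_le[of w "W n" g p]])
       (use n g(3) p in \<open>auto intro!: mult_left_mono add_mono\<close>)
  also have "\<dots> = ennreal e"
    using d by (simp add: ennreal_plus[symmetric] ennreal_mult'[symmetric] del: ennreal_plus) (simp add: d_def)
  finally show ?thesis using g by blast
qed

lemma ennreal_tendsto_0I:
  fixes X :: "'b \<Rightarrow> ennreal"
  assumes "\<And>e. e > 0 \<Longrightarrow> eventually (\<lambda>n. X n \<le> ennreal e) F"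
  shows "(X \<longlongrightarrow> 0) F"
proof (rule order_tendstoI)
  fix a :: ennreal assume a: "0 < a"
  then obtain e where e: "e > 0" "ennreal e < a"
  proof (cases a)
    case (real r)
    then have "r / 2 > 0" "ennreal (r / 2) < a" using a by (auto simp: ennreal_less_iff)
    then show ?thesis using that by blast
  next
    case top
    then show ?thesis using that[of 1] by simp
  qed
  show "\<forall>\<^sub>F n in F. X n < a"
    using assms[OF e(1)] by eventually_elim (use e in auto)
qed simp

text \<open>Proved by comparing b with \<eta> a. The free parameter matters: the a-term will merely
  be bounded and is made small by \<eta>, while the b-term tends to 0 whatever its
  coefficient.\<close>

lemma powr_Young:
  fixes a b p \<eta> :: real
  assumes "a \<ge> 0" "b \<ge> 0" "p > 1" "\<eta> > 0"
  shows "a powr (p - 1) * b \<le> \<eta> * a powr p + \<eta> powr (1 - p) * b powr p"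
proof (cases "b \<le> \<eta> * a")
  case True
  have "a powr (p - 1) * b \<le> a powr (p - 1) * (\<eta> * a)"
    using True by (intro mult_left_mono) auto
  also have "\<dots> = \<eta> * (a powr (p - 1) * a powr 1)" using assms by simp
  also have "\<dots> = \<eta> * a powr p" by (simp only: powr_add[symmetric]) simp
  also have "\<dots> \<le> \<eta> * a powr p + \<eta> powr (1 - p) * b powr p" by simp
  finally show ?thesis .
next
  case False
  then have ab: "a \<le> b / \<eta>" using assms by (simp add: field_simps)
  then have "a powr (p - 1) * b \<le> (b / \<eta>) powr (p - 1) * b powr 1"
    using assms by (intro mult_mono powr_mono2) auto
  also have "(b / \<eta>) powr (p - 1) = b powr (p - 1) * \<eta> powr (1 - p)"
    using assms by (simp add: powr_divide powr_minus_divide[symmetric] divide_powr_uminus)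
  also have "b powr (p - 1) * \<eta> powr (1 - p) * b powr 1 = \<eta> powr (1 - p) * (b powr (p - 1) * b powr 1)" by simp
  also have "\<dots> = \<eta> powr (1 - p) * b powr p" by (simp only: powr_add[symmetric]) simp
  also have "\<dots> \<le> \<eta> * a powr p + \<eta> powr (1 - p) * b powr p" using assms by simp
  finally show ?thesis .
qed

text \<open>A non-integrable \<open>f\<close> has integral 0 by convention, so a bound on the
  absolute integral always transfers.\<close>

lemma integral_norm_le_nn_integral:
  fixes f :: "'b \<Rightarrow> complex"
  assumes "(\<integral>\<^sup>+x. ennreal (norm (f x)) \<partial>M) \<le> ennreal B" "B \<ge> 0"
  shows "norm (LINT x|M. f x) \<le> B"
proof (cases "integrable M f")
  case True
  have "ennreal (norm (LINT x|M. f x)) \<le> (\<integral>\<^sup>+x. ennreal (norm (f x)) \<partial>M)"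
    using True by (rule integral_norm_bound_ennreal)
  also note assms(1)
  finally show ?thesis using assms(2) by simp
next
  case False
  then show ?thesis using assms(2) by (simp add: not_integrable_integral_eq)
qed

text \<open>Schur's test in additive form: the sum q(x) + q(y) splits the double integral in two,
  and each part is integrated first over the variable that \<open>q\<close> does not contain. This
  serves q = |u|^2 and q = |u|^(\<alpha>+2) alike.\<close>

lemma schur_bound:
  fixes v w :: "'a::euclidean_space \<Rightarrow> complex" and K :: "'a \<Rightarrow> 'a \<Rightarrow> complex"
  assumes [measurable]: "(\<lambda>z. K (fst z) (snd z)) \<in> borel_measurable (borel \<Otimes>\<^sub>M borel)"
    "q \<in> borel_measurable borel"
    and q: "\<And>x. q x \<ge> 0" "(\<integral>\<^sup>+x. ennreal (q x) \<partial>lborel) \<le> ennreal Q" "Q \<ge> 0"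
    and vw: "\<And>x y. norm (v x) * norm (w y) \<le> q x + q y"
    and L: "L \<ge> 0" "\<And>x. (\<integral>\<^sup>+y. ennreal (norm (K x y)) \<partial>lborel) \<le> ennreal L"
      "\<And>y. (\<integral>\<^sup>+x. ennreal (norm (K x y)) \<partial>lborel) \<le> ennreal L"
  shows "norm (LINT z|(lborel \<Otimes>\<^sub>M lborel). v (fst z) * w (snd z) * K (fst z) (snd z)) \<le> 2 * L * Q"
proof (rule integral_norm_le_nn_integral)
  let ?P = "lborel \<Otimes>\<^sub>M lborel :: ('a \<times> 'a) measure"
  have 1: "(\<integral>\<^sup>+z. ennreal (q (fst z)) * ennreal (norm (K (fst z) (snd z))) \<partial>?P) \<le> ennreal (L * Q)"
  proof -
    have "(\<integral>\<^sup>+z. ennreal (q (fst z)) * ennreal (norm (K (fst z) (snd z))) \<partial>?P)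
      = (\<integral>\<^sup>+x. \<integral>\<^sup>+y. ennreal (q x) * ennreal (norm (K x y)) \<partial>lborel \<partial>lborel)"
      by (subst lborel.nn_integral_fst[symmetric]) simp_all
    also have "\<dots> \<le> (\<integral>\<^sup>+x. ennreal (q x) * ennreal L \<partial>lborel)"
    proof (rule nn_integral_mono)
      fix x
      have [measurable]: "(\<lambda>y. K x y) \<in> borel_measurable borel"
        using measurable_compose[OF _ assms(1), of "\<lambda>y. (x, y)" borel] by simp
      show "(\<integral>\<^sup>+y. ennreal (q x) * ennreal (norm (K x y)) \<partial>lborel) \<le> ennreal (q x) * ennreal L"
        by (subst nn_integral_cmult) (auto intro!: mult_left_mono L)
    qed
    also have "\<dots> = (\<integral>\<^sup>+x. ennreal (q x) \<partial>lborel) * ennreal L" by (rule nn_integral_multc) simp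
    also have "\<dots> \<le> ennreal Q * ennreal L" by (intro mult_right_mono q) auto
    finally show ?thesis using L q by (simp add: ennreal_mult' mult.commute)
  qed
  have 2: "(\<integral>\<^sup>+z. ennreal (q (snd z)) * ennreal (norm (K (fst z) (snd z))) \<partial>?P) \<le> ennreal (L * Q)"
  proof -
    have "(\<integral>\<^sup>+z. ennreal (q (snd z)) * ennreal (norm (K (fst z) (snd z))) \<partial>?P)
      = (\<integral>\<^sup>+y. \<integral>\<^sup>+x. ennreal (q y) * ennreal (norm (K x y)) \<partial>lborel \<partial>lborel)"
      by (subst lborel_pair.nn_integral_snd[symmetric]) simp_all
    also have "\<dots> \<le> (\<integral>\<^sup>+y. ennreal (q y) * ennreal L \<partial>lborel)"
    proof (rule nn_integral_mono)
      fix y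
      have [measurable]: "(\<lambda>x. K x y) \<in> borel_measurable borel"
        using measurable_compose[OF _ assms(1), of "\<lambda>x. (x, y)" borel] by simp
      show "(\<integral>\<^sup>+x. ennreal (q y) * ennreal (norm (K x y)) \<partial>lborel) \<le> ennreal (q y) * ennreal L"
        by (subst nn_integral_cmult) (auto intro!: mult_left_mono L)
    qed
    also have "\<dots> = (\<integral>\<^sup>+x. ennreal (q x) \<partial>lborel) * ennreal L" by (rule nn_integral_multc) simp
    also have "\<dots> \<le> ennreal Q * ennreal L" by (intro mult_right_mono q) auto
    finally show ?thesis using L q by (simp add: ennreal_mult' mult.commute)
  qed
  have "(\<integral>\<^sup>+z. ennreal (norm (v (fst z) * w (snd z) * K (fst z) (snd z))) \<partial>?P)
    \<le> (\<integral>\<^sup>+z. ennreal (q (fst z)) * ennreal (norm (K (fst z) (snd z))) + ennreal (q (snd z)) * ennreal (norm (K (fst z) (snd z))) \<partial>?P)"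
  proof (rule nn_integral_mono)
    fix z
    have "norm (v (fst z) * w (snd z) * K (fst z) (snd z)) \<le> (q (fst z) + q (snd z)) * norm (K (fst z) (snd z))"
      unfolding norm_mult by (intro mult_right_mono vw) simp
    then have "ennreal (norm (v (fst z) * w (snd z) * K (fst z) (snd z))) \<le> ennreal (q (fst z) * norm (K (fst z) (snd z)) + q (snd z) * norm (K (fst z) (snd z)))"
      by (simp add: distrib_right ennreal_leI)
    then show "ennreal (norm (v (fst z) * w (snd z) * K (fst z) (snd z))) \<le>
        ennreal (q (fst z)) * ennreal (norm (K (fst z) (snd z))) + ennreal (q (snd z)) * ennreal (norm (K (fst z) (snd z)))"
      using q by (simp add: ennreal_mult' ennreal_plus)
  qed
  also have "\<dots> = (\<integral>\<^sup>+z. ennreal (q (fst z)) * ennreal (norm (K (fst z) (snd z))) \<partial>?P) + (\<integral>\<^sup>+z. ennreal (q (snd z)) * ennreal (norm (K (fst z) (snd z))) \<partial>?P)"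
    by (rule nn_integral_add) measurable
  also have "\<dots> \<le> ennreal (L * Q) + ennreal (L * Q)" by (intro add_mono 1 2)
  also have "\<dots> = ennreal (2 * L * Q)" using L q by (simp add: ennreal_plus[symmetric] del: ennreal_plus)
  finally show "(\<integral>\<^sup>+z. ennreal (norm (v (fst z) * w (snd z) * K (fst z) (snd z))) \<partial>?P) \<le> ennreal (2 * L * Q)" .
qed (use L q in simp)

section \<open>Kernels concentrating on the diagonal\<close>

locale mollifier =
  fixes H :: "nat \<Rightarrow> 'a::euclidean_space \<Rightarrow> 'a \<Rightarrow> real"
  assumes H_measurable [measurable]: "\<And>n. (\<lambda>z. H n (fst z) (snd z)) \<in> borel_measurable (borel \<Otimes>\<^sub>M borel)"
    and H_nonneg: "\<And>n x y. H n x y \<ge> 0"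
    and H_fst: "\<And>n x. (\<integral>\<^sup>+y. ennreal (H n x y) \<partial>lborel) = 1"
    and H_snd: "\<And>n y. (\<integral>\<^sup>+x. ennreal (H n x y) \<partial>lborel) = 1"
    and H_support: "\<And>e. e > 0 \<Longrightarrow> \<forall>\<^sub>F n in sequentially. \<forall>x y. norm (x - y) > e \<longrightarrow> H n x y = 0"
begin

abbreviation (input) "P \<equiv> lborel \<Otimes>\<^sub>M lborel :: ('a \<times> 'a) measure"

lemma H_section: "H n x \<in> borel_measurable borel" "(\<lambda>x. H n x y) \<in> borel_measurable borel"
  using measurable_compose[OF _ H_measurable, of "\<lambda>y. (x, y)" borel] measurable_compose[OF _ H_measurable, of "\<lambda>x. (x, y)" borel]
  by simp_all

lemma nn_integral_fst_H:
  assumes [measurable]: "q \<in> borel_measurable borel"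
  shows "(\<integral>\<^sup>+z. q (fst z) * ennreal (H n (fst z) (snd z)) \<partial>P) = (\<integral>\<^sup>+x. q x \<partial>lborel)"
proof -
  have "(\<integral>\<^sup>+z. q (fst z) * ennreal (H n (fst z) (snd z)) \<partial>P) = (\<integral>\<^sup>+x. \<integral>\<^sup>+y. q x * ennreal (H n x y) \<partial>lborel \<partial>lborel)"
    by (subst lborel.nn_integral_fst[symmetric]) simp_all
  also have "\<dots> = (\<integral>\<^sup>+x. q x \<partial>lborel)"
    using H_section by (simp add: nn_integral_cmult H_fst)
  finally show ?thesis .
qed

lemma nn_integral_snd_H:
  assumes [measurable]: "q \<in> borel_measurable borel"
  shows "(\<integral>\<^sup>+z. q (snd z) * ennreal (H n (fst z) (snd z)) \<partial>P) = (\<integral>\<^sup>+x. q x \<partial>lborel)"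
proof -
  have "(\<integral>\<^sup>+z. q (snd z) * ennreal (H n (fst z) (snd z)) \<partial>P) = (\<integral>\<^sup>+y. \<integral>\<^sup>+x. q y * ennreal (H n x y) \<partial>lborel \<partial>lborel)"
    by (subst lborel_pair.nn_integral_snd[symmetric]) simp_all
  also have "\<dots> = (\<integral>\<^sup>+x. q x \<partial>lborel)"
    using H_section by (simp add: nn_integral_cmult H_snd)
  finally show ?thesis .
qed

lemma mean_continuity_continuous:
  fixes g :: "'a \<Rightarrow> complex"
  assumes g: "continuous_on UNIV g" "\<And>x. norm x > R \<Longrightarrow> g x = 0" and p: "p > 0" and e: "e > 0"
  shows "\<forall>\<^sub>F n in sequentially. (\<integral>\<^sup>+z. ennreal (norm (g (fst z) - g (snd z)) powr p) * ennreal (H n (fst z) (snd z)) \<partial>P) \<le> ennreal e"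
proof -
  define V where "V = measure lborel (cball (0::'a) (R + 1))"
  \<comment> \<open>Admissible oscillation of \<open>g\<close>: its p-th power times the volume
    \<open>V\<close> of the ball of radius R+1 is at most \<open>e\<close>; the summand 1 avoids
    dividing by 0. Points at distance at most 1 from that ball lie within R+2, where
    \<open>g\<close> is uniformly continuous.\<close>
  define \<omega> where "\<omega> = (e / (V + 1)) powr (1 / p)"
  have V: "V \<ge> 0" by (simp add: V_def)
  have \<omega>: "\<omega> > 0" "\<omega> powr p = e / (V + 1)" using e V p by (auto simp: \<omega>_def powr_powr)
  have "uniformly_continuous_on (cball 0 (R + 2)) g"
    by (intro compact_uniformly_continuous continuous_on_subset[OF g(1)]) auto
  then obtain d where d: "d > 0" "\<And>x y. x \<in> cball 0 (R + 2) \<Longrightarrow> y \<in> cball 0 (R + 2) \<Longrightarrow> dist y x < d \<Longrightarrow> dist (g y) (g x) < \<omega>"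
    using \<omega>(1) unfolding uniformly_continuous_on_def by metis
  have "\<forall>\<^sub>F n in sequentially. \<forall>x y. norm (x - y) > min (d / 2) 1 \<longrightarrow> H n x y = 0"
    using d(1) by (intro H_support) auto
  then show ?thesis
  proof eventually_elim
    case (elim n)
    have pt: "ennreal (norm (g x - g y) powr p) * ennreal (H n x y) \<le> (ennreal (\<omega> powr p) * indicator (cball 0 (R + 1)) x) * ennreal (H n x y)" for x y
    proof (cases "norm (x - y) > min (d / 2) 1")
      case True
      then show ?thesis using elim by simp
    next
      case False
      then have xy: "norm (x - y) < d" "norm (x - y) \<le> 1" using d(1) by (auto simp: min_def split: if_splits)
      show ?thesis
      proof (cases "norm x \<le> R + 1")
        case True
        moreover have "norm y \<le> R + 2" using True xy(2) norm_triangle_sub[of y x] by (simp add: norm_minus_commute)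
        ultimately have "norm (g x - g y) \<le> \<omega>"
          using d(2)[of y x] xy by (simp add: dist_norm less_imp_le)
        then show ?thesis using True p by (auto intro!: mult_right_mono ennreal_leI powr_mono2)
      next
        case False
        moreover have "norm y > R" using False xy(2) norm_triangle_sub[of x y] by simp
        ultimately show ?thesis using g(2)[of x] g(2)[of y] p by simp
      qed
    qed
    have m: "(\<lambda>x::'a. ennreal (\<omega> powr p) * indicator (cball 0 (R + 1)) x) \<in> borel_measurable borel"
      by (intro borel_measurable_times_ennreal borel_measurable_const borel_measurable_indicator) simp
    have "(\<integral>\<^sup>+z. ennreal (norm (g (fst z) - g (snd z)) powr p) * ennreal (H n (fst z) (snd z)) \<partial>P)
      \<le> (\<integral>\<^sup>+z. (ennreal (\<omega> powr p) * indicator (cball 0 (R + 1)) (fst z)) * ennreal (H n (fst z) (snd z)) \<partial>P)"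
      by (intro nn_integral_mono pt)
    also have "\<dots> = (\<integral>\<^sup>+x. ennreal (\<omega> powr p) * indicator (cball 0 (R + 1)) x \<partial>(lborel :: 'a measure))"
      by (rule nn_integral_fst_H[OF m])
    also have "\<dots> = ennreal (\<omega> powr p) * emeasure lborel (cball (0::'a) (R + 1))"
      by (rule nn_integral_cmult_indicator) simp
    also have "\<dots> = ennreal (\<omega> powr p) * ennreal V"
      unfolding V_def using emeasure_lborel_cball_finite[of "0::'a" "R+1"] by (subst emeasure_eq_ennreal_measure) auto
    also have "\<dots> = ennreal (e / (V + 1) * V)" unfolding \<omega>(2) by (rule ennreal_mult''[OF V, symmetric])
    also have "\<dots> \<le> ennreal e"
      using V e by (intro ennreal_leI) (simp add: field_simps)
    finally show ?case .
  qed
qed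

text \<open>A density argument: \<open>w\<close> is replaced by a continuous \<open>g\<close> at
  both points. Both marginals of \<open>H\<close> have mass one, so each replacement costs exactly
  the p-th power of the L^p distance, whatever \<open>n\<close> is.\<close>

lemma mean_continuity:
  fixes w :: "'a \<Rightarrow> complex"
  assumes [measurable]: "w \<in> borel_measurable borel" and p: "p > 0"
    and fin: "(\<integral>\<^sup>+x. ennreal (norm (w x) powr p) \<partial>lborel) < \<infinity>"
  shows "(\<lambda>n. \<integral>\<^sup>+z. ennreal (norm (w (fst z) - w (snd z)) powr p) * ennreal (H n (fst z) (snd z)) \<partial>P) \<longlonglongrightarrow> 0"
proof (rule ennreal_tendsto_0I)
  fix e :: real assume e: "e > 0"
  define c where "c = (2::real) powr p"
  have c: "c \<ge> 1" using p by (simp add: c_def ge_one_powr_ge_zero)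
  have c1: "t \<le> c * t" if "t \<ge> 0" for t using mult_right_mono[OF c that] by simp
  \<comment> \<open>Three error terms, and a factor \<open>c\<close> for each of the two uses of the
    weak triangle inequality.\<close>
  define d where "d = e / (3 * c\<^sup>2)"
  have d: "d > 0" using e c by (simp add: d_def)
  obtain g R where g: "continuous_on UNIV g" "\<And>x. norm x > R \<Longrightarrow> g x = 0"
     "(\<integral>\<^sup>+x. ennreal (norm (w x - g x) powr p) \<partial>lborel) \<le> ennreal d"
    using Lp_approximation_by_continuous[OF assms(1) p d fin] by blast
  have [measurable]: "g \<in> borel_measurable borel" using g(1) by (rule borel_measurable_continuous_onI)
  show "\<forall>\<^sub>F n in sequentially. (\<integral>\<^sup>+z. ennreal (norm (w (fst z) - w (snd z)) powr p) * ennreal (H n (fst z) (snd z)) \<partial>P) \<le> ennreal e"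
  proof (rule eventually_mono[OF mean_continuity_continuous[OF g(1,2) p d]])
    fix n
    assume elim: "(\<integral>\<^sup>+z. ennreal (norm (g (fst z) - g (snd z)) powr p) * ennreal (H n (fst z) (snd z)) \<partial>P) \<le> ennreal d"
    let ?h = "\<lambda>z. ennreal (H n (fst z) (snd z))"
    let ?a = "\<lambda>x. ennreal (norm (w x - g x) powr p)"
    let ?b = "\<lambda>z. ennreal (norm (g (fst z) - g (snd z)) powr p)"
    have pt: "ennreal (norm (w x - w y) powr p) \<le> ennreal (c\<^sup>2) * (?a x + (?b (x, y) + ?a y))" for x y
    proof -
      have "norm (w x - w y) powr p \<le> c * (norm (w x - g x) powr p + norm (g x - w y) powr p)"
        unfolding c_def by (rule norm_diff_powr_le[OF p])
      also have "\<dots> \<le> c * (c * norm (w x - g x) powr p + c * (norm (g x - g y) powr p + norm (g y - w y) powr p))"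
        by (intro mult_left_mono add_mono c1 norm_diff_powr_le[OF p, folded c_def]) (use c in auto)
      also have "\<dots> = c\<^sup>2 * (norm (w x - g x) powr p + (norm (g x - g y) powr p + norm (w y - g y) powr p))"
        by (simp add: power2_eq_square algebra_simps norm_minus_commute)
      finally have "ennreal (norm (w x - w y) powr p) \<le> ennreal (c\<^sup>2 * (norm (w x - g x) powr p + (norm (g x - g y) powr p + norm (w y - g y) powr p)))"
        by (rule ennreal_leI)
      then show ?thesis by (simp add: ennreal_mult')
    qed
    have "(\<integral>\<^sup>+z. ennreal (norm (w (fst z) - w (snd z)) powr p) * ?h z \<partial>P)
       \<le> (\<integral>\<^sup>+z. ennreal (c\<^sup>2) * (?a (fst z) * ?h z + (?b z * ?h z + ?a (snd z) * ?h z)) \<partial>P)"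
    proof (rule nn_integral_mono)
      fix z
      show "ennreal (norm (w (fst z) - w (snd z)) powr p) * ?h z \<le> ennreal (c\<^sup>2) * (?a (fst z) * ?h z + (?b z * ?h z + ?a (snd z) * ?h z))"
        using mult_right_mono[OF pt[of "fst z" "snd z"], of "?h z"] by (simp only: distrib_right mult.assoc fst_conv snd_conv zero_le simp_thms)
    qed
    also have "\<dots> = ennreal (c\<^sup>2) * ((\<integral>\<^sup>+z. ?a (fst z) * ?h z \<partial>P) + ((\<integral>\<^sup>+z. ?b z * ?h z \<partial>P) + (\<integral>\<^sup>+z. ?a (snd z) * ?h z \<partial>P)))"
      by (simp add: nn_integral_cmult nn_integral_add)
    also have "\<dots> \<le> ennreal (c\<^sup>2) * (ennreal d + (ennreal d + ennreal d))"
    proof (intro mult_left_mono add_mono)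
      show "(\<integral>\<^sup>+z. ?a (fst z) * ?h z \<partial>P) \<le> ennreal d" by (subst nn_integral_fst_H) (use g(3) in auto)
      show "(\<integral>\<^sup>+z. ?a (snd z) * ?h z \<partial>P) \<le> ennreal d" by (subst nn_integral_snd_H) (use g(3) in auto)
    qed (use elim in auto)
    also have "\<dots> = ennreal (c\<^sup>2 * (3 * d))"
    proof -
      have "ennreal d + (ennreal d + ennreal d) = ennreal (d + (d + d))"
        using d by (simp del: ennreal_plus add: ennreal_plus[symmetric])
      also have "d + (d + d) = 3 * d" by simp
      finally show ?thesis by (simp only: ennreal_mult'[OF zero_le_power2])
    qed
    also have "c\<^sup>2 * (3 * d) = e" using c by (simp add: d_def)
    finally show "(\<integral>\<^sup>+z. ennreal (norm (w (fst z) - w (snd z)) powr p) * ?h z \<partial>P) \<le> ennreal e" .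
  qed
qed

text \<open>Writing w(y) = w(x) + (w(y) - w(x)) leaves a main term, in which the kernel is
  integrated in y, and a remainder treated by Young's inequality and continuity in the mean. The
  growth condition on \<open>v\<close> covers v = u with p = 2 and the nonlinearity with p =
  \<alpha>+2. The modulation \<open>m\<close> tends to 1 only for fixed x, so the main term needs
  dominated convergence in x.\<close>

lemma approximate_identity:
  fixes v w :: "'a \<Rightarrow> complex" and m :: "nat \<Rightarrow> 'a \<Rightarrow> 'a \<Rightarrow> complex"
  assumes [measurable]: "v \<in> borel_measurable borel" "w \<in> borel_measurable borel" and p: "p > 1"
    and int: "integrable lborel (\<lambda>x. norm (w x) powr p)"
    and v: "\<And>x. norm (v x) \<le> norm (w x) powr (p - 1)"
    and m_meas [measurable]: "\<And>n. (\<lambda>z. m n (fst z) (snd z)) \<in> borel_measurable (borel \<Otimes>\<^sub>M borel)"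
    and m: "\<And>n x y. norm (m n x y) \<le> 1"
    and m_lim: "\<And>x e. e > 0 \<Longrightarrow> \<forall>\<^sub>F n in sequentially. \<forall>y. H n x y \<noteq> 0 \<longrightarrow> norm (m n x y - 1) \<le> e"
  shows "(\<lambda>n. LINT z|P. v (fst z) * cnj (w (snd z)) * (m n (fst z) (snd z) * of_real (H n (fst z) (snd z))))
    \<longlonglongrightarrow> (LINT x|lborel. v x * cnj (w x))"
proof -
  define I where "I = (\<integral>\<^sup>+x. ennreal (norm (w x) powr p) \<partial>lborel)"
  have I: "I < \<infinity>" using int unfolding I_def integrable_iff_bounded by simp
  let ?k = "\<lambda>n z. m n (fst z) (snd z) * complex_of_real (H n (fst z) (snd z))"
  let ?h = "\<lambda>n z. ennreal (H n (fst z) (snd z))"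
  let ?d = "\<lambda>n z. v (fst z) * cnj (w (snd z) - w (fst z)) * ?k n z"
  let ?e = "\<lambda>n z. v (fst z) * cnj (w (fst z)) * ?k n z"
  let ?a = "\<lambda>n z. ennreal (norm (w (fst z)) powr p) * ?h n z"
  let ?b = "\<lambda>n z. ennreal (norm (w (fst z) - w (snd z)) powr p) * ?h n z"
  let ?X = "\<lambda>n. \<integral>\<^sup>+z. ennreal (norm (?d n z)) \<partial>P"
  let ?L = "LINT x|lborel. v x * cnj (w x)"
  have k: "norm (?k n z) \<le> H n (fst z) (snd z)" for n z
    using mult_right_mono[OF m[of n "fst z" "snd z"] H_nonneg[of n "fst z" "snd z"]] by (simp add: norm_mult H_nonneg)
  have k_meas [measurable]: "?k n \<in> borel_measurable (borel \<Otimes>\<^sub>M borel)" for n by measurable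
  have [measurable]: "?k n \<in> borel_measurable P" for n using k_meas[of n] by simp
  have [measurable]: "cnj \<in> borel_measurable borel" by (intro borel_measurable_continuous_onI continuous_intros)
  have ww: "norm (w x) powr (p - 1) * norm (w x) = norm (w x) powr p" for x
  proof -
    have "norm (w x) powr (p - 1) * norm (w x) = norm (w x) powr (p - 1) * norm (w x) powr 1" by simp
    also have "\<dots> = norm (w x) powr p" by (simp only: powr_add[symmetric]) simp
    finally show ?thesis .
  qed
  have vw: "norm (v x) * norm (w x) \<le> norm (w x) powr p" for x
    using mult_right_mono[OF v[of x] norm_ge_zero[of "w x"]] ww[of x] by simp
  have fst_int: "integrable P (\<lambda>z. ?e n z)" for n
    unfolding integrable_iff_bounded
  proof
    have "(\<integral>\<^sup>+z. ennreal (norm (?e n z)) \<partial>P)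
       \<le> (\<integral>\<^sup>+z. ?a n z \<partial>P)"
    proof (rule nn_integral_mono)
      fix z
      have "norm (?e n z) = (norm (v (fst z)) * norm (w (fst z))) * norm (?k n z)"
        unfolding norm_mult complex_mod_cnj ..
      also have "\<dots> \<le> norm (w (fst z)) powr p * H n (fst z) (snd z)"
        by (intro mult_mono vw k) auto
      finally show "ennreal (norm (?e n z)) \<le> ?a n z"
        by (simp add: ennreal_mult''[symmetric] H_nonneg ennreal_leI)
    qed
    also have "\<dots> = I" unfolding I_def by (rule nn_integral_fst_H) simp
    finally show "(\<integral>\<^sup>+z. ennreal (norm (?e n z)) \<partial>P) < \<infinity>" using I by (rule le_less_trans)
  qed measurable
  let ?D = "\<lambda>n. (\<integral>\<^sup>+z. ?b n z \<partial>P)"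
  have D0: "?D \<longlonglongrightarrow> 0" using mean_continuity[of w p] I p by (simp add: I_def)
  \<comment> \<open>The first term is small with \<eta>, uniformly in \<open>n\<close>; the second
    vanishes as \<open>n\<close> grows, for each fixed \<eta>.\<close>
  have diff_bound: "?X n
      \<le> ennreal \<eta> * I + ennreal (\<eta> powr (1 - p)) * ?D n" if \<eta>: "\<eta> > 0" for \<eta> n
  proof -
    have "?X n
       \<le> (\<integral>\<^sup>+z. ennreal \<eta> * (?a n z) + ennreal (\<eta> powr (1 - p)) * (?b n z) \<partial>P)"
    proof (rule nn_integral_mono)
      fix z
      have "norm (?d n z) = (norm (v (fst z)) * norm (w (fst z) - w (snd z))) * norm (?k n z)"
        unfolding norm_mult complex_mod_cnj by (simp only: norm_minus_commute)
      also have "\<dots> \<le> (norm (w (fst z)) powr (p - 1) * norm (w (fst z) - w (snd z))) * H n (fst z) (snd z)"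
        by (intro mult_mono v k) auto
      also have "\<dots> \<le> (\<eta> * norm (w (fst z)) powr p + \<eta> powr (1 - p) * norm (w (fst z) - w (snd z)) powr p) * H n (fst z) (snd z)"
        by (intro mult_right_mono powr_Young H_nonneg p \<eta>) auto
      finally have "ennreal (norm (?d n z)) \<le>
         ennreal (\<eta> * (norm (w (fst z)) powr p * H n (fst z) (snd z)) + \<eta> powr (1 - p) * (norm (w (fst z) - w (snd z)) powr p * H n (fst z) (snd z)))"
        by (intro ennreal_leI) (simp add: algebra_simps)
      also have "\<dots> = ennreal \<eta> * (?a n z) + ennreal (\<eta> powr (1 - p)) * (?b n z)"
        using \<eta> H_nonneg by (simp add: ennreal_mult)
      finally show "ennreal (norm (?d n z)) \<le> \<dots>" .
    qed
    also have "\<dots> = ennreal \<eta> * (\<integral>\<^sup>+z. ?a n z \<partial>P) + ennreal (\<eta> powr (1 - p)) * ?D n"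
      by (simp add: nn_integral_add nn_integral_cmult)
    also have "(\<integral>\<^sup>+z. ?a n z \<partial>P) = I"
      unfolding I_def by (rule nn_integral_fst_H) simp
    finally show ?thesis .
  qed
  have diff_lim: "?X \<longlonglongrightarrow> 0"
  proof (rule ennreal_tendsto_0I)
    fix e :: real assume e: "e > 0"
    define J where "J = enn2real I"
    have J: "I = ennreal J" "J \<ge> 0" using I by (auto simp: J_def)
    \<comment> \<open>Chosen before \<open>n\<close>, so that \<eta> I is at most e/2; the summand 1
      allows \<open>J\<close> to be 0.\<close>
    define \<eta> where "\<eta> = e / (2 * (J + 1))"
    have \<eta>: "\<eta> > 0" using e J by (simp add: \<eta>_def)
    have "\<eta> * J \<le> e / 2" using e J by (simp add: \<eta>_def field_simps)
    define c where "c = \<eta> powr (1 - p)"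
    have c: "c > 0" using \<eta> by (simp add: c_def)
    have "\<forall>\<^sub>F n in sequentially. ?D n < ennreal (e / (2 * c))"
      using e c by (intro order_tendstoD(2)[OF D0]) auto
    then show "\<forall>\<^sub>F n in sequentially. ?X n \<le> ennreal e"
    proof (rule eventually_mono)
      fix n assume n: "?D n < ennreal (e / (2 * c))"
      have "?X n \<le> ennreal \<eta> * I + ennreal c * ?D n"
        unfolding c_def by (rule diff_bound[OF \<eta>])
      also have "\<dots> \<le> ennreal \<eta> * ennreal J + ennreal c * ennreal (e / (2 * c))"
        unfolding J(1) by (intro add_left_mono mult_left_mono less_imp_le[OF n]) auto
      also have "\<dots> = ennreal (\<eta> * J + e / 2)"
        using \<eta> J c e by (simp add: ennreal_mult'[symmetric] ennreal_plus[symmetric] del: ennreal_plus)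
      also have "\<dots> \<le> ennreal e" using \<open>\<eta> * J \<le> e / 2\<close> by (intro ennreal_leI) simp
      finally show "?X n \<le> ennreal e" .
    qed
  qed
  have diff_int: "integrable P (\<lambda>z. ?d n z)" for n
    unfolding integrable_iff_bounded
  proof
    have "?D n \<le> (\<integral>\<^sup>+z. ennreal (2 powr p) * (?a n z + ennreal (norm (w (snd z)) powr p) * ?h n z) \<partial>P)"
    proof (rule nn_integral_mono)
      fix z
      have "ennreal (norm (w (fst z) - w (snd z)) powr p) \<le> ennreal (2 powr p * (norm (w (fst z)) powr p + norm (w (snd z)) powr p))"
        using norm_diff_powr_le[of p "w (fst z)" "w (snd z)" 0] p by (intro ennreal_leI) simp
      from mult_right_mono[OF this, of "?h n z"]
      show "?b n z \<le> ennreal (2 powr p) * (?a n z + ennreal (norm (w (snd z)) powr p) * ?h n z)"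
        by (simp add: ennreal_mult' distrib_left distrib_right mult.assoc)
    qed
    also have "\<dots> = ennreal (2 powr p) * ((\<integral>\<^sup>+z. ?a n z \<partial>P) + (\<integral>\<^sup>+z. ennreal (norm (w (snd z)) powr p) * ?h n z \<partial>P))"
      by (simp add: nn_integral_add nn_integral_cmult)
    also have "\<dots> = ennreal (2 powr p) * (I + I)"
      unfolding I_def by (subst nn_integral_fst_H nn_integral_snd_H, simp)+ simp
    finally have "?D n < \<infinity>" using I by (auto simp: ennreal_mult_less_top intro: le_less_trans)
    then have "ennreal 1 * I + ennreal (1 powr (1 - p)) * ?D n < \<infinity>" using I by simp
    with diff_bound[of 1 n] show "?X n < \<infinity>"
      by (auto intro: le_less_trans)
  qed measurable
  have "(\<lambda>n. LINT z|P. ?d n z) \<longlonglongrightarrow> 0"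
  proof (rule tendsto_norm_zero_cancel, rule LIMSEQ_I)
    fix e :: real assume e: "e > 0"
    then have "\<forall>\<^sub>F n in sequentially. ?X n < ennreal (e / 2)"
      by (intro order_tendstoD(2)[OF diff_lim]) auto
    then obtain N where N: "\<And>n. n \<ge> N \<Longrightarrow> ?X n < ennreal (e / 2)"
      unfolding eventually_sequentially by blast
    have "norm (LINT z|P. ?d n z) < e" if "n \<ge> N" for n
      by (rule le_less_trans[OF integral_norm_le_nn_integral[OF less_imp_le[OF N[OF that]]]]) (use e in simp_all)
    then show "\<exists>N. \<forall>n\<ge>N. norm (norm (LINT z|P. ?d n z) - 0) < e"
      unfolding diff_zero real_norm_def abs_norm_cancel by blast
  qed
  moreover have "(\<lambda>n. LINT z|P. ?e n z) \<longlonglongrightarrow> ?L"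
  proof -
    have Hi: "integrable lborel (H n x)" "(LINT y|lborel. H n x y) = 1" for n x
    proof -
      have "(\<integral>\<^sup>+y. ennreal (norm (H n x y)) \<partial>lborel) = 1" using H_nonneg H_fst by simp
      then show "integrable lborel (H n x)" unfolding integrable_iff_bounded using H_section by auto
      then show "(LINT y|lborel. H n x y) = 1"
        using H_nonneg H_section by (subst integral_eq_nn_integral) (auto simp: H_fst)
    qed
    have ki: "integrable lborel (\<lambda>y. m n x y * complex_of_real (H n x y))" for n x
    proof (rule Bochner_Integration.integrable_bound[OF Hi(1)])
      show "(\<lambda>y. m n x y * complex_of_real (H n x y)) \<in> borel_measurable lborel"
        using measurable_compose[OF _ k_meas, of "\<lambda>y. (x, y)" borel] by simp
      show "AE y in lborel. norm (m n x y * complex_of_real (H n x y)) \<le> norm (H n x y)"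
        using k[of n "(x, _)"] H_nonneg by auto
    qed
    \<comment> \<open>Total mass of the modulated kernel as seen from x. It is bounded by 1 and
      tends to 1, because the modulation is close to 1 wherever \<open>H\<close> is nonzero.\<close>
    define K where "K n x = (LINT y|lborel. m n x y * complex_of_real (H n x y))" for n x
    have K_le: "norm (K n x) \<le> 1" for n x
    proof -
      have "norm (K n x) \<le> (LINT y|lborel. norm (m n x y * complex_of_real (H n x y)))"
        unfolding K_def by (rule integral_norm_bound)
      also have "\<dots> \<le> (LINT y|lborel. H n x y)"
        using k[of n "(x, _)"] by (intro integral_mono integrable_norm ki Hi) auto
      finally show ?thesis using Hi by simp
    qed
    have K_lim: "(\<lambda>n. K n x) \<longlonglongrightarrow> 1" for x
    proof (rule LIMSEQ_I)
      fix e :: real assume e: "e > 0"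
      then obtain N where N: "\<And>n y. n \<ge> N \<Longrightarrow> H n x y \<noteq> 0 \<Longrightarrow> norm (m n x y - 1) \<le> e / 2"
        using m_lim[of "e/2" x] unfolding eventually_sequentially by auto
      have "norm (K n x - 1) < e" if n: "n \<ge> N" for n
      proof -
        have H1: "integrable lborel (\<lambda>y. complex_of_real (H n x y))" using Hi(1) by simp
        have "K n x - 1 = K n x - (LINT y|lborel. complex_of_real (H n x y))" using Hi by simp
        also have "\<dots> = (LINT y|lborel. m n x y * complex_of_real (H n x y) - complex_of_real (H n x y))"
          unfolding K_def by (rule Bochner_Integration.integral_diff[symmetric, OF ki H1])
        also have "norm \<dots> \<le> (LINT y|lborel. norm (m n x y * complex_of_real (H n x y) - complex_of_real (H n x y)))"
          by (rule integral_norm_bound)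
        also have "\<dots> \<le> (LINT y|lborel. e / 2 * H n x y)"
        proof (rule integral_mono)
          fix y
          have "norm (m n x y * complex_of_real (H n x y) - complex_of_real (H n x y)) = norm (m n x y - 1) * H n x y"
          proof -
            have "m n x y * complex_of_real (H n x y) - complex_of_real (H n x y) = (m n x y - 1) * complex_of_real (H n x y)"
              by (simp add: left_diff_distrib)
            then show ?thesis using H_nonneg[of n x y] by (simp only: norm_mult norm_of_real abs_of_nonneg)
          qed
          also have "\<dots> \<le> e / 2 * H n x y"
            using N[OF n, of y] H_nonneg[of n x y] by (cases "H n x y = 0") (auto intro: mult_right_mono)
          finally show "norm (m n x y * complex_of_real (H n x y) - complex_of_real (H n x y)) \<le> e / 2 * H n x y" .
        qed (intro integrable_norm Bochner_Integration.integrable_diff ki H1 integrable_mult_right Hi)+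
        also have "\<dots> = e / 2" using Hi by simp
        finally show ?thesis using e by simp
      qed
      then show "\<exists>N. \<forall>n\<ge>N. norm (K n x - 1) < e" by blast
    qed
    have [measurable]: "K n \<in> borel_measurable borel" for n
    proof -
      have "(\<lambda>z. ?k n z) \<in> borel_measurable (borel \<Otimes>\<^sub>M lborel)" using k_meas by simp
      then have "case_prod (\<lambda>x y. m n x y * complex_of_real (H n x y)) \<in> borel_measurable (borel \<Otimes>\<^sub>M lborel)"
        by (simp add: case_prod_beta')
      then show ?thesis unfolding K_def by (rule lborel.borel_measurable_lebesgue_integral)
    qed
    have "(LINT z|P. ?e n z) = (LINT x|lborel. v x * cnj (w x) * K n x)" for n
    proof -
      have "(LINT z|P. ?e n z) = (LINT x|lborel. LINT y|lborel. v x * cnj (w x) * (m n x y * complex_of_real (H n x y)))"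
        using lborel_pair.integral_fst[of "\<lambda>x y. v x * cnj (w x) * (m n x y * complex_of_real (H n x y))"] fst_int[of n]
        by (simp add: case_prod_beta')
      also have "\<dots> = (LINT x|lborel. v x * cnj (w x) * K n x)" unfolding K_def by (simp only: integral_mult_right_zero)
      finally show ?thesis .
    qed
    moreover have "(\<lambda>n. LINT x|lborel. v x * cnj (w x) * K n x) \<longlonglongrightarrow> ?L"
    proof (rule integral_dominated_convergence[OF _ _ int])
      show "AE x in lborel. (\<lambda>n. v x * cnj (w x) * K n x) \<longlonglongrightarrow> v x * cnj (w x)"
        using tendsto_mult[OF tendsto_const K_lim] by (intro AE_I2) fastforce
      show "AE x in lborel. norm (v x * cnj (w x) * K n x) \<le> norm (w x) powr p" for n
      proof (intro AE_I2)
        fix x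
        have "norm (v x * cnj (w x) * K n x) = (norm (v x) * norm (w x)) * norm (K n x)" unfolding norm_mult complex_mod_cnj ..
        also have "\<dots> \<le> norm (w x) powr p * 1" by (intro mult_mono vw K_le) auto
        finally show "norm (v x * cnj (w x) * K n x) \<le> norm (w x) powr p" by simp
      qed
    qed measurable
    ultimately show ?thesis by (simp only:)
  qed
  ultimately have "(\<lambda>n. (LINT z|P. ?d n z) + (LINT z|P. ?e n z))
     \<longlonglongrightarrow> 0 + ?L" by (rule tendsto_add)
  moreover have "(LINT z|P. ?d n z) + (LINT z|P. ?e n z)
     = (LINT z|P. v (fst z) * cnj (w (snd z)) * ?k n z)" for n
    by (subst Bochner_Integration.integral_add[symmetric, OF diff_int fst_int])
       (intro Bochner_Integration.integral_cong refl, simp add: algebra_simps)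
  ultimately show ?thesis by simp
qed

end

section \<open>The self-similar kernel\<close>

text \<open>Removes from both copies of \<open>u\<close> the oscillation exp(i|x|^2/4t) produced by
  the free flow. The exponent is written with a sum and a factor -1 to match the closure rules for
  smooth functions.\<close>

definition phase :: "real \<Rightarrow> 'a::euclidean_space \<Rightarrow> 'a \<Rightarrow> complex" where
  "phase t x y = exp (of_real (x \<bullet> x + - 1 * (y \<bullet> y)) * (- \<i> / (4 * of_real t)))"

text \<open>\<open>i\<close> and \<open>j\<close> count derivatives of the cutoff in x+y and of the
  mollifier in x-y, so derivatives of packets are combinations of packets. \<open>A\<close> and
  \<open>B\<close> are inverse squared widths in the self-similar variable.\<close>

definition packet :: "real \<Rightarrow> real \<Rightarrow> real \<Rightarrow> nat \<Rightarrow> nat \<Rightarrow> real \<Rightarrow> 'a::euclidean_space \<Rightarrow> 'a \<Rightarrow> complex" where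
  "packet c A B i j t x y = of_real (c / t ^ DIM('a)) * (phase t x y *
     (of_real (bump i (A / t\<^sup>2 * ((x + y) \<bullet> (x + y)))) * of_real (bump j (B / t\<^sup>2 * ((x - y) \<bullet> (x - y))))))"

lemma smooth_quadratic:
  "smooth (\<lambda>x. complex_of_real (a * ((x + s *\<^sub>R y) \<bullet> (x + s *\<^sub>R y))))"
proof -
  have "(\<lambda>x. complex_of_real (a * ((x + s *\<^sub>R y) \<bullet> (x + s *\<^sub>R y)))) =
    (\<lambda>x. of_real a * (complex_of_real (x \<bullet> x) + (of_real (2 * s) * complex_of_real (x \<bullet> y) + of_real (s\<^sup>2 * (y \<bullet> y)))))"
    by (simp add: fun_eq_iff inner_add inner_commute power2_eq_square algebra_simps)
  then show ?thesis by (simp only:) (intro smooth_mult smooth_add smooth_const smooth_inner_self smooth_inner_right)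
qed

lemma smooth_packet: "smooth (\<lambda>x. packet c A B i j t x y)"
  unfolding packet_def phase_def of_real_add of_real_mult[of "-1"]
  using smooth_quadratic[of "A / t\<^sup>2" 1 y] smooth_quadratic[of "B / t\<^sup>2" "-1" y]
  by (intro smooth_mult smooth_add smooth_const smooth_exp smooth_inner_self smooth_bump) simp_all

lemma packet_hermitian: "packet c A B i j t y x = cnj (packet c A B i j t x y)"
  by (simp add: packet_def phase_def exp_cnj add.commute inner_commute inner_diff algebra_simps)

lemma packet_has_derivative:
  "((\<lambda>x. packet c A B i j t x y) has_derivative
     (\<lambda>v. (- \<i> / (2 * of_real t)) * of_real (x \<bullet> v) * packet c A B i j t x y
        + of_real (2 * (A / t\<^sup>2) * ((x + y) \<bullet> v)) * packet c A B (Suc i) j t x y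
        + of_real (2 * (B / t\<^sup>2) * ((x - y) \<bullet> v)) * packet c A B i (Suc j) t x y)) (at x)"
proof -
  have E: "((\<lambda>x. phase t x y) has_derivative (\<lambda>v. (- \<i> / (2 * of_real t)) * of_real (x \<bullet> v) * phase t x y)) (at x)"
  proof -
    have "((\<lambda>x. x \<bullet> x + - 1 * (y \<bullet> y)) has_derivative (\<lambda>v. x \<bullet> v + v \<bullet> x)) (at x)"
      by (auto intro!: derivative_eq_intros)
    from has_derivative_mult_left[OF has_derivative_of_real[OF this], of "- \<i> / (4 * complex_of_real t)"]
    have this: "((\<lambda>x. of_real (x \<bullet> x + - 1 * (y \<bullet> y)) * (- \<i> / (4 * of_real t))) has_derivative
        (\<lambda>v. of_real (x \<bullet> v + v \<bullet> x) * (- \<i> / (4 * of_real t)))) (at x)" .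
    note E0 = has_derivative_compose[OF this DERIV_exp[unfolded has_field_derivative_def]]
    define q where "q = - \<i> / (4 * complex_of_real t)"
    have h: "- \<i> / (2 * complex_of_real t) = 2 * q" by (simp add: q_def)
    show ?thesis using E0 unfolding phase_def h q_def[symmetric] by (simp add: inner_commute algebra_simps)
  qed
  have Q: "((\<lambda>x. complex_of_real (bump i (a * ((x + z) \<bullet> (x + z))))) has_derivative
      (\<lambda>v. of_real (2 * a * ((x + z) \<bullet> v)) * of_real (bump (Suc i) (a * ((x + z) \<bullet> (x + z)))))) (at x)" for a i z
  proof -
    have "((\<lambda>x. a * ((x + z) \<bullet> (x + z))) has_derivative (\<lambda>v. 2 * a * ((x + z) \<bullet> v))) (at x)"
      by (auto intro!: derivative_eq_intros simp: inner_commute algebra_simps)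
    from has_derivative_of_real[OF has_derivative_compose[OF this bump_has_real_derivative[unfolded has_field_derivative_def]]]
    show ?thesis by (simp add: mult_ac)
  qed
  show ?thesis
    unfolding packet_def
    using has_derivative_mult_right[OF has_derivative_mult[OF E has_derivative_mult[OF Q[of i "A / t\<^sup>2" y] Q[of j "B / t\<^sup>2" "- y"]]],
        of "of_real (c / t ^ DIM('a))"]
    by (simp only: diff_conv_add_uminus[symmetric] ring_distribs mult_ac)
       (erule has_derivative_eq_rhs, simp add: fun_eq_iff algebra_simps)
qed

section \<open>Commutator of the kernel with the free flow\<close>

lemma dir_deriv_dir_deriv_packet:
  fixes y :: "'a::euclidean_space" and A B c :: real
  assumes b: "b \<in> Basis"
  defines "k \<equiv> \<lambda>t::real. - \<i> / (2 * complex_of_real t)" and "a \<equiv> \<lambda>t. complex_of_real (2 * (A / t\<^sup>2))" and "d \<equiv> \<lambda>t. complex_of_real (2 * (B / t\<^sup>2))"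
    and "p \<equiv> packet c A B"
  shows "dir_deriv b (dir_deriv b (\<lambda>x. p 0 0 t x y)) x =
     (k t * k t * of_real ((x \<bullet> b) * (x \<bullet> b)) + k t) * p 0 0 t x y
     + (a t * a t * of_real (((x + y) \<bullet> b) * ((x + y) \<bullet> b)) * p 2 0 t x y + a t * p 1 0 t x y)
     + (d t * d t * of_real (((x - y) \<bullet> b) * ((x - y) \<bullet> b)) * p 0 2 t x y + d t * p 0 1 t x y)
     + 2 * (k t * a t * of_real ((x \<bullet> b) * ((x + y) \<bullet> b)) * p 1 0 t x y + k t * d t * of_real ((x \<bullet> b) * ((x - y) \<bullet> b)) * p 0 1 t x y
        + a t * d t * of_real (((x + y) \<bullet> b) * ((x - y) \<bullet> b)) * p 1 1 t x y)"
proof -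
  have p': "((\<lambda>x. p i j t x y) has_derivative
     (\<lambda>v. k t * of_real (x \<bullet> v) * p i j t x y + a t * of_real ((x + y) \<bullet> v) * p (Suc i) j t x y
        + d t * of_real ((x - y) \<bullet> v) * p i (Suc j) t x y)) (at x)" for i j x
    using packet_has_derivative[of c A B i j t y x] unfolding k_def a_def d_def p_def by simp
  have 1: "dir_deriv b (\<lambda>x. p 0 0 t x y) = (\<lambda>x. k t * of_real (x \<bullet> b) * p 0 0 t x y
     + a t * of_real ((x + y) \<bullet> b) * p (Suc 0) 0 t x y + d t * of_real ((x - y) \<bullet> b) * p 0 (Suc 0) t x y)"
    by (rule dir_derivI) (rule p')
  have bb: "b \<bullet> b = 1" using b by simp
  have l: "((\<lambda>x. complex_of_real ((x + z) \<bullet> b)) has_derivative (\<lambda>v. of_real (v \<bullet> b))) (at x)" for z x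
    by (auto intro!: derivative_eq_intros)
  let ?D = "\<lambda>v. (k t * of_real (x \<bullet> b) * (k t * of_real (x \<bullet> v) * p 0 0 t x y + a t * of_real ((x + y) \<bullet> v) * p (Suc 0) 0 t x y
        + d t * of_real ((x - y) \<bullet> v) * p 0 (Suc 0) t x y) + k t * of_real (v \<bullet> b) * p 0 0 t x y)
     + (a t * of_real ((x + y) \<bullet> b) * (k t * of_real (x \<bullet> v) * p (Suc 0) 0 t x y + a t * of_real ((x + y) \<bullet> v) * p (Suc (Suc 0)) 0 t x y
        + d t * of_real ((x - y) \<bullet> v) * p (Suc 0) (Suc 0) t x y) + a t * of_real (v \<bullet> b) * p (Suc 0) 0 t x y)
     + (d t * of_real ((x - y) \<bullet> b) * (k t * of_real (x \<bullet> v) * p 0 (Suc 0) t x y + a t * of_real ((x + y) \<bullet> v) * p (Suc 0) (Suc 0) t x y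
        + d t * of_real ((x - y) \<bullet> v) * p 0 (Suc (Suc 0)) t x y) + d t * of_real (v \<bullet> b) * p 0 (Suc 0) t x y)"
  have "dir_deriv b (dir_deriv b (\<lambda>x. p 0 0 t x y)) x = ?D b"
    unfolding 1
    by (rule dir_deriv_eqI[where D="?D"])
      (intro has_derivative_add has_derivative_mult p' has_derivative_mult_right l l[of "- y", simplified] l[of 0, simplified])
  then show ?thesis by (simp add: bb numeral_2_eq_2 algebra_simps)
qed

lemma lap_packet:
  fixes y :: "'a::euclidean_space" and A B c :: real
  defines "k \<equiv> \<lambda>t::real. - \<i> / (2 * complex_of_real t)" and "a \<equiv> \<lambda>t. complex_of_real (2 * (A / t\<^sup>2))" and "d \<equiv> \<lambda>t. complex_of_real (2 * (B / t\<^sup>2))"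
    and "p \<equiv> packet c A B"
  shows "kernel_lap (p 0 0) t x y =
     (k t * k t * of_real (x \<bullet> x) + of_nat DIM('a) * k t) * p 0 0 t x y
     + (a t * a t * of_real ((x + y) \<bullet> (x + y)) * p 2 0 t x y + of_nat DIM('a) * a t * p 1 0 t x y)
     + (d t * d t * of_real ((x - y) \<bullet> (x - y)) * p 0 2 t x y + of_nat DIM('a) * d t * p 0 1 t x y)
     + 2 * (k t * a t * of_real (x \<bullet> (x + y)) * p 1 0 t x y + k t * d t * of_real (x \<bullet> (x - y)) * p 0 1 t x y
        + a t * d t * of_real ((x + y) \<bullet> (x - y)) * p 1 1 t x y)"
proof -
  have s: "(\<Sum>b\<in>Basis. complex_of_real ((v \<bullet> b) * (w \<bullet> b))) = of_real (v \<bullet> w)" for v w :: 'a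
    by (subst (3) euclidean_inner) simp
  have ks: "- \<i> / (2 * complex_of_real t) = k t" "complex_of_real (2 * (A / t\<^sup>2)) = a t" "complex_of_real (2 * (B / t\<^sup>2)) = d t"
    by (simp_all only: k_def a_def d_def)
  note dd = dir_deriv_dir_deriv_packet[where A=A and B=B and c=c and t=t and y=y and x=x, unfolded ks, folded p_def]
  have "kernel_lap (p 0 0) t x y = (\<Sum>b\<in>Basis. (k t * k t * of_real ((x \<bullet> b) * (x \<bullet> b)) + k t) * p 0 0 t x y
     + (a t * a t * of_real (((x + y) \<bullet> b) * ((x + y) \<bullet> b)) * p 2 0 t x y + a t * p 1 0 t x y)
     + (d t * d t * of_real (((x - y) \<bullet> b) * ((x - y) \<bullet> b)) * p 0 2 t x y + d t * p 0 1 t x y)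
     + 2 * (k t * a t * of_real ((x \<bullet> b) * ((x + y) \<bullet> b)) * p 1 0 t x y + k t * d t * of_real ((x \<bullet> b) * ((x - y) \<bullet> b)) * p 0 1 t x y
        + a t * d t * of_real (((x + y) \<bullet> b) * ((x - y) \<bullet> b)) * p 1 1 t x y))"
    unfolding kernel_lap_def lap_def by (rule sum.cong[OF refl dd])
  also have "\<dots> = (k t * k t * of_real (x \<bullet> x) + of_nat DIM('a) * k t) * p 0 0 t x y
     + (a t * a t * of_real ((x + y) \<bullet> (x + y)) * p 2 0 t x y + of_nat DIM('a) * a t * p 1 0 t x y)
     + (d t * d t * of_real ((x - y) \<bullet> (x - y)) * p 0 2 t x y + of_nat DIM('a) * d t * p 0 1 t x y)
     + 2 * (k t * a t * of_real (x \<bullet> (x + y)) * p 1 0 t x y + k t * d t * of_real (x \<bullet> (x - y)) * p 0 1 t x y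
        + a t * d t * of_real ((x + y) \<bullet> (x - y)) * p 1 1 t x y)"
    by (simp only: distrib_right[of _ _ "p _ _ _ _ _"] distrib_left[of 2] sum.distrib sum_distrib_left[symmetric] sum_distrib_right[symmetric] s sum_constant mult.assoc
        mult.left_commute[of "k t" "of_nat DIM('a)"] mult.left_commute[of "a t" "of_nat DIM('a)"] mult.left_commute[of "d t" "of_nat DIM('a)"])
  finally show ?thesis .
qed

text \<open>The summands come, in order, from the dilation factor, from the phase, and from the
  factor 1/t^2 in the arguments of the two bumps.\<close>

definition packet_dt :: "real \<Rightarrow> real \<Rightarrow> real \<Rightarrow> real \<Rightarrow> 'a::euclidean_space \<Rightarrow> 'a \<Rightarrow> complex" where
  "packet_dt c A B t x y = (- of_nat DIM('a) / of_real t + \<i> * of_real (x \<bullet> x - y \<bullet> y) / (4 * of_real t ^ 2)) * packet c A B 0 0 t x y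
     + (of_real (- (2 * A / t ^ 3) * ((x + y) \<bullet> (x + y))) * packet c A B 1 0 t x y
       + of_real (- (2 * B / t ^ 3) * ((x - y) \<bullet> (x - y))) * packet c A B 0 1 t x y)"

lemma packet_has_time_derivative:
  fixes x y :: "'a::euclidean_space"
  assumes t: "t > 0"
  shows "((\<lambda>t. packet c A B 0 0 t x y) has_vector_derivative packet_dt c A B t x y) (at t)"
proof -
  let ?N = "DIM('a)"
  have R: "((\<lambda>t. complex_of_real (c / t ^ ?N)) has_vector_derivative - of_nat ?N / of_real t * of_real (c / t ^ ?N)) (at t)"
  proof -
    have "((\<lambda>t. c / t ^ ?N) has_real_derivative - real ?N / t * (c / t ^ ?N)) (at t)"
    proof -
      have "t ^ (?N - Suc 0) * t = t ^ ?N" by (metis DIM_positive Suc_pred mult.commute power_Suc One_nat_def)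
      then show ?thesis using t
        by (auto intro!: derivative_eq_intros simp: field_simps power2_eq_square)
    qed
    then have "((\<lambda>t. complex_of_real (c / t ^ ?N)) has_vector_derivative of_real (- real ?N / t * (c / t ^ ?N))) (at t)"
      by (rule has_vector_derivative_of_real)
    moreover have "- of_nat ?N / of_real t * of_real (c / t ^ ?N) = complex_of_real (- real ?N / t * (c / t ^ ?N))" by simp
    ultimately show ?thesis by (simp only:)
  qed
  have E: "((\<lambda>t. phase t x y) has_vector_derivative \<i> * of_real (x \<bullet> x - y \<bullet> y) / (4 * of_real t ^ 2) * phase t x y) (at t)"
    unfolding phase_def
    by (rule has_vector_derivative_real_field)
       (use t in \<open>auto intro!: derivative_eq_intros simp: field_simps power2_eq_square\<close>)
  have Q: "((\<lambda>t. complex_of_real (bump 0 (a / t\<^sup>2 * q))) has_vector_derivative of_real (- (2 * a / t ^ 3) * q) * of_real (bump 1 (a / t\<^sup>2 * q))) (at t)" for a q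
  proof -
    have "((\<lambda>t. a / t\<^sup>2 * q) has_real_derivative - (2 * a / t ^ 3) * q) (at t)"
      using t by (auto intro!: derivative_eq_intros simp: field_simps power2_eq_square power3_eq_cube)
    from DERIV_chain2[OF bump_has_real_derivative this, of 0]
    have "((\<lambda>t. complex_of_real (bump 0 (a / t\<^sup>2 * q))) has_vector_derivative of_real (bump (Suc 0) (a / t\<^sup>2 * q) * (- (2 * a / t ^ 3) * q))) (at t)"
      by (rule has_vector_derivative_of_real)
    then show ?thesis by (simp only: of_real_mult[symmetric] One_nat_def mult.commute[of "bump _ _"])
  qed
  show ?thesis
    using has_vector_derivative_mult[OF R has_vector_derivative_mult[OF E has_vector_derivative_mult[OF Q[of A "(x + y) \<bullet> (x + y)"] Q[of B "(x - y) \<bullet> (x - y)"]]]]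
    unfolding packet_dt_def packet_def by (simp only: ring_distribs mult_ac add_ac One_nat_def)
qed

text \<open>The terms without derivatives of the two bumps, and those with one derivative, cancel:
  the phase and the dilation follow the free flow.\<close>

lemma packet_remainder:
  fixes x y :: "'a::euclidean_space"
  assumes t: "t > 0"
  shows "packet_dt c A B t x y + \<i> * (kernel_lap (packet c A B 0 0) t x y - cnj (kernel_lap (packet c A B 0 0) t y x))
     = \<i> * of_real (16 * A * B / t ^ 4 * ((x + y) \<bullet> (x - y))) * packet c A B 1 1 t x y"
proof -
  \<comment> \<open>In terms of 1/t all coefficients are polynomials, so the cancellation reduces to
    a polynomial identity. Conjugation flips the sign of the imaginary \<open>k\<close> and fixes
    the real \<open>a\<close> and \<open>d\<close>.\<close>
  define \<tau> where "\<tau> = 1 / complex_of_real t"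
  have \<tau>: "1 / complex_of_real t = \<tau>" by (simp add: \<tau>_def)
  define k where "k = - \<i> / 2 * \<tau>"
  define a where "a = 2 * complex_of_real A * \<tau> * \<tau>"
  define d where "d = 2 * complex_of_real B * \<tau> * \<tau>"
  have k: "- \<i> / (2 * complex_of_real t) = k" "cnj k = - k"
    and a: "complex_of_real (2 * (A / t\<^sup>2)) = a" "cnj a = a"
    and d: "complex_of_real (2 * (B / t\<^sup>2)) = d" "cnj d = d"
    by (simp_all add: k_def a_def d_def \<tau>_def power2_eq_square)
  have h: "cnj (packet c A B i j t y x) = packet c A B i j t x y" for i j
    by (metis packet_hermitian complex_cnj_cnj)
  have cnj: "cnj (kernel_lap (packet c A B 0 0) t y x) =
     (k * k * of_real (y \<bullet> y) - of_nat DIM('a) * k) * packet c A B 0 0 t x y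
     + (a * a * of_real ((y + x) \<bullet> (y + x)) * packet c A B 2 0 t x y + of_nat DIM('a) * a * packet c A B 1 0 t x y)
     + (d * d * of_real ((y - x) \<bullet> (y - x)) * packet c A B 0 2 t x y + of_nat DIM('a) * d * packet c A B 0 1 t x y)
     + 2 * (- (k * a * of_real (y \<bullet> (y + x)) * packet c A B 1 0 t x y) - k * d * of_real (y \<bullet> (y - x)) * packet c A B 0 1 t x y
        + a * d * of_real ((y + x) \<bullet> (y - x)) * packet c A B 1 1 t x y)"
    unfolding lap_packet k a d by (simp add: h k(2) a(2) d(2))
  \<comment> \<open>Written through \<open>k\<close>, \<open>a\<close> and \<open>d\<close>, each
    term of the time derivative matches one of the commutator: dilation against the trace of the
    phase, phase against the square of its gradient, moving bumps against the mixed terms of phase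
    and bump.\<close>
  have dt: "packet_dt c A B t x y = (2 * of_nat DIM('a) * (- \<i>) * k + \<i> * (k * k) * of_real (y \<bullet> y - x \<bullet> x)) * packet c A B 0 0 t x y
     + (- 2 * \<i> * k * a * of_real ((x + y) \<bullet> (x + y)) * packet c A B 1 0 t x y - 2 * \<i> * k * d * of_real ((x - y) \<bullet> (x - y)) * packet c A B 0 1 t x y)"
  proof -
    have 1: "- of_nat DIM('a) / complex_of_real t = 2 * of_nat DIM('a) * (- \<i>) * k * 1"
      unfolding k_def \<tau>_def by simp
    have 2: "\<i> * of_real (x \<bullet> x - y \<bullet> y) / (4 * complex_of_real t ^ 2) = \<i> * (k * k) * of_real (y \<bullet> y - x \<bullet> x)"
    proof -
      have "(\<i> * \<tau>) * (\<i> * \<tau>) = (\<i> * \<i>) * (\<tau> * \<tau>)" by (simp only: mult_ac)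
      then have "k * k = - (1 / 4 * (\<tau> * \<tau>))" by (simp add: k_def)
      moreover have "complex_of_real (y \<bullet> y - x \<bullet> x) = - of_real (x \<bullet> x - y \<bullet> y)" by simp
      ultimately show ?thesis unfolding \<tau>_def by (simp only:) (simp add: power2_eq_square del: of_real_diff)
    qed
    have 3: "complex_of_real (- (2 * A / t ^ 3) * q) = - 2 * \<i> * k * a * of_real q"
      "complex_of_real (- (2 * B / t ^ 3) * q) = - 2 * \<i> * k * d * of_real q" for q
      unfolding k_def a_def d_def \<tau>_def by (simp_all add: power3_eq_cube)
    show ?thesis unfolding packet_dt_def 2 3 unfolding 1 by simp
  qed
  have r: "complex_of_real (16 * A * B / t ^ 4 * q) = 4 * a * d * of_real q" for q
    unfolding a_def d_def \<tau>_def by (simp add: power4_eq_xxxx mult.assoc)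
  show ?thesis
    unfolding cnj unfolding lap_packet k a d dt r
    by (simp add: inner_add_left inner_add_right inner_diff_left inner_diff_right inner_commute[of y x] algebra_simps)
qed

lemma norm_packet: "norm (packet c A B i j t x y) = \<bar>c / t ^ DIM('a)\<bar> * (\<bar>bump i (A / t\<^sup>2 * ((x + y) \<bullet> (x + y)))\<bar> * \<bar>bump j (B / t\<^sup>2 * ((x - y) \<bullet> (x - y)))\<bar>)"
  for x y :: "'a::euclidean_space"
proof -
  have "norm (phase t x y) = 1" by (simp add: phase_def norm_exp_eq_Re)
  then show ?thesis unfolding packet_def norm_mult norm_of_real by (simp only: mult_1)
qed

text \<open>On the support |x+y| is at most t/sqrt A and |x-y| at most t/sqrt B, so Cauchy-Schwarz
  turns AB/t^4 into sqrt(AB)/t^2. Only the cutoff derivative is replaced by its supremum; the other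
  bump stays, since it is what gets integrated.\<close>

lemma norm_packet_remainder_le:
  fixes x y :: "'a::euclidean_space"
  assumes t: "t > 0" and A: "A > 0" and B: "B > 0" and c: "c \<ge> 0" and M: "\<And>v. v \<ge> 0 \<Longrightarrow> \<bar>bump 1 v\<bar> \<le> M"
  shows "norm (\<i> * of_real (16 * A * B / t ^ 4 * ((x + y) \<bullet> (x - y))) * packet c A B 1 1 t x y)
     \<le> 16 * sqrt (A * B) / t\<^sup>2 * M * (c / t ^ DIM('a) * \<bar>bump 1 (B / t\<^sup>2 * ((x - y) \<bullet> (x - y)))\<bar>)"
proof (cases "A / t\<^sup>2 * ((x + y) \<bullet> (x + y)) < 1 \<and> B / t\<^sup>2 * ((x - y) \<bullet> (x - y)) < 1")
  case True
  have "norm (x + y) ^ 2 \<le> t\<^sup>2 / A" "norm (x - y) ^ 2 \<le> t\<^sup>2 / B"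
    using True t A B by (auto simp: dot_square_norm field_simps)
  then have "(norm (x + y) * norm (x - y)) ^ 2 \<le> (t\<^sup>2 / A) * (t\<^sup>2 / B)"
    unfolding power_mult_distrib using A B by (intro mult_mono) auto
  then have "norm (x + y) * norm (x - y) \<le> sqrt ((t\<^sup>2 / A) * (t\<^sup>2 / B))"
    by (rule real_le_rsqrt)
  also have "\<dots> = t\<^sup>2 / sqrt (A * B)"
  proof -
    have "sqrt (t ^ 4) = t\<^sup>2" by (rule real_sqrt_unique) (auto simp: power_mult[symmetric])
    then show ?thesis using t A B by (simp add: real_sqrt_divide real_sqrt_mult)
  qed
  finally have "\<bar>(x + y) \<bullet> (x - y)\<bar> \<le> t\<^sup>2 / sqrt (A * B)"
    using Cauchy_Schwarz_ineq2[of "x + y" "x - y"] by linarith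
  then have "16 * A * B / t ^ 4 * \<bar>(x + y) \<bullet> (x - y)\<bar> \<le> 16 * A * B / t ^ 4 * (t\<^sup>2 / sqrt (A * B))"
    using A B t by (intro mult_left_mono) auto
  also have "\<dots> = 16 * (sqrt (A * B) * sqrt (A * B)) / t ^ 4 * (t\<^sup>2 / sqrt (A * B))" using A B by simp
  also have "\<dots> = 16 * sqrt (A * B) / t\<^sup>2" using A B t by (simp add: field_simps power2_eq_square power4_eq_xxxx)
  finally have 1: "\<bar>16 * A * B / t ^ 4 * ((x + y) \<bullet> (x - y))\<bar> \<le> 16 * sqrt (A * B) / t\<^sup>2"
    using A B t by (simp add: abs_mult)
  have "norm (\<i> * of_real (16 * A * B / t ^ 4 * ((x + y) \<bullet> (x - y))) * packet c A B 1 1 t x y)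
    = \<bar>16 * A * B / t ^ 4 * ((x + y) \<bullet> (x - y))\<bar> * (c / t ^ DIM('a) * (\<bar>bump 1 (A / t\<^sup>2 * ((x + y) \<bullet> (x + y)))\<bar> * \<bar>bump 1 (B / t\<^sup>2 * ((x - y) \<bullet> (x - y)))\<bar>))"
    unfolding norm_mult norm_packet norm_of_real using c t by simp
  also have "\<dots> \<le> 16 * sqrt (A * B) / t\<^sup>2 * (c / t ^ DIM('a) * (M * \<bar>bump 1 (B / t\<^sup>2 * ((x - y) \<bullet> (x - y)))\<bar>))"
    using c t A B by (intro mult_mono 1 mult_left_mono mult_right_mono M) auto
  finally show ?thesis by (simp add: mult_ac)
next
  case False
  then have "packet c A B 1 1 t x y = 0" by (auto simp: packet_def bump_eq_0)
  moreover have "M \<ge> 0" using M[of 0] by simp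
  ultimately show ?thesis using A B c t by simp
qed

lemma kernel_mult:
  assumes k: "kernel k" and q: "continuous_on ({0<..} \<times> UNIV) (\<lambda>(t, x, y). q t x y)"
  shows "kernel (\<lambda>t x y. q t x y * k t x y)"
proof -
  have "continuous_on ({0<..} \<times> UNIV) (\<lambda>z. (\<lambda>(t, x, y). q t x y) z * (\<lambda>(t, x, y). k t x y) z)"
    by (rule continuous_on_mult[OF q k[unfolded kernel_def, THEN conjunct1]])
  moreover have "\<exists>R. \<forall>t\<in>{a..b}. \<forall>x y. norm x > R \<or> norm y > R \<longrightarrow> q t x y * k t x y = 0" if a: "0 < a" for a b
    using k[unfolded kernel_def, THEN conjunct2, rule_format, OF a] unfolding mult_eq_0_iff by blast
  ultimately show ?thesis unfolding kernel_def by (simp add: case_prod_beta')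
qed

text \<open>x and y are half the sum and half the difference of x+y and x-y. The bound is
  proportional to t, which is the origin of the cone.\<close>

lemma packet_support:
  fixes x y :: "'a::euclidean_space"
  assumes A: "A > 0" and B: "B > 0" and t: "t > 0" and nz: "packet c A B i j t x y \<noteq> 0"
  shows "norm x \<le> t * (1 / sqrt A + 1 / sqrt B)" "norm y \<le> t * (1 / sqrt A + 1 / sqrt B)"
proof -
  have "bump i (A / t\<^sup>2 * ((x + y) \<bullet> (x + y))) \<noteq> 0" "bump j (B / t\<^sup>2 * ((x - y) \<bullet> (x - y))) \<noteq> 0"
    using nz unfolding packet_def by auto
  then have *: "A / t\<^sup>2 * ((x + y) \<bullet> (x + y)) < 1" "B / t\<^sup>2 * ((x - y) \<bullet> (x - y)) < 1"
    using bump_eq_0 not_less by blast+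
  have "norm v \<le> t * (1 / sqrt C)" if "C / t\<^sup>2 * (v \<bullet> v) < 1" "C > 0" for C and v :: 'a
  proof -
    have "norm v ^ 2 \<le> t\<^sup>2 / C" using that t by (simp add: dot_square_norm field_simps)
    then have "norm v \<le> sqrt (t\<^sup>2 / C)" by (rule real_le_rsqrt)
    also have "\<dots> = t * (1 / sqrt C)" using t by (simp add: real_sqrt_divide)
    finally show ?thesis .
  qed
  from this[OF *(1) A] this[OF *(2) B] have s: "norm (x + y) + norm (x - y) \<le> t * (1 / sqrt A + 1 / sqrt B)"
    by (simp only: distrib_left)
  have "2 *\<^sub>R x = (x + y) + (x - y)" "2 *\<^sub>R y = (x + y) - (x - y)" by (simp_all add: scaleR_2)
  then have "2 * norm x \<le> norm (x + y) + norm (x - y)" "2 * norm y \<le> norm (x + y) + norm (x - y)"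
    using norm_triangle_ineq[of "x + y" "x - y"] norm_triangle_ineq4[of "x + y" "x - y"]
      norm_scaleR[of 2 x] norm_scaleR[of 2 y] by simp_all
  with s show "norm x \<le> t * (1 / sqrt A + 1 / sqrt B)" "norm y \<le> t * (1 / sqrt A + 1 / sqrt B)"
    using norm_ge_zero[of x] norm_ge_zero[of y] by linarith+
qed

lemma kernel_packet:
  assumes A: "A > 0" and B: "B > 0"
  shows "kernel (packet c A B i j :: real \<Rightarrow> 'a::euclidean_space \<Rightarrow> 'a \<Rightarrow> complex)"
  unfolding kernel_def
proof (intro conjI allI impI)
  have "continuous_on ({0<..} \<times> UNIV) (\<lambda>z::real \<times> 'a \<times> 'a. packet c A B i j (fst z) (fst (snd z)) (snd (snd z)))"
    unfolding packet_def phase_def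
    by (intro continuous_on_mult continuous_on_of_real continuous_on_exp continuous_on_compose2[OF continuous_bump[of UNIV]] continuous_intros) auto
  then show "continuous_on ({0<..} \<times> UNIV) (\<lambda>(t, x, y). packet c A B i j t x (y::'a))"
    by (simp add: case_prod_beta')
  fix a b :: real assume a: "0 < a"
  define S where "S = 1 / sqrt A + 1 / sqrt B"
  have S: "S \<ge> 0" using A B by (simp add: S_def)
  have "packet c A B i j t x y = 0" if t: "t \<in> {a..b}" and xy: "norm x > b * S \<or> norm y > b * S" for t and x y :: 'a
  proof (rule ccontr)
    assume "packet c A B i j t x y \<noteq> 0"
    from packet_support[OF A B _ this] t a have "norm x \<le> t * S" "norm y \<le> t * S" unfolding S_def by auto
    moreover have "t * S \<le> b * S" using t S by (intro mult_right_mono) auto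
    ultimately show False using xy by linarith
  qed
  then show "\<exists>R. \<forall>t\<in>{a..b}. \<forall>x y. norm x > R \<or> norm y > R \<longrightarrow> packet c A B i j t x (y::'a) = 0" by blast
qed

lemma kernel_packet_dt:
  assumes A: "A > 0" and B: "B > 0"
  shows "kernel (packet_dt c A B :: real \<Rightarrow> 'a::euclidean_space \<Rightarrow> 'a \<Rightarrow> complex)"
  unfolding packet_dt_def
  by (intro kernel_add kernel_mult kernel_packet A B)
     (auto simp: case_prod_beta' intro!: continuous_intros)

lemma kernel_kernel_lap_packet:
  assumes A: "A > 0" and B: "B > 0"
  shows "kernel (kernel_lap (packet c A B 0 0) :: real \<Rightarrow> 'a::euclidean_space \<Rightarrow> 'a \<Rightarrow> complex)"
  unfolding lap_packet[abs_def]
  by (intro kernel_add kernel_mult kernel_mult_const kernel_packet A B)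
     (auto simp: case_prod_beta' intro!: continuous_intros)

section \<open>Normalisation and concentration of the kernel\<close>

lemma nn_integral_dilation:
  fixes f :: "real \<Rightarrow> ennreal" and x :: "'a::euclidean_space"
  assumes [measurable]: "f \<in> borel_measurable borel" and s: "s > 0"
  shows "(\<integral>\<^sup>+y. f ((1 / s)\<^sup>2 * ((x - y) \<bullet> (x - y))) \<partial>lborel) = ennreal (s ^ DIM('a)) * (\<integral>\<^sup>+z. f (z \<bullet> z) \<partial>(lborel :: 'a measure))"
proof -
  have "(\<integral>\<^sup>+y. f ((1 / s)\<^sup>2 * ((x - y) \<bullet> (x - y))) \<partial>lborel) =
     (\<integral>\<^sup>+y. f ((1 / s)\<^sup>2 * ((x - y) \<bullet> (x - y))) \<partial>(density (distr lborel borel (\<lambda>z. x + s *\<^sub>R z)) (\<lambda>_. ennreal (\<bar>s\<bar> ^ DIM('a)))))"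
    using lborel_affine[of s x] s by simp
  also have "\<dots> = (\<integral>\<^sup>+z. ennreal (\<bar>s\<bar> ^ DIM('a)) * f ((1 / s)\<^sup>2 * ((x - (x + s *\<^sub>R z)) \<bullet> (x - (x + s *\<^sub>R z)))) \<partial>lborel)"
    by (subst nn_integral_density, measurable) (subst nn_integral_distr, measurable)
  also have "\<dots> = (\<integral>\<^sup>+z. ennreal (s ^ DIM('a)) * f (z \<bullet> z) \<partial>(lborel :: 'a measure))"
    using s by (intro nn_integral_cong) (simp add: power2_eq_square)
  also have "\<dots> = ennreal (s ^ DIM('a)) * (\<integral>\<^sup>+z. f (z \<bullet> z) \<partial>(lborel :: 'a measure))"
    by (rule nn_integral_cmult) measurable
  finally show ?thesis .
qed

definition bump_integral :: "'a::euclidean_space itself \<Rightarrow> nat \<Rightarrow> real" where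
  "bump_integral _ j = enn2real (\<integral>\<^sup>+z. ennreal \<bar>bump j (z \<bullet> z)\<bar> \<partial>(lborel :: 'a measure))"

lemma measurable_bump [measurable]: "bump j \<in> borel_measurable borel"
  by (rule borel_measurable_continuous_onI[OF continuous_bump])

lemma bump_integral:
  "(\<integral>\<^sup>+z. ennreal \<bar>bump j (z \<bullet> z)\<bar> \<partial>(lborel :: 'a::euclidean_space measure)) = ennreal (bump_integral TYPE('a) j)"
proof -
  obtain M where M: "\<And>v. v \<ge> 0 \<Longrightarrow> \<bar>bump j v\<bar> \<le> M" using bump_bounded by blast
  have "(\<integral>\<^sup>+z. ennreal \<bar>bump j (z \<bullet> z)\<bar> \<partial>(lborel :: 'a measure)) \<le> (\<integral>\<^sup>+z. ennreal M * indicator (cball 0 1) z \<partial>(lborel :: 'a measure))"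
  proof (rule nn_integral_mono)
    fix z :: 'a
    show "ennreal \<bar>bump j (z \<bullet> z)\<bar> \<le> ennreal M * indicator (cball 0 1) z"
    proof (cases "norm z \<le> 1")
      case True
      then show ?thesis using M[of "z \<bullet> z"] by (simp add: ennreal_leI)
    next
      case False
      then have "1 \<le> z \<bullet> z" by (simp add: dot_square_norm one_le_power)
      then show ?thesis by (simp add: bump_eq_0)
    qed
  qed
  also have "\<dots> = ennreal M * emeasure lborel (cball (0::'a) 1)" by (rule nn_integral_cmult_indicator) simp
  also have "\<dots> < top" using emeasure_lborel_cball_finite[of "0::'a" 1] by (simp add: ennreal_mult_less_top top.not_eq_extremum)
  finally show ?thesis unfolding bump_integral_def by simp
qed

lemma bump_integral_nonneg: "bump_integral T j \<ge> 0"
  by (simp add: bump_integral_def)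

lemma bump_integral_pos: "bump_integral TYPE('a::euclidean_space) 0 > 0"
proof (rule ccontr)
  assume "\<not> bump_integral TYPE('a) 0 > 0"
  then have "bump_integral TYPE('a) 0 = 0" using bump_integral_nonneg[of "TYPE('a)" 0] by linarith
  then have "(\<integral>\<^sup>+z. ennreal \<bar>bump 0 (z \<bullet> z)\<bar> \<partial>(lborel :: 'a measure)) = 0" by (simp add: bump_integral)
  then have "AE z in (lborel :: 'a measure). ennreal \<bar>bump 0 (z \<bullet> z)\<bar> = 0"
    by (subst (asm) nn_integral_0_iff_AE) measurable
  then have "AE z in (lborel :: 'a measure). z \<notin> ball 0 1"
  proof eventually_elim
    case (elim z)
    show ?case
    proof
      assume "z \<in> ball 0 1"
      then have "z \<bullet> z < 1" by (simp add: dot_square_norm abs_square_less_1)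
      then show False using elim bump_pos[of "z \<bullet> z"] by simp
    qed
  qed
  then have "emeasure lborel (ball (0::'a) 1) = 0"
    by (subst (asm) AE_iff_measurable[where N="ball (0::'a) 1"]) auto
  then have "ball (0::'a) 1 \<in> null_sets lborel" by auto
  then have "negligible (ball (0::'a) 1)"
    by (simp add: negligible_iff_null_sets null_sets_completionI)
  then show False using open_not_negligible[of "ball (0::'a) 1"] by simp
qed

text \<open>The power of \<open>Suc n\<close> offsets the narrowing of the mollifier. Dividing by
  \<open>bump 0 0\<close> normalises the cutoff at its centre, so that the whole kernel has mass
  about one near the diagonal.\<close>

definition packet_coeff :: "'a::euclidean_space itself \<Rightarrow> nat \<Rightarrow> real" where
  "packet_coeff T n = real (Suc n) ^ DIM('a) / (bump_integral TYPE('a) 0 * bump 0 0)"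

text \<open>Spatial width \<open>1 / n\<close> of the mollifier and cutoff radius of order \<open>n\<^sup>2\<close>, in the self-similar variable
  \<open>x / t\<close>: the commutator with the free flow has relative size \<open>n / n\<^sup>2\<close>.\<close>

definition wave_kernel :: "nat \<Rightarrow> real \<Rightarrow> 'a::euclidean_space \<Rightarrow> 'a \<Rightarrow> complex" where
  "wave_kernel n = packet (packet_coeff TYPE('a) n) (1 / (4 * real (Suc n) ^ 4)) (real (Suc n) ^ 2) 0 0"

text \<open>The factor \<open>bump 0 0\<close> is shifted here from the cutoff. This mollifier then
  has mass one, and the remaining factor, phase times normalised cutoff, has modulus at most
  one.\<close>

definition wave_mollifier :: "real \<Rightarrow> nat \<Rightarrow> 'a::euclidean_space \<Rightarrow> 'a \<Rightarrow> real" where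
  "wave_mollifier t n x y = packet_coeff TYPE('a) n * bump 0 0 / t ^ DIM('a) * bump 0 (real (Suc n) ^ 2 / t\<^sup>2 * ((x - y) \<bullet> (x - y)))"

definition wave_factor :: "real \<Rightarrow> nat \<Rightarrow> 'a::euclidean_space \<Rightarrow> 'a \<Rightarrow> complex" where
  "wave_factor t n x y = phase t x y * of_real (bump 0 (1 / (4 * real (Suc n) ^ 4) / t\<^sup>2 * ((x + y) \<bullet> (x + y))) / bump 0 0)"

lemma bump_0_0: "bump 0 0 > 0" by (rule bump_pos) simp

lemma packet_coeff_pos: "packet_coeff TYPE('a::euclidean_space) n > 0"
  using bump_integral_pos[where 'a='a] bump_0_0 by (simp add: packet_coeff_def)

lemma wave_kernel_eq: "wave_kernel n t x y = wave_factor t n x y * of_real (wave_mollifier t n x y)"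
  using bump_0_0 by (simp add: wave_kernel_def wave_factor_def wave_mollifier_def packet_def)

text \<open>The width t/(n+1) cancels against the normalisation, so the value depends neither on
  \<open>n\<close> nor on \<open>t\<close>. The case j = 0 normalises the mollifier, the case j = 1
  measures the remainder kernel.\<close>

lemma nn_integral_packet_bump:
  fixes x :: "'a::euclidean_space"
  assumes t: "t > 0"
  shows "(\<integral>\<^sup>+y. ennreal (packet_coeff TYPE('a) n / t ^ DIM('a) * \<bar>bump j (real (Suc n) ^ 2 / t\<^sup>2 * ((x - y) \<bullet> (x - y)))\<bar>) \<partial>lborel)
    = ennreal (bump_integral TYPE('a) j / (bump_integral TYPE('a) 0 * bump 0 0))"
proof -
  define s where "s = t / real (Suc n)"
  have s: "s > 0" using t by (simp add: s_def)
  have e: "real (Suc n) ^ 2 / t\<^sup>2 = (1 / s)\<^sup>2" using t by (simp add: s_def power_divide)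
  have c: "packet_coeff TYPE('a) n / t ^ DIM('a) \<ge> 0" using packet_coeff_pos[of n, where 'a='a] t by simp
  have "(\<integral>\<^sup>+y. ennreal (packet_coeff TYPE('a) n / t ^ DIM('a) * \<bar>bump j (real (Suc n) ^ 2 / t\<^sup>2 * ((x - y) \<bullet> (x - y)))\<bar>) \<partial>lborel)
    = (\<integral>\<^sup>+y. ennreal (packet_coeff TYPE('a) n / t ^ DIM('a)) * ennreal \<bar>bump j ((1 / s)\<^sup>2 * ((x - y) \<bullet> (x - y)))\<bar> \<partial>lborel)"
    unfolding e by (intro nn_integral_cong ennreal_mult' c)
  also have "\<dots> = ennreal (packet_coeff TYPE('a) n / t ^ DIM('a)) * (\<integral>\<^sup>+y. ennreal \<bar>bump j ((1 / s)\<^sup>2 * ((x - y) \<bullet> (x - y)))\<bar> \<partial>lborel)"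
    by (rule nn_integral_cmult) measurable
  also have "(\<integral>\<^sup>+y. ennreal \<bar>bump j ((1 / s)\<^sup>2 * ((x - y) \<bullet> (x - y)))\<bar> \<partial>lborel) = ennreal (s ^ DIM('a)) * ennreal (bump_integral TYPE('a) j)"
    unfolding bump_integral[symmetric] by (rule nn_integral_dilation[OF _ s]) measurable
  also have "ennreal (packet_coeff TYPE('a) n / t ^ DIM('a)) * (ennreal (s ^ DIM('a)) * ennreal (bump_integral TYPE('a) j))
     = ennreal (packet_coeff TYPE('a) n / t ^ DIM('a) * (s ^ DIM('a) * bump_integral TYPE('a) j))"
    by (simp only: ennreal_mult'[OF c] ennreal_mult'[OF zero_le_power[OF less_imp_le[OF s]]])
  also have "packet_coeff TYPE('a) n / t ^ DIM('a) * (s ^ DIM('a) * bump_integral TYPE('a) j) = bump_integral TYPE('a) j / (bump_integral TYPE('a) 0 * bump 0 0)"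
    unfolding packet_coeff_def s_def using t by (simp add: power_divide)
  finally show ?thesis .
qed

lemma wave_mollifier_nonneg: "t > 0 \<Longrightarrow> wave_mollifier t n (x::'a::euclidean_space) y \<ge> 0"
  unfolding wave_mollifier_def using packet_coeff_pos[of n, where 'a='a] bump_0_0 bump_nonneg by simp

lemma wave_mollifier_commute: "wave_mollifier t n x y = wave_mollifier t n y x"
  by (simp add: wave_mollifier_def inner_diff inner_commute algebra_simps)

lemma mollifier_wave_mollifier:
  assumes t: "t > 0"
  shows "mollifier (wave_mollifier t :: nat \<Rightarrow> 'a::euclidean_space \<Rightarrow> 'a \<Rightarrow> real)"
proof
  fix n and x y :: 'a
  show "(\<lambda>z::'a \<times> 'a. wave_mollifier t n (fst z) (snd z)) \<in> borel_measurable (borel \<Otimes>\<^sub>M borel)"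
    unfolding wave_mollifier_def by measurable
  show "wave_mollifier t n x y \<ge> 0" by (rule wave_mollifier_nonneg[OF t])
  show 1: "(\<integral>\<^sup>+y. ennreal (wave_mollifier t n x y) \<partial>lborel) = 1" for x :: 'a
  proof -
    have "(\<integral>\<^sup>+y. ennreal (wave_mollifier t n x y) \<partial>lborel) = (\<integral>\<^sup>+y. ennreal (bump 0 0) * ennreal (packet_coeff TYPE('a) n / t ^ DIM('a) * \<bar>bump 0 (real (Suc n) ^ 2 / t\<^sup>2 * ((x - y) \<bullet> (x - y)))\<bar>) \<partial>lborel)"
      unfolding wave_mollifier_def using bump_0_0 bump_nonneg
      by (intro nn_integral_cong) (simp add: ennreal_mult'[symmetric] mult_ac)
    also have "\<dots> = ennreal (bump 0 0) * ennreal (bump_integral TYPE('a) 0 / (bump_integral TYPE('a) 0 * bump 0 0))"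
      unfolding nn_integral_packet_bump[OF t, where n=n and j=0 and x=x, symmetric] by (rule nn_integral_cmult) measurable
    also have "\<dots> = 1" using bump_0_0 bump_integral_pos[where 'a='a] by (simp add: ennreal_mult'[symmetric])
    finally show ?thesis .
  qed
  show "(\<integral>\<^sup>+x. ennreal (wave_mollifier t n x y) \<partial>lborel) = 1"
    using 1[of y] by (simp only: wave_mollifier_commute[of t n _ y])
next
  fix e :: real assume e: "e > 0"
  obtain n0 where n0: "t / e < real n0" using reals_Archimedean2 by blast
  show "\<forall>\<^sub>F n in sequentially. \<forall>x y::'a. norm (x - y) > e \<longrightarrow> wave_mollifier t n x y = 0"
    using eventually_ge_at_top[of n0]
  proof eventually_elim
    case (elim n)
    show ?case
    proof (intro allI impI)
      fix x y :: 'a assume xy: "norm (x - y) > e"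
      have "t < e * real n0" using n0 e by (simp add: field_simps)
      also have "\<dots> \<le> norm (x - y) * real (Suc n)" using xy elim e by (intro mult_mono) auto
      finally have "1 \<le> real (Suc n) / t * norm (x - y)" using t by (simp add: field_simps)
      then have "1 \<le> (real (Suc n) / t * norm (x - y)) ^ 2" by (rule one_le_power)
      then have "1 \<le> real (Suc n) ^ 2 / t\<^sup>2 * ((x - y) \<bullet> (x - y))"
        by (simp only: power_mult_distrib power_divide dot_square_norm)
      then show "wave_mollifier t n x y = 0" by (simp add: wave_mollifier_def bump_eq_0)
    qed
  qed
qed

lemma wave_factor_le: "norm (wave_factor t n x y) \<le> 1"
proof -
  have 1: "norm (phase t x y) = 1" by (simp add: phase_def norm_exp_eq_Re)
  have "0 \<le> 1 / (4 * real (Suc n) ^ 4) / t\<^sup>2 * ((x + y) \<bullet> (x + y))" by simp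
  from bump_mono[OF this] show ?thesis
    unfolding wave_factor_def norm_mult 1 norm_of_real using bump_0_0 bump_nonneg by simp
qed

lemma continuous_wave_factor:
  fixes x :: "'b::topological_space \<Rightarrow> 'a::euclidean_space"
  assumes [continuous_intros]: "continuous_on UNIV x" "continuous_on UNIV y" "continuous_on UNIV a"
  shows "continuous_on UNIV (\<lambda>z. phase t (x z) (y z) * of_real (bump 0 (a z / t\<^sup>2 * ((x z + y z) \<bullet> (x z + y z))) / bump 0 0))"
proof -
  have 1: "continuous_on UNIV (\<lambda>z. phase t (x z) (y z))"
    unfolding phase_def by (intro continuous_intros)
  have "continuous_on UNIV (\<lambda>z. a z * (1 / t\<^sup>2) * ((x z + y z) \<bullet> (x z + y z)))"
    by (intro continuous_intros)
  then have "continuous_on UNIV (\<lambda>z. a z / t\<^sup>2 * ((x z + y z) \<bullet> (x z + y z)))" by simp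
  from continuous_on_compose2[OF continuous_bump[of UNIV 0] this]
  have "continuous_on UNIV (\<lambda>z. bump 0 (a z / t\<^sup>2 * ((x z + y z) \<bullet> (x z + y z))) * (1 / bump 0 0))"
    by (intro continuous_on_mult continuous_on_const) auto
  from continuous_on_mult[OF 1 continuous_on_of_real[OF this]] show ?thesis by simp
qed

lemma measurable_wave_factor: "(\<lambda>z. wave_factor t n (fst z) (snd z)) \<in> borel_measurable (borel \<Otimes>\<^sub>M borel)"
  unfolding wave_factor_def borel_prod
  by (intro borel_measurable_continuous_onI continuous_wave_factor continuous_on_fst continuous_on_snd continuous_on_id continuous_on_const)

lemma wave_factor_tendsto_1:
  fixes x :: "'a::euclidean_space"
  assumes t: "t > 0" and e: "e > 0"
  shows "\<forall>\<^sub>F n in sequentially. \<forall>y. wave_mollifier t n x y \<noteq> 0 \<longrightarrow> norm (wave_factor t n x y - 1) \<le> e"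
proof -
  \<comment> \<open>The cutoff coefficient becomes a second variable: letting \<open>n\<close> grow
    sends it to 0 while y tends to x, so joint continuity at (x, 0) covers both limits.\<close>
  define \<Phi> where "\<Phi> z = phase t x (fst z) * of_real (bump 0 (snd z / t\<^sup>2 * ((x + fst z) \<bullet> (x + fst z))) / bump 0 0)" for z :: "'a \<times> real"
  have "continuous_on UNIV \<Phi>"
    unfolding \<Phi>_def
    by (intro continuous_wave_factor continuous_on_fst continuous_on_snd continuous_on_id continuous_on_const)
  moreover have "\<Phi> (x, 0) = 1" using bump_0_0 by (simp add: \<Phi>_def phase_def)
  ultimately obtain d where d: "d > 0" "\<And>z. dist z (x, 0) < d \<Longrightarrow> dist (\<Phi> z) 1 < e"
    unfolding continuous_on_iff using e by (metis UNIV_I)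
  have "\<forall>\<^sub>F n in sequentially. inverse (real (Suc n)) < d / 2"
    using d(1) by (intro order_tendstoD(2)[OF LIMSEQ_inverse_real_of_nat]) auto
  then have ev1: "\<forall>\<^sub>F n in sequentially. 1 / (4 * real (Suc n) ^ 4) < d / 2"
  proof (rule eventually_mono)
    fix n assume n: "inverse (real (Suc n)) < d / 2"
    have "real (Suc n) ^ 1 \<le> real (Suc n) ^ 4" by (rule power_increasing) auto
    then have "1 / (4 * real (Suc n) ^ 4) \<le> 1 / real (Suc n)" by (intro divide_left_mono) auto
    with n show "1 / (4 * real (Suc n) ^ 4) < d / 2" by (simp add: inverse_eq_divide)
  qed
  have "\<forall>\<^sub>F n in sequentially. \<forall>x y::'a. norm (x - y) > d / 2 \<longrightarrow> wave_mollifier t n x y = 0"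
    using mollifier.H_support[OF mollifier_wave_mollifier[OF t], of "d/2"] d(1) by simp
  with ev1 show ?thesis
  proof eventually_elim
    case (elim n)
    show ?case
    proof (intro allI impI)
      fix y assume "wave_mollifier t n x y \<noteq> 0"
      then have "norm (x - y) \<le> d / 2" using elim(2) by (meson not_le)
      moreover have "dist (y, 1 / (4 * real (Suc n) ^ 4)) (x, 0) \<le> dist y x + dist (1 / (4 * real (Suc n) ^ 4)) 0"
        unfolding dist_Pair_Pair by (rule sqrt_sum_squares_le_sum) auto
      ultimately have "dist (y, 1 / (4 * real (Suc n) ^ 4)) (x, 0) < d"
        using elim(1) by (simp add: dist_norm norm_minus_commute)
      from d(2)[OF this] show "norm (wave_factor t n x y - 1) \<le> e"
        by (simp add: \<Phi>_def wave_factor_def dist_norm)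
    qed
  qed
qed

lemma nn_integral_norm_wave_kernel_le:
  fixes x y :: "'a::euclidean_space"
  assumes t: "t > 0"
  shows "(\<integral>\<^sup>+y. ennreal (norm (wave_kernel n t x y)) \<partial>lborel) \<le> ennreal 1"
    "(\<integral>\<^sup>+x. ennreal (norm (wave_kernel n t x y)) \<partial>lborel) \<le> ennreal 1"
proof -
  have le: "ennreal (norm (wave_kernel n t x y)) \<le> ennreal (wave_mollifier t n x y)" for x y :: 'a
  proof -
    have "norm (wave_factor t n x y) * \<bar>wave_mollifier t n x y\<bar> \<le> 1 * \<bar>wave_mollifier t n x y\<bar>"
      by (intro mult_right_mono wave_factor_le) auto
    then show ?thesis using wave_mollifier_nonneg[OF t, of n x y] by (simp add: wave_kernel_eq norm_mult ennreal_leI)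
  qed
  interpret mollifier "wave_mollifier t :: nat \<Rightarrow> 'a \<Rightarrow> 'a \<Rightarrow> real" by (rule mollifier_wave_mollifier[OF t])
  show "(\<integral>\<^sup>+y. ennreal (norm (wave_kernel n t x y)) \<partial>lborel) \<le> ennreal 1"
    using nn_integral_mono[OF le, of lborel "\<lambda>_. x" "\<lambda>y. y"] H_fst[of n x] by simp
  show "(\<integral>\<^sup>+x. ennreal (norm (wave_kernel n t x y)) \<partial>lborel) \<le> ennreal 1"
    using nn_integral_mono[OF le, of lborel "\<lambda>x. x" "\<lambda>_. y"] H_snd[of n y] by simp
qed

section \<open>Mass in a cone\<close>

lemma kernel_wave_kernel: "kernel (wave_kernel n :: real \<Rightarrow> 'a::euclidean_space \<Rightarrow> 'a \<Rightarrow> complex)"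
  unfolding wave_kernel_def by (rule kernel_packet) auto

definition wave_remainder :: "nat \<Rightarrow> real \<Rightarrow> 'a::euclidean_space \<Rightarrow> 'a \<Rightarrow> complex" where
  "wave_remainder n t x y = \<i> * of_real (16 * (1 / (4 * real (Suc n) ^ 4)) * real (Suc n) ^ 2 / t ^ 4 * ((x + y) \<bullet> (x - y)))
     * packet (packet_coeff TYPE('a) n) (1 / (4 * real (Suc n) ^ 4)) (real (Suc n) ^ 2) 1 1 t x y"

lemma kernel_wave_remainder: "kernel (wave_remainder n :: real \<Rightarrow> 'a::euclidean_space \<Rightarrow> 'a \<Rightarrow> complex)"
proof -
  have "kernel (\<lambda>t x y::'a. \<i> * of_real (w / t ^ 4 * ((x + y) \<bullet> (x - y))) * packet c A B 1 1 t x y)" if "A > 0" "B > 0" for w c A B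
    using that by (intro kernel_mult kernel_packet) (auto simp: case_prod_beta' intro!: continuous_intros)
  note this[of "1 / (4 * real (Suc n) ^ 4)" "real (Suc n) ^ 2" "16 * (1 / (4 * real (Suc n) ^ 4)) * real (Suc n) ^ 2" "packet_coeff TYPE('a) n"]
  then show ?thesis unfolding wave_remainder_def[abs_def] by (simp only: zero_less_power of_nat_0_less_iff zero_less_Suc zero_less_divide_1_iff zero_less_mult_iff zero_less_numeral simp_thms)
qed

lemma nn_integral_wave_remainder_le:
  obtains D where "D \<ge> 0"
    "\<And>n t x. t > 0 \<Longrightarrow> (\<integral>\<^sup>+y. ennreal (norm (wave_remainder n t x (y::'a::euclidean_space))) \<partial>lborel) \<le> ennreal (D / (real (Suc n) * t\<^sup>2))"
    "\<And>n t y. t > 0 \<Longrightarrow> (\<integral>\<^sup>+x. ennreal (norm (wave_remainder n t (x::'a) y)) \<partial>lborel) \<le> ennreal (D / (real (Suc n) * t\<^sup>2))"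
proof -
  obtain M where M: "\<And>v. v \<ge> 0 \<Longrightarrow> \<bar>bump 1 v\<bar> \<le> M" using bump_bounded by blast
  have M0: "M \<ge> 0" using M[of 0] by simp
  define Z where "Z = bump_integral TYPE('a) 1 / (bump_integral TYPE('a) 0 * bump 0 0)"
  have Z: "Z \<ge> 0" unfolding Z_def using bump_integral_nonneg[of "TYPE('a)" 1] bump_integral_pos[where 'a='a] bump_0_0
    by (intro divide_nonneg_nonneg mult_nonneg_nonneg) auto
  let ?f = "\<lambda>n t x y::'a. packet_coeff TYPE('a) n / t ^ DIM('a) * \<bar>bump 1 (real (Suc n) ^ 2 / t\<^sup>2 * ((x - y) \<bullet> (x - y)))\<bar>"
  have le: "ennreal (norm (wave_remainder n t x y)) \<le> ennreal (8 * M / (real (Suc n) * t\<^sup>2)) * ennreal (?f n t x y)" if t: "t > 0" for n t and x y :: 'a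
  proof -
    \<comment> \<open>Here sqrt(AB) = 1/(2q) with q = n+1: mollifier frequency q against cutoff
      radius 2 q^2. This is the entire gain in \<open>n\<close>.\<close>
    have "1 / (4 * q ^ 4) * q ^ 2 = (1 / (2 * q))\<^sup>2" if "q > 0" for q :: real
      using that by (simp add: power2_eq_square power4_eq_xxxx)
    from this[of "real (Suc n)"] have "1 / (4 * real (Suc n) ^ 4) * real (Suc n) ^ 2 = (1 / (2 * real (Suc n)))\<^sup>2"
      by (simp only: of_nat_0_less_iff zero_less_Suc simp_thms)
    then have s: "sqrt (1 / (4 * real (Suc n) ^ 4) * real (Suc n) ^ 2) = 1 / (2 * real (Suc n))"
      by (simp only: real_sqrt_abs) simp
    have "norm (wave_remainder n t x y) \<le> 16 * (1 / (2 * real (Suc n))) / t\<^sup>2 * M * ?f n t x y"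
      unfolding wave_remainder_def s[symmetric]
      by (intro norm_packet_remainder_le that M less_imp_le[OF packet_coeff_pos]) auto
    also have "16 * (1 / (2 * real (Suc n))) / t\<^sup>2 * M = 8 * M / (real (Suc n) * t\<^sup>2)" by (simp del: of_nat_Suc)
    finally have "ennreal (norm (wave_remainder n t x y)) \<le> ennreal (8 * M / (real (Suc n) * t\<^sup>2) * ?f n t x y)"
      by (rule ennreal_leI)
    also have "\<dots> = ennreal (8 * M / (real (Suc n) * t\<^sup>2)) * ennreal (?f n t x y)"
      using M0 by (intro ennreal_mult') simp
    finally show ?thesis .
  qed
  have "8 * M * Z \<ge> 0" using M0 Z by simp
  moreover have *: "(\<integral>\<^sup>+y. ennreal (8 * M / (real (Suc n) * t\<^sup>2)) * ennreal (?f n t x y) \<partial>lborel) = ennreal (8 * M * Z / (real (Suc n) * t\<^sup>2))"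
    if t: "t > 0" for n t and x :: 'a
  proof -
    have "(\<integral>\<^sup>+y. ennreal (8 * M / (real (Suc n) * t\<^sup>2)) * ennreal (?f n t x y) \<partial>lborel) = ennreal (8 * M / (real (Suc n) * t\<^sup>2)) * ennreal Z"
      unfolding Z_def nn_integral_packet_bump[OF t, where n=n and j=1 and x=x, symmetric] by (rule nn_integral_cmult) measurable
    also have "\<dots> = ennreal (8 * M / (real (Suc n) * t\<^sup>2) * Z)"
      using M0 by (intro ennreal_mult'[symmetric]) simp
    finally show ?thesis by simp
  qed
  moreover have "(\<integral>\<^sup>+y. ennreal (norm (wave_remainder n t x y)) \<partial>lborel) \<le> ennreal (8 * M * Z / (real (Suc n) * t\<^sup>2))" if t: "t > 0" for n t and x :: 'a
    unfolding *[OF t, where x=x, symmetric] by (intro nn_integral_mono le t)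
  moreover have "(\<integral>\<^sup>+x. ennreal (norm (wave_remainder n t x y)) \<partial>lborel) \<le> ennreal (8 * M * Z / (real (Suc n) * t\<^sup>2))" if t: "t > 0" for n t and y :: 'a
  proof -
    have c: "?f n t x y = ?f n t y x" for x
      by (metis (no_types) inner_minus_left inner_minus_right minus_diff_eq minus_minus)
    have "(\<integral>\<^sup>+x. ennreal (norm (wave_remainder n t x y)) \<partial>lborel) \<le> (\<integral>\<^sup>+x. ennreal (8 * M / (real (Suc n) * t\<^sup>2)) * ennreal (?f n t y x) \<partial>lborel)"
      unfolding c[symmetric] by (intro nn_integral_mono le t)
    also have "\<dots> = ennreal (8 * M * Z / (real (Suc n) * t\<^sup>2))" by (rule *[OF t])
    finally show ?thesis .
  qed
  ultimately show ?thesis using that by blast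
qed

section \<open>Evolution of the localised mass\<close>

context decaying_nls begin

definition wave_energy :: "nat \<Rightarrow> real \<Rightarrow> complex" where
  "wave_energy n t = pair (\<lambda>z. z) cnj t t (wave_kernel n t)"

definition wave_flux :: "nat \<Rightarrow> real \<Rightarrow> complex" where
  "wave_flux n t = pair (nonlinearity \<alpha>) cnj t t (wave_kernel n t)"

definition wave_error :: "nat \<Rightarrow> real \<Rightarrow> complex" where
  "wave_error n t = pair (\<lambda>z. z) cnj t t (wave_remainder n t)"

lemma wave_energy_has_derivative:
  assumes t: "t > 0"
  shows "(wave_energy n has_vector_derivative wave_error n t - of_real (2 * lam * Im (wave_flux n t))) (at t)"
proof -
  let ?c = "packet_coeff TYPE('a) n" and ?A = "1 / (4 * real (Suc n) ^ 4)" and ?B = "real (Suc n) ^ 2"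
  have "((\<lambda>t. pair (\<lambda>z. z) cnj t t (packet ?c ?A ?B 0 0 t)) has_vector_derivative
     pair (\<lambda>z. z) cnj t t (\<lambda>x y. packet_dt ?c ?A ?B t x y + \<i> * (kernel_lap (packet ?c ?A ?B 0 0) t x y - cnj (kernel_lap (packet ?c ?A ?B 0 0) t y x)))
     + 2 * Re (\<i> * lam * pair (nonlinearity \<alpha>) cnj t t (packet ?c ?A ?B 0 0 t))) (at t)"
    by (rule pair_diagonal_has_derivative[OF kernel_packet kernel_kernel_lap_packet kernel_packet_dt smooth_packet packet_has_time_derivative packet_hermitian t]) auto
  moreover have "complex_of_real (2 * Re (\<i> * of_real lam * z)) = - of_real (2 * lam * Im z)" for z by simp
  ultimately show ?thesis
    unfolding packet_remainder[OF t] wave_energy_def[abs_def] wave_error_def wave_flux_def wave_remainder_def[abs_def] wave_kernel_def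
    by (simp only: add_uminus_conv_diff)
qed

lemma norm_mult_le_add_squares: "norm a * norm (b::complex) \<le> norm (a::complex) ^ 2 + norm b ^ 2"
proof -
  have "0 \<le> (norm a - norm b)\<^sup>2" by simp
  then have "2 * (norm a * norm b) \<le> norm a ^ 2 + norm b ^ 2" by (simp add: power2_eq_square algebra_simps)
  then show ?thesis using mult_nonneg_nonneg[OF norm_ge_zero[of a] norm_ge_zero[of b]] by linarith
qed

lemma norm_nonlinearity_mult_le: "norm (nonlinearity \<alpha> a) * norm (b::complex) \<le> norm a powr (\<alpha> + 2) + norm b powr (\<alpha> + 2)"
proof (cases "norm b \<le> norm a")
  case True
  then have "norm (nonlinearity \<alpha> a) * norm b \<le> norm (nonlinearity \<alpha> a) * norm a" by (intro mult_left_mono) auto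
  also have "\<dots> \<le> norm a powr (\<alpha> + 2) + norm b powr (\<alpha> + 2)" by (simp add: norm_nonlinearity_mult)
  finally show ?thesis .
next
  case False
  then have "norm (nonlinearity \<alpha> a) \<le> norm (nonlinearity \<alpha> b)"
    unfolding nonlinearity_def norm_mult using alpha_pos by (intro mult_mono) (auto intro: powr_mono2)
  then have "norm (nonlinearity \<alpha> a) * norm b \<le> norm (nonlinearity \<alpha> b) * norm b" by (intro mult_right_mono) auto
  also have "\<dots> \<le> norm a powr (\<alpha> + 2) + norm b powr (\<alpha> + 2)" by (simp add: norm_nonlinearity_mult)
  finally show ?thesis .
qed

lemma nn_integral_L2_le: "t > 0 \<Longrightarrow> (\<integral>\<^sup>+x. ennreal (norm (u t x) ^ 2) \<partial>lborel) \<le> ennreal M"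
  by (subst nn_integral_eq_integral) (auto intro!: integrable_L2 L2_bound ennreal_leI)

lemma M_nonneg: "M \<ge> 0"
proof -
  have "0 \<le> (LINT x|lborel. norm (u 1 x) ^ 2)" by simp
  also have "\<dots> \<le> M" by (rule L2_bound) simp
  finally show ?thesis .
qed

lemma wave_error_bound:
  obtains D where "D \<ge> 0" "\<And>n t. t > 0 \<Longrightarrow> norm (wave_error n t) \<le> D / (real (Suc n) * t\<^sup>2)"
proof -
  obtain D where D: "D \<ge> 0"
    "\<And>n t x. t > 0 \<Longrightarrow> (\<integral>\<^sup>+y. ennreal (norm (wave_remainder n t x (y::'a))) \<partial>lborel) \<le> ennreal (D / (real (Suc n) * t\<^sup>2))"
    "\<And>n t y. t > 0 \<Longrightarrow> (\<integral>\<^sup>+x. ennreal (norm (wave_remainder n t (x::'a) y)) \<partial>lborel) \<le> ennreal (D / (real (Suc n) * t\<^sup>2))"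
    by (rule nn_integral_wave_remainder_le[where 'a='a]) blast
  have "norm (wave_error n t) \<le> 2 * (D / (real (Suc n) * t\<^sup>2)) * M" if t: "t > 0" for n t
    unfolding wave_error_def pair_eq_product[OF admissible_id admissible_cnj kernel_wave_remainder t t t]
  proof (rule schur_bound[where q="\<lambda>x. norm (u t x) ^ 2"])
    show "(\<lambda>z::'a \<times> 'a. wave_remainder n t (fst z) (snd z)) \<in> borel_measurable (borel \<Otimes>\<^sub>M borel)"
      by (rule kernel_measurable[OF kernel_wave_remainder t])
    show "norm (u t x) * norm (cnj (u t y)) \<le> norm (u t x) ^ 2 + norm (u t y) ^ 2" for x y
      using norm_mult_le_add_squares by simp
  qed (use D t nn_integral_L2_le M_nonneg in auto)
  then show ?thesis using that[of "2 * D * M"] D M_nonneg by simp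
qed

text \<open>The kernel has sections of L^1 norm at most one for every \<open>n\<close>, so the bound
  is uniform in \<open>n\<close>: it becomes the majorant in time.\<close>

lemma wave_flux_bound:
  assumes t: "t > 0" shows "norm (wave_flux n t) \<le> 2 * C * t powr - \<kappa>"
proof -
  have "norm (wave_flux n t) \<le> 2 * 1 * (C * t powr - \<kappa>)"
    unfolding wave_flux_def pair_eq_product[OF admissible_nonlinearity admissible_cnj kernel_wave_kernel t t t]
  proof (rule schur_bound[where q="\<lambda>x. norm (u t x) powr (\<alpha> + 2)"])
    show "(\<lambda>z::'a \<times> 'a. wave_kernel n t (fst z) (snd z)) \<in> borel_measurable (borel \<Otimes>\<^sub>M borel)"
      by (rule kernel_measurable[OF kernel_wave_kernel t])
    show "norm (nonlinearity \<alpha> (u t x)) * norm (cnj (u t y)) \<le> norm (u t x) powr (\<alpha> + 2) + norm (u t y) powr (\<alpha> + 2)" for x y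
      using norm_nonlinearity_mult_le by simp
    show "(\<integral>\<^sup>+x. ennreal (norm (u t x) powr (\<alpha> + 2)) \<partial>lborel) \<le> ennreal (C * t powr - \<kappa>)"
      using t by (subst nn_integral_eq_integral) (auto intro!: integrable_Lp Lp_bound ennreal_leI)
  qed (use nn_integral_norm_wave_kernel_le[OF t] C_nonneg in auto)
  then show ?thesis by simp
qed

lemma wave_energy_tendsto:
  assumes t: "t > 0" shows "(\<lambda>n. wave_energy n t) \<longlonglongrightarrow> of_real (LINT x|lborel. norm (u t x) ^ 2)"
proof -
  interpret mollifier "wave_mollifier t :: nat \<Rightarrow> 'a \<Rightarrow> 'a \<Rightarrow> real" by (rule mollifier_wave_mollifier[OF t])
  have p2: "norm z powr 2 = norm z ^ 2" for z :: complex by (simp add: powr_numeral)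
  have "(\<lambda>n. LINT z|(lborel \<Otimes>\<^sub>M lborel). u t (fst z) * cnj (u t (snd z)) * (wave_factor t n (fst z) (snd z) * of_real (wave_mollifier t n (fst z) (snd z))))
     \<longlonglongrightarrow> (LINT x|lborel. u t x * cnj (u t x))"
    by (rule approximate_identity[where p=2])
       (use integrable_L2[OF t] measurable_wave_factor wave_factor_le wave_factor_tendsto_1[OF t] in \<open>auto simp: p2\<close>)
  moreover have "(LINT x|lborel. u t x * cnj (u t x)) = of_real (LINT x|lborel. norm (u t x) ^ 2)"
    unfolding complex_norm_square[symmetric] by (rule integral_complex_of_real)
  ultimately show ?thesis
    unfolding wave_energy_def pair_eq_product[OF admissible_id admissible_cnj kernel_wave_kernel t t t] wave_kernel_eq by simp
qed

lemma Im_wave_flux_tendsto: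
  assumes t: "t > 0" shows "(\<lambda>n. Im (wave_flux n t)) \<longlonglongrightarrow> 0"
proof -
  interpret mollifier "wave_mollifier t :: nat \<Rightarrow> 'a \<Rightarrow> 'a \<Rightarrow> real" by (rule mollifier_wave_mollifier[OF t])
  have n: "norm (nonlinearity \<alpha> z) = norm z powr (\<alpha> + 2 - 1)" for z
  proof (cases "z = 0")
    case False
    have "norm (nonlinearity \<alpha> z) = norm z powr \<alpha> * norm z powr 1" by (simp add: nonlinearity_def norm_mult)
    also have "\<dots> = norm z powr (\<alpha> + 2 - 1)" by (simp only: powr_add[symmetric]) (simp add: add.commute)
    finally show ?thesis .
  qed (simp add: nonlinearity_def)
  have [measurable]: "nonlinearity \<alpha> \<in> borel_measurable borel"
    by (rule admissible_measurable[OF admissible_nonlinearity])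
  have "(\<lambda>n. LINT z|(lborel \<Otimes>\<^sub>M lborel). nonlinearity \<alpha> (u t (fst z)) * cnj (u t (snd z)) * (wave_factor t n (fst z) (snd z) * of_real (wave_mollifier t n (fst z) (snd z))))
     \<longlonglongrightarrow> (LINT x|lborel. nonlinearity \<alpha> (u t x) * cnj (u t x))"
  proof (rule approximate_identity[where p="\<alpha> + 2"])
    show "norm (nonlinearity \<alpha> (u t x)) \<le> norm (u t x) powr (\<alpha> + 2 - 1)" for x by (simp only: n order.refl)
  qed (use alpha_pos integrable_Lp[OF t] measurable_wave_factor wave_factor_le wave_factor_tendsto_1[OF t] in auto)
  moreover have "(LINT x|lborel. nonlinearity \<alpha> (u t x) * cnj (u t x)) = of_real (LINT x|lborel. norm (u t x) powr \<alpha> * norm (u t x) ^ 2)"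
    unfolding nonlinearity_def mult.assoc complex_norm_square[symmetric] of_real_mult[symmetric] by (rule integral_complex_of_real)
  ultimately have "(\<lambda>n. wave_flux n t) \<longlonglongrightarrow> of_real (LINT x|lborel. norm (u t x) powr \<alpha> * norm (u t x) ^ 2)"
    unfolding wave_flux_def pair_eq_product[OF admissible_nonlinearity admissible_cnj kernel_wave_kernel t t t] wave_kernel_eq by simp
  from tendsto_Im[OF this] show ?thesis by simp
qed

lemma continuous_wave_flux: "continuous_on {0<..} (wave_flux n)"
  unfolding continuous_on_sequentially o_def wave_flux_def
  by (intro allI ballI impI) (auto intro!: pair_tendsto admissible_nonlinearity admissible_cnj kernel_wave_kernel)

text \<open>The kernel is supported in a product of two balls, so both copies of \<open>u\<close>
  may be cut off to the ball before the Schur bound is applied. The opening \<rho> grows with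
  \<open>n\<close>.\<close>

lemma wave_energy_cone_bound:
  obtains \<rho> where "\<rho> > 0" "\<And>t. t > 0 \<Longrightarrow> norm (wave_energy n t) \<le> 2 * (LINT x|lborel. indicator (cball 0 (\<rho> * t)) x * norm (u t x) ^ 2)"
proof -
  let ?A = "1 / (4 * real (Suc n) ^ 4)" and ?B = "real (Suc n) ^ 2"
  define \<rho> where "\<rho> = 1 / sqrt ?A + 1 / sqrt ?B"
  have AB: "?A > 0" "?B > 0" by auto
  have \<rho>: "\<rho> > 0" unfolding \<rho>_def by (intro add_pos_pos divide_pos_pos) auto
  have "norm (wave_energy n t) \<le> 2 * 1 * (LINT x|lborel. indicator (cball 0 (\<rho> * t)) x * norm (u t x) ^ 2)" if t: "t > 0" for t
  proof -
    let ?I = "\<lambda>x::'a. indicator (cball 0 (\<rho> * t)) x :: complex"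
    have supp: "x \<in> cball 0 (\<rho> * t) \<and> y \<in> cball 0 (\<rho> * t)" if "wave_kernel n t x y \<noteq> 0" for x y :: 'a
      using packet_support[OF AB t that[unfolded wave_kernel_def]] by (simp add: \<rho>_def mult.commute)
    have i: "integrable lborel (\<lambda>x. indicator (cball 0 (\<rho> * t)) x * norm (u t x) ^ 2)"
    proof (rule Bochner_Integration.integrable_bound[OF integrable_L2[OF t]])
      show "(\<lambda>x. indicator (cball 0 (\<rho> * t)) x * norm (u t x) ^ 2) \<in> borel_measurable lborel"
        by (intro borel_measurable_times borel_measurable_indicator) auto
    qed (auto simp: indicator_def)
    have "wave_energy n t = (LINT z|(lborel \<Otimes>\<^sub>M lborel). (?I (fst z) * u t (fst z)) * (?I (snd z) * cnj (u t (snd z))) * wave_kernel n t (fst z) (snd z))"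
      unfolding wave_energy_def pair_eq_product[OF admissible_id admissible_cnj kernel_wave_kernel t t t]
    proof (intro Bochner_Integration.integral_cong refl)
      fix z :: "'a \<times> 'a"
      show "u t (fst z) * cnj (u t (snd z)) * wave_kernel n t (fst z) (snd z) =
         (?I (fst z) * u t (fst z)) * (?I (snd z) * cnj (u t (snd z))) * wave_kernel n t (fst z) (snd z)"
        using supp[of "fst z" "snd z"] by (cases "wave_kernel n t (fst z) (snd z) = 0") auto
    qed
    also have "norm \<dots> \<le> 2 * 1 * (LINT x|lborel. indicator (cball 0 (\<rho> * t)) x * norm (u t x) ^ 2)"
    proof (rule schur_bound[where q="\<lambda>x. indicator (cball 0 (\<rho> * t)) x * norm (u t x) ^ 2"])
      show "(\<lambda>z::'a \<times> 'a. wave_kernel n t (fst z) (snd z)) \<in> borel_measurable (borel \<Otimes>\<^sub>M borel)"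
        by (rule kernel_measurable[OF kernel_wave_kernel t])
      show "(\<lambda>x. indicator (cball 0 (\<rho> * t)) x * norm (u t x) ^ 2) \<in> borel_measurable borel"
        by (intro borel_measurable_times borel_measurable_indicator) auto
      show "norm (?I x * u t x) * norm (?I y * cnj (u t y)) \<le> indicator (cball 0 (\<rho> * t)) x * norm (u t x) ^ 2 + indicator (cball 0 (\<rho> * t)) y * norm (u t y) ^ 2" for x y
        using norm_mult_le_add_squares[of "u t x" "u t y"] by (auto simp: indicator_def)
      show "(\<integral>\<^sup>+x. ennreal (indicator (cball 0 (\<rho> * t)) x * norm (u t x) ^ 2) \<partial>lborel) \<le> ennreal (LINT x|lborel. indicator (cball 0 (\<rho> * t)) x * norm (u t x) ^ 2)"
        by (subst nn_integral_eq_integral[OF i]) auto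
    qed (use nn_integral_norm_wave_kernel_le[OF t] in auto)
    finally show ?thesis .
  qed
  with \<rho> show ?thesis using that by simp
qed


text \<open>A single \<open>n\<close> is fixed for which the energy at \<open>t0\<close> misses the
  mass \<open>m\<close> by less than m/4 and drifts by less than m/4 over all later times. At least
  m/2 remains, and the factor 2 in the cone bound leaves m/4.\<close>

theorem mass_in_cone:
  assumes t0: "t0 > 0" and pos: "(LINT x|lborel. norm (u t0 x) ^ 2) > 0"
  obtains \<rho> c where "\<rho> > 0" "c > 0"
    "\<And>t. t \<ge> t0 \<Longrightarrow> c \<le> (LINT x|lborel. indicator (cball 0 (\<rho> * t)) x * norm (u t x) ^ 2)"
proof -
  define m where "m = (LINT x|lborel. norm (u t0 x) ^ 2)"
  have m: "m > 0" using pos by (simp add: m_def)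
  obtain D where D: "D \<ge> 0" "\<And>n t. t > 0 \<Longrightarrow> norm (wave_error n t) \<le> D / (real (Suc n) * t\<^sup>2)"
    using wave_error_bound by blast
  \<comment> \<open>A bound for the modulus of the time derivative of the energy. The flux enters
    through its actual imaginary part rather than an estimate, as only this tends to 0 with
    \<open>n\<close>.\<close>
  define G where "G n s = D / real (Suc n) * s powr - 2 + 2 * \<bar>lam\<bar> * \<bar>Im (wave_flux n s)\<bar>" for n s
  \<comment> \<open>Majorant independent of \<open>n\<close>, integrable at infinity because both
    exponents 2 and \<kappa> exceed 1.\<close>
  define h where "h s = D * s powr - 2 + 2 * \<bar>lam\<bar> * (2 * C * s powr - \<kappa>)" for s
  have sub: "{t0..} \<subseteq> {0<..}" "{t0..t} \<subseteq> {0<..}" for t using t0 by auto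
  have h_int: "h integrable_on {t0..}"
  proof -
    have i: "((\<lambda>s. s powr - 2) has_integral - (t0 powr (- 2 + 1)) / (- 2 + 1)) {t0..}"
      "((\<lambda>s. s powr - \<kappa>) has_integral - (t0 powr (- \<kappa> + 1)) / (- \<kappa> + 1)) {t0..}"
      using t0 kappa by (intro has_integral_powr_to_inf; simp)+
    show ?thesis
      using has_integral_add[OF has_integral_mult_right[OF i(1), of D] has_integral_mult_right[OF has_integral_mult_right[OF i(2), of "2 * C"], of "2 * \<bar>lam\<bar>"]]
      unfolding h_def by (rule has_integral_integrable)
  qed
  have Gh: "norm (G n s) \<le> h s" and G0: "0 \<le> G n s" if "s \<in> {t0..}" for n s
  proof -
    have s: "s > 0" using that t0 by simp
    have 1: "D / real (Suc n) * s powr - 2 \<le> D * s powr - 2"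
      using D(1) by (intro mult_right_mono) (auto simp: field_simps)
    have "\<bar>Im (wave_flux n s)\<bar> \<le> 2 * C * s powr - \<kappa>"
      using abs_Im_le_cmod[of "wave_flux n s"] wave_flux_bound[OF s, of n] by linarith
    then have 2: "2 * \<bar>lam\<bar> * \<bar>Im (wave_flux n s)\<bar> \<le> 2 * \<bar>lam\<bar> * (2 * C * s powr - \<kappa>)" by (intro mult_left_mono) auto
    show "0 \<le> G n s" unfolding G_def using D(1) by simp
    then show "norm (G n s) \<le> h s"
      using add_mono[OF 1 2] unfolding real_norm_def h_def G_def by (simp only: abs_of_nonneg)
  qed
  have G_cont: "continuous_on {0<..} (G n)" for n
    unfolding G_def
    by (intro continuous_intros continuous_wave_flux) auto
  have G_int: "G n integrable_on {t0..}" for n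
  proof (rule measurable_bounded_by_integrable_imp_integrable[OF _ h_int])
    show "G n \<in> borel_measurable (lebesgue_on {t0..})"
      by (intro continuous_imp_measurable_on_sets_lebesgue continuous_on_subset[OF G_cont sub(1)]) simp
  qed (use Gh in auto)
  have "(\<lambda>n. integral {t0..} (G n)) \<longlonglongrightarrow> integral {t0..} (\<lambda>_. 0)"
  proof (rule dominated_convergence(2)[OF G_int h_int Gh])
    fix s assume "s \<in> {t0..}"
    then have s: "s > 0" using t0 by simp
    have "(\<lambda>n. D * inverse (real (Suc n)) * s powr - 2 + 2 * \<bar>lam\<bar> * \<bar>Im (wave_flux n s)\<bar>) \<longlonglongrightarrow> D * 0 * s powr - 2 + 2 * \<bar>lam\<bar> * \<bar>0\<bar>"
      by (intro tendsto_add tendsto_mult tendsto_const tendsto_rabs LIMSEQ_inverse_real_of_nat Im_wave_flux_tendsto s)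
    then show "(\<lambda>n. G n s) \<longlonglongrightarrow> 0" by (simp add: G_def divide_inverse)
  qed
  then have "(\<lambda>n. integral {t0..} (G n)) \<longlonglongrightarrow> 0" by simp
  \<comment> \<open>The integral over the whole half-line is made small, so the choice of
    \<open>n\<close> does not depend on the final time.\<close>
  then have ev1: "\<forall>\<^sub>F n in sequentially. integral {t0..} (G n) < m / 4"
    using m by (intro order_tendstoD(2)) auto
  have "\<forall>\<^sub>F n in sequentially. dist (wave_energy n t0) (of_real m) < m / 4"
    using m by (intro tendstoD wave_energy_tendsto[OF t0, folded m_def]) auto
  with ev1 have "\<forall>\<^sub>F n in sequentially. integral {t0..} (G n) < m / 4 \<and> dist (wave_energy n t0) (of_real m) < m / 4"
    by (rule eventually_conj)
  then obtain n where n: "integral {t0..} (G n) < m / 4" "dist (wave_energy n t0) (of_real m) < m / 4"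
    using eventually_happens by force
  have E: "m / 2 \<le> norm (wave_energy n t)" if t: "t \<ge> t0" for t
  proof -
    let ?d = "\<lambda>s. wave_error n s - of_real (2 * lam * Im (wave_flux n s))"
    have int: "(?d has_integral (wave_energy n t - wave_energy n t0)) {t0..t}"
      using t t0 by (intro fundamental_theorem_of_calculus has_vector_derivative_at_within[OF wave_energy_has_derivative]) auto
    have "norm (wave_energy n t - wave_energy n t0) = norm (integral {t0..t} ?d)"
      using int by (simp add: integral_unique)
    also have "\<dots> \<le> integral {t0..t} (G n)"
    proof (rule integral_norm_bound_integral)
      show "?d integrable_on {t0..t}" using int by blast
      show "G n integrable_on {t0..t}" by (intro integrable_continuous_real continuous_on_subset[OF G_cont sub(2)])
      fix s assume "s \<in> {t0..t}"
      then have s: "s > 0" using t0 by simp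
      have "norm (?d s) \<le> norm (wave_error n s) + norm (complex_of_real (2 * lam * Im (wave_flux n s)))"
        by (rule norm_triangle_ineq4)
      also have "\<dots> \<le> D / (real (Suc n) * s\<^sup>2) + 2 * \<bar>lam\<bar> * \<bar>Im (wave_flux n s)\<bar>"
        using D(2)[OF s, of n] by (simp add: norm_mult abs_mult)
      also have "D / (real (Suc n) * s\<^sup>2) = D / real (Suc n) * s powr - 2"
        using s by (simp add: powr_minus powr_numeral divide_inverse)
      finally show "norm (?d s) \<le> G n s" unfolding G_def .
    qed
    also have "\<dots> \<le> integral {t0..} (G n)"
      using G0 by (intro integral_subset_le G_int integrable_continuous_real continuous_on_subset[OF G_cont sub(2)]) auto
    also note n(1)
    finally have 1: "norm (wave_energy n t - wave_energy n t0) < m / 4" .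
    have "m = norm (complex_of_real m)" using m by simp
    also have "\<dots> = norm (wave_energy n t - ((wave_energy n t - wave_energy n t0) + (wave_energy n t0 - of_real m)))" by simp
    also have "\<dots> \<le> norm (wave_energy n t) + (norm (wave_energy n t - wave_energy n t0) + norm (wave_energy n t0 - of_real m))"
      by (intro order_trans[OF norm_triangle_ineq4] add_left_mono norm_triangle_ineq)
    finally show ?thesis using 1 n(2) by (simp add: dist_norm)
  qed
  obtain \<rho> where \<rho>: "\<rho> > 0" "\<And>t. t > 0 \<Longrightarrow> norm (wave_energy n t) \<le> 2 * (LINT x|lborel. indicator (cball 0 (\<rho> * t)) x * norm (u t x) ^ 2)"
    using wave_energy_cone_bound[of n] by blast
  have "m / 4 \<le> (LINT x|lborel. indicator (cball 0 (\<rho> * t)) x * norm (u t x) ^ 2)" if "t \<ge> t0" for t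
    using E[OF that] \<rho>(2)[of t] that t0 by simp
  then show ?thesis using that[of \<rho> "m / 4"] \<rho>(1) m by simp
qed

end

section \<open>Representatives and exponents\<close>

lemma AE_lebesgue_dense:
  fixes a b :: real
  assumes "AE t in lebesgue. P t" "a < b"
  shows "\<exists>t\<in>{a<..<b}. P t"
proof (rule ccontr)
  assume "\<not> ?thesis"
  then have "AE t in lebesgue. t \<notin> {a<..<b}"
    using assms(1) by (auto elim!: eventually_mono)
  then have "emeasure lebesgue {a<..<b} = 0"
    by (subst (asm) AE_iff_measurable[where N="{a<..<b}"]) auto
  then show False using assms(2) by simp
qed

text \<open>Finite Lebesgue norms yield only Lebesgue measurability, whereas the product-measure
  arguments are carried out with Borel functions.\<close>

lemma lebesgue_measurable_complex_ex_borel: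
  fixes f :: "'a::euclidean_space \<Rightarrow> complex"
  assumes f: "f \<in> borel_measurable lebesgue"
  obtains g where "g \<in> borel_measurable borel" "AE x in lborel. f x = g x"
proof -
  have "(\<lambda>x. Re (f x)) \<in> borel_measurable lebesgue" "(\<lambda>x. Im (f x)) \<in> borel_measurable lebesgue"
    using f by measurable
  from this[THEN completion_ex_borel_measurable_real] obtain a b where
    a: "a \<in> borel_measurable lborel" "AE x in lborel. Re (f x) = a x"
    and b: "b \<in> borel_measurable lborel" "AE x in lborel. Im (f x) = b x"
    by blast
  have "(\<lambda>x. Complex (a x) (b x)) \<in> borel_measurable borel"
    using a(1) b(1) by (simp add: borel_measurable_complex_iff)
  moreover have "AE x in lborel. f x = Complex (a x) (b x)"
    using a(2) b(2) by eventually_elim (simp add: complex_eq_iff)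
  ultimately show ?thesis using that by blast
qed

lemma Lp_norm_real:
  assumes "f \<in> borel_measurable lebesgue" "p > 0"
  shows "Lp_norm (ennreal p) f = ennreal_powr (\<integral>\<^sup>+ x. ennreal (norm (f x) powr p) \<partial>lebesgue) (1 / p)"
  using assms by (simp add: Lp_norm_def)

lemma Lp_norm_le_iff:
  assumes f: "f \<in> borel_measurable lebesgue" and p: "p > 0" and K: "K \<ge> 0"
  shows "Lp_norm (ennreal p) f \<le> ennreal K \<longleftrightarrow> (\<integral>\<^sup>+ x. ennreal (norm (f x) powr p) \<partial>lebesgue) \<le> ennreal (K powr p)"
proof (cases "(\<integral>\<^sup>+ x. ennreal (norm (f x) powr p) \<partial>lebesgue)")
  case (real r)
  have "r powr (1 / p) \<le> K \<longleftrightarrow> r \<le> K powr p"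
  proof
    assume "r powr (1 / p) \<le> K"
    then have "(r powr (1 / p)) powr p \<le> K powr p" using p by (intro powr_mono2) auto
    then show "r \<le> K powr p" using p real by (simp add: powr_powr)
  next
    assume "r \<le> K powr p"
    then have "r powr (1 / p) \<le> (K powr p) powr (1 / p)" using p real by (intro powr_mono2) auto
    then show "r powr (1 / p) \<le> K" using p K by (simp add: powr_powr)
  qed
  then show ?thesis using real K by (simp add: Lp_norm_real[OF f p] ennreal_powr_def)
next
  case top
  then show ?thesis by (simp add: Lp_norm_real[OF f p] ennreal_powr_def top_unique)
qed

lemma Lp_norm_measurable: "Lp_norm p f < \<infinity> \<Longrightarrow> f \<in> borel_measurable lebesgue"
  by (auto simp: Lp_norm_def split: if_splits)

text \<open>The a.e. decay estimates hold at every time, by lower semicontinuity.\<close>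

lemma L2_limit_nn_integral_powr_le:
  fixes v :: "real \<Rightarrow> 'a::euclidean_space \<Rightarrow> complex"
  assumes [measurable]: "\<And>s. v s \<in> borel_measurable borel" and p: "p > 0"
    and int: "\<And>s. s > 0 \<Longrightarrow> integrable lborel (\<lambda>x. norm (v s x - v t x) ^ 2)"
    and lim: "((\<lambda>s. LINT x|lborel. norm (v s x - v t x) ^ 2) \<longlongrightarrow> 0) (at t)"
    and ae: "AE s in lebesgue. 0 < s \<longrightarrow> (\<integral>\<^sup>+x. ennreal (norm (v s x) powr p) \<partial>lborel) \<le> ennreal (C s)"
    and C: "isCont C t" and t: "t > 0"
  shows "(\<integral>\<^sup>+x. ennreal (norm (v t x) powr p) \<partial>lborel) \<le> ennreal (C t)"
proof -
  \<comment> \<open>Times at which the estimate holds are dense. Taking them strictly to the right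
    of \<open>t\<close> keeps them positive and different from \<open>t\<close>, as the punctured
    limit requires.\<close>
  have "\<forall>n. \<exists>s\<in>{t<..<t + 1 / real (Suc n)}. 0 < s \<longrightarrow> (\<integral>\<^sup>+x. ennreal (norm (v s x) powr p) \<partial>lborel) \<le> ennreal (C s)"
    by (intro allI AE_lebesgue_dense[OF ae]) simp
  then obtain s where s: "\<And>n. s n \<in> {t<..<t + 1 / real (Suc n)}"
    "\<And>n. 0 < s n \<longrightarrow> (\<integral>\<^sup>+x. ennreal (norm (v (s n) x) powr p) \<partial>lborel) \<le> ennreal (C (s n))"
    by metis
  have s0: "s n > 0" for n using s(1)[of n] t by simp
  have slim: "s \<longlonglongrightarrow> t"
  proof (rule real_tendsto_sandwich[where f="\<lambda>_. t" and h="\<lambda>n. t + inverse (real (Suc n))"])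
    show "(\<lambda>n. t + inverse (real (Suc n))) \<longlonglongrightarrow> t" by (rule LIMSEQ_inverse_real_of_nat_add)
    show "\<forall>\<^sub>F n in sequentially. t \<le> s n" using s(1) by (auto intro!: always_eventually less_imp_le)
    show "\<forall>\<^sub>F n in sequentially. s n \<le> t + inverse (real (Suc n))"
      using s(1) by (auto intro!: always_eventually less_imp_le simp: inverse_eq_divide)
  qed simp
  have "(\<lambda>n. LINT x|lborel. norm (v (s n) x - v t x) ^ 2) \<longlonglongrightarrow> 0"
    using lim slim s(1) unfolding tendsto_at_iff_sequentially o_def by (auto simp: less_imp_neq[symmetric])
  from L2_AE_subseq[OF int[OF s0] this] obtain r :: "nat \<Rightarrow> nat" where
    r: "strict_mono r" "AE x in lborel. (\<lambda>n. v (s (r n)) x) \<longlonglongrightarrow> v t x" by blast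
  have "(\<integral>\<^sup>+x. ennreal (norm (v t x) powr p) \<partial>lborel) = (\<integral>\<^sup>+x. liminf (\<lambda>n. ennreal (norm (v (s (r n)) x) powr p)) \<partial>lborel)"
  proof (rule nn_integral_cong_AE)
    show "AE x in lborel. ennreal (norm (v t x) powr p) = liminf (\<lambda>n. ennreal (norm (v (s (r n)) x) powr p))"
      using r(2)
    proof eventually_elim
      case (elim x)
      have "(\<lambda>n. norm (v (s (r n)) x) powr p) \<longlonglongrightarrow> norm (v t x) powr p"
        using p by (intro tendsto_powr' tendsto_norm elim tendsto_const) auto
      then have "(\<lambda>n. ennreal (norm (v (s (r n)) x) powr p)) \<longlonglongrightarrow> ennreal (norm (v t x) powr p)"
        by (rule tendsto_ennrealI)
      from lim_imp_Liminf[OF sequentially_bot this] show ?case by simp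
    qed
  qed
  \<comment> \<open>Fatou's lemma along an almost everywhere convergent subsequence; continuity of
    the constant in time then recovers its value at \<open>t\<close>.\<close>
  also have "\<dots> \<le> liminf (\<lambda>n. \<integral>\<^sup>+x. ennreal (norm (v (s (r n)) x) powr p) \<partial>lborel)"
    by (rule nn_integral_liminf) measurable
  also have "\<dots> \<le> liminf (\<lambda>n. ennreal (C (s (r n))))"
    using s(2) s0 by (intro Liminf_mono always_eventually) auto
  also have "\<dots> = ennreal (C t)"
  proof (rule lim_imp_Liminf)
    have "(\<lambda>n. s (r n)) \<longlonglongrightarrow> t" using LIMSEQ_subseq_LIMSEQ[OF slim r(1)] by (simp add: o_def)
    then show "(\<lambda>n. ennreal (C (s (r n)))) \<longlonglongrightarrow> ennreal (C t)"
      by (intro tendsto_ennrealI isCont_tendsto_compose[OF C])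
  qed simp
  finally show ?thesis .
qed

text \<open>Plays the part of Hoelder's inequality on the ball: where |f|^2 exceeds \<delta>, the
  missing power of |f| may be inserted at the price of a power of \<delta>. The level \<delta> will
  be adapted to the time.\<close>

lemma mass_le_Young:
  fixes f :: "'a::euclidean_space \<Rightarrow> complex"
  assumes [measurable]: "f \<in> borel_measurable borel" and p: "p \<ge> 2" and \<delta>: "\<delta> > 0" and R: "R \<ge> 0"
  shows "(\<integral>\<^sup>+x. indicator (cball 0 R) x * ennreal (norm (f x) ^ 2) \<partial>lborel) \<le>
     ennreal (\<delta> * (unit_ball_vol DIM('a) * R ^ DIM('a))) + ennreal (\<delta> powr (1 - p / 2)) * (\<integral>\<^sup>+x. ennreal (norm (f x) powr p) \<partial>lborel)"
proof -
  have pt: "a ^ 2 \<le> \<delta> + \<delta> powr (1 - p / 2) * a powr p" if a: "a \<ge> 0" for a :: real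
  proof (cases "a ^ 2 \<le> \<delta>")
    case True
    then show ?thesis by (simp add: add_increasing2)
  next
    case False
    then have "\<delta> powr (p / 2 - 1) \<le> (a ^ 2) powr (p / 2 - 1)" using p \<delta> by (intro powr_mono2) auto
    moreover have a0: "a > 0" using False a \<delta> by (cases "a = 0") auto
    moreover have "1 = \<delta> powr (1 - p / 2) * \<delta> powr (p / 2 - 1)" using \<delta> by (simp only: powr_add[symmetric]) simp
    ultimately have "1 \<le> \<delta> powr (1 - p / 2) * (a ^ 2) powr (p / 2 - 1)"
      by (metis mult_left_mono powr_ge_zero)
    then have "a ^ 2 * 1 \<le> a ^ 2 * (\<delta> powr (1 - p / 2) * (a ^ 2) powr (p / 2 - 1))" by (intro mult_left_mono) auto
    also have "\<dots> = \<delta> powr (1 - p / 2) * (a ^ 2 * (a ^ 2) powr (p / 2 - 1))" by simp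
    also have "a ^ 2 * (a ^ 2) powr (p / 2 - 1) = (a ^ 2) powr (1 + (p / 2 - 1))" using a0 by (subst powr_add) simp
    also have "\<dots> = a powr p" using a0 by (simp add: powr_numeral[symmetric] powr_powr del: powr_numeral)
    finally show ?thesis using \<delta> by simp
  qed
  have m: "(\<lambda>x::'a. ennreal \<delta> * indicator (cball 0 R) x) \<in> borel_measurable lborel"
    by (intro borel_measurable_times_ennreal borel_measurable_const borel_measurable_indicator) simp
  have "(\<integral>\<^sup>+x. indicator (cball 0 R) x * ennreal (norm (f x) ^ 2) \<partial>lborel)
     \<le> (\<integral>\<^sup>+x. ennreal \<delta> * indicator (cball 0 R) x + ennreal (\<delta> powr (1 - p / 2)) * ennreal (norm (f x) powr p) \<partial>lborel)"
  proof (rule nn_integral_mono)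
    fix x
    have "ennreal (norm (f x) ^ 2) \<le> ennreal \<delta> + ennreal (\<delta> powr (1 - p / 2)) * ennreal (norm (f x) powr p)"
      using ennreal_leI[OF pt[OF norm_ge_zero[of "f x"]]] \<delta> by (simp add: ennreal_mult')
    then show "indicator (cball 0 R) x * ennreal (norm (f x) ^ 2) \<le> ennreal \<delta> * indicator (cball 0 R) x + ennreal (\<delta> powr (1 - p / 2)) * ennreal (norm (f x) powr p)"
      by (cases "x \<in> cball 0 R") auto
  qed
  also have "\<dots> = (\<integral>\<^sup>+x. ennreal \<delta> * indicator (cball 0 R) x \<partial>(lborel :: 'a measure)) + ennreal (\<delta> powr (1 - p / 2)) * (\<integral>\<^sup>+x. ennreal (norm (f x) powr p) \<partial>lborel)"
    by (subst nn_integral_add[OF m], measurable) (subst nn_integral_cmult, measurable)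
  also have "(\<integral>\<^sup>+x. ennreal \<delta> * indicator (cball 0 R) x \<partial>(lborel :: 'a measure)) = ennreal \<delta> * emeasure lborel (cball (0::'a) R)"
    by (rule nn_integral_cmult_indicator) simp
  also have "\<dots> = ennreal (\<delta> * (unit_ball_vol DIM('a) * R ^ DIM('a)))"
    using R \<delta> by (simp add: emeasure_cball ennreal_mult')
  finally show ?thesis .
qed

section \<open>Exponents and decay rates\<close>

lemma decay_rate_ennreal:
  assumes "p > 0" shows "decay_rate N (ennreal p) = real N * (1 / 2 - 1 / p)"
proof -
  have "1 / ennreal p = ennreal (1 / p)" using assms by (simp add: divide_ennreal[symmetric])
  then show ?thesis using assms by (simp add: decay_rate_def)
qed

lemma decay_rate_top: "decay_rate N top = real N / 2"
  by (simp add: decay_rate_def)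

lemma two_less_sobolev_exponent: "2 < sobolev_exponent N"
proof (cases "N \<le> 2")
  case False
  then have "ennreal 2 < ennreal (2 * real N / (real N - 2))" by (intro ennreal_lessI) (auto simp: field_simps)
  then show ?thesis using False by (simp add: sobolev_exponent_def)
qed (simp add: sobolev_exponent_def)

text \<open>For N > 2 the upper end is 2 + 4/(N-2), strictly above 2 + 4/N. Hence r = \<alpha>+2
  lies in the range of the decay hypothesis even in the mass-critical case.\<close>

lemma subcritical_less_sobolev_exponent:
  assumes "N \<ge> 1" "\<alpha> \<le> 4 / real N" "0 < \<alpha>"
  shows "ennreal (\<alpha> + 2) < sobolev_exponent N"
proof (cases "N \<le> 2")
  case False
  then have N: "real N > 2" by simp
  have "4 / real N < 4 / (real N - 2)" using N by (intro divide_strict_left_mono) auto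
  moreover have "4 / (real N - 2) + 2 = 2 * real N / (real N - 2)" using N by (simp add: field_simps)
  ultimately have "\<alpha> + 2 < 2 * real N / (real N - 2)" using assms(2) by linarith
  then have "ennreal (\<alpha> + 2) < ennreal (2 * real N / (real N - 2))" using assms(3) by (intro ennreal_lessI) auto
  then show ?thesis using False by (simp add: sobolev_exponent_def)
qed (simp add: sobolev_exponent_def)

text \<open>Lets the integrand be discarded at times outside the support, where \<open>u\<close> and
  its representative are not related.\<close>

lemma test_function_derivs_zero:
  assumes "z \<notin> closure {z. \<psi> z \<noteq> 0}"
  shows "\<psi> z = 0" "time_deriv \<psi> z = 0" "space_laplacian \<psi> z = 0"
proof -
  let ?S = "- closure {z. \<psi> z \<noteq> 0}"
  have S: "open ?S" by auto
  have 0: "\<psi> y = 0" if "y \<in> ?S" for y using that closure_subset[of "{z. \<psi> z \<noteq> 0}"] by auto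
  have 1: "dir_deriv v \<psi> y = 0" if "y \<in> ?S" for v y using dir_deriv_eq_0[OF S that] 0 by blast
  have 2: "dir_deriv v (dir_deriv v \<psi>) y = 0" if "y \<in> ?S" for v y using dir_deriv_eq_0[OF S that] 1 by blast
  have z: "z \<in> ?S" using assms by simp
  show "\<psi> z = 0" by (rule 0[OF z])
  show "time_deriv \<psi> z = 0" unfolding time_deriv_def by (rule 1[OF z])
  show "space_laplacian \<psi> z = 0" unfolding space_laplacian_def by (intro sum.neutral ballI 2[OF z])
qed

lemma test_function_derivs_measurable:
  fixes \<psi> :: "real \<times> 'a::euclidean_space \<Rightarrow> complex"
  assumes "test_function S \<psi>"
  shows "(\<lambda>x. \<psi> (t, x)) \<in> borel_measurable borel" "(\<lambda>x. time_deriv \<psi> (t, x)) \<in> borel_measurable borel"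
    "(\<lambda>x. space_laplacian \<psi> (t, x)) \<in> borel_measurable borel"
proof -
  have \<psi>: "smooth \<psi>" using assms by (simp add: test_function_def smooth_def)
  have m: "(\<lambda>x. f (t, x)) \<in> borel_measurable borel" if "smooth f" for f :: "real \<times> 'a \<Rightarrow> complex"
  proof -
    have "continuous_on UNIV (\<lambda>x::'a. (t, x))" by (intro continuous_intros)
    from continuous_on_compose2[OF smooth_continuous[OF that] this] show ?thesis
      by (intro borel_measurable_continuous_onI) auto
  qed
  show "(\<lambda>x. \<psi> (t, x)) \<in> borel_measurable borel" by (rule m[OF \<psi>])
  have "(1, 0) \<in> (Basis :: (real \<times> 'a) set)" by (simp add: Basis_prod_def)
  then show "(\<lambda>x. time_deriv \<psi> (t, x)) \<in> borel_measurable borel"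
    unfolding time_deriv_def by (intro m smooth_dir_deriv \<psi>)
  have "(0, b) \<in> (Basis :: (real \<times> 'a) set)" if "b \<in> Basis" for b using that by (simp add: Basis_prod_def)
  then show "(\<lambda>x. space_laplacian \<psi> (t, x)) \<in> borel_measurable borel"
    unfolding space_laplacian_def by (intro borel_measurable_sum m smooth_dir_deriv \<psi>)
qed

text \<open>The ball has volume V t^N. A fixed amount of mass in it forces a sup norm of order
  t^(-N/2), and for finite r the corresponding L^r norm, with a constant in which t no longer
  occurs.\<close>

lemma Lp_norm_lower_bound:
  fixes f g :: "'a::euclidean_space \<Rightarrow> complex"
  assumes f: "f \<in> borel_measurable lebesgue" and g [measurable]: "g \<in> borel_measurable borel" and fg: "AE x in lborel. f x = g x"
    and c: "c > 0" and t: "t > 0" and \<rho>: "\<rho> > 0"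
    and mass: "ennreal c \<le> (\<integral>\<^sup>+x. indicator (cball 0 (\<rho> * t)) x * ennreal (norm (g x) ^ 2) \<partial>lborel)"
    and r: "2 \<le> r"
  defines "V \<equiv> unit_ball_vol DIM('a) * \<rho> ^ DIM('a)"
  shows "ennreal (if r = \<infinity> then sqrt (c / V) else ((c / 2) * (c / (2 * V)) powr (enn2real r / 2 - 1)) powr (1 / enn2real r))
     \<le> ennreal (\<bar>t\<bar> powr decay_rate DIM('a) r) * Lp_norm r f"
proof (cases "r = \<infinity>")
  case True
  have V: "V > 0" using \<rho> by (simp add: V_def)
  \<comment> \<open>In \<open>ennreal\<close> the product of 0 and \<infinity> is 0; a nonzero
    weight ensures that an infinite norm makes the product infinite.\<close>
  have nz: "ennreal (t powr decay_rate DIM('a) r) \<noteq> 0" using t by simp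
  show ?thesis
  proof (cases "Lp_norm r f")
    case top
    then show ?thesis using nz t by (simp add: ennreal_mult_top)
  next
    case (real s)
    have "esssup lebesgue (\<lambda>x. ennreal (norm (f x))) = ennreal s" using real f True by (simp add: Lp_norm_def)
    then have "AE x in lebesgue. ennreal (norm (f x)) \<le> ennreal s"
      using esssup_AE[where M=lebesgue and f="\<lambda>x. ennreal (norm (f x))"] by (simp only:)
    then have "AE x in lborel. ennreal (norm (f x)) \<le> ennreal s" by (simp add: AE_completion_iff)
    then have AE: "AE x in lborel. norm (g x) \<le> s" using fg by eventually_elim (use real in auto)
    have "(\<integral>\<^sup>+x. indicator (cball 0 (\<rho> * t)) x * ennreal (norm (g x) ^ 2) \<partial>lborel) \<le> (\<integral>\<^sup>+x. ennreal (s ^ 2) * indicator (cball 0 (\<rho> * t)) x \<partial>(lborel :: 'a measure))"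
      using AE by (intro nn_integral_mono_AE, eventually_elim) (auto simp: indicator_def intro!: ennreal_leI power_mono)
    also have "\<dots> = ennreal (s ^ 2) * emeasure lborel (cball (0::'a) (\<rho> * t))"
      by (rule nn_integral_cmult_indicator) simp
    also have "\<dots> = ennreal (s ^ 2 * (V * t ^ DIM('a)))"
      using \<rho> t by (simp add: emeasure_cball ennreal_mult' V_def power_mult_distrib mult.assoc)
    finally have "ennreal c \<le> ennreal (s ^ 2 * (V * t ^ DIM('a)))" using mass by (rule order_trans[rotated])
    then have "c \<le> s ^ 2 * (V * t ^ DIM('a))" using V t by (subst (asm) ennreal_le_iff) auto
    then have "c / V \<le> s ^ 2 * t ^ DIM('a)" using V by (simp add: field_simps)
    also have "\<dots> = (t powr (real DIM('a) / 2) * s) ^ 2"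
    proof -
      have "(t powr (real DIM('a) / 2)) ^ 2 = t powr (real DIM('a) / 2 + real DIM('a) / 2)"
        by (simp only: power2_eq_square powr_add)
      also have "\<dots> = t ^ DIM('a)" using t by (simp add: powr_realpow)
      finally show ?thesis by (simp add: power_mult_distrib)
    qed
    finally have "sqrt (c / V) \<le> t powr (real DIM('a) / 2) * s"
      using real by (intro real_le_lsqrt) auto
    then show ?thesis using True t real by (simp add: decay_rate_top ennreal_mult'[symmetric] ennreal_leI)
  qed
next
  case False
  have V: "V > 0" using \<rho> by (simp add: V_def)
  define p where "p = enn2real r"
  have rp: "r = ennreal p" using False by (simp add: p_def less_top)
  have p: "p \<ge> 2"
  proof -
    have "ennreal 2 \<le> ennreal p" using r rp by simp
    then show ?thesis by (subst (asm) ennreal_le_iff2) auto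
  qed
  define I where "I = (\<integral>\<^sup>+x. ennreal (norm (g x) powr p) \<partial>lborel)"
  have I: "I = (\<integral>\<^sup>+x. ennreal (norm (f x) powr p) \<partial>lebesgue)"
    unfolding I_def nn_integral_completion by (rule nn_integral_cong_AE) (use fg in eventually_elim, simp)
  have L: "Lp_norm r f = ennreal_powr I (1 / p)"
    unfolding rp I using p by (intro Lp_norm_real f) simp
  have nz: "ennreal (t powr decay_rate DIM('a) r) \<noteq> 0" using t by simp
  show ?thesis
  proof (cases I)
    case top
    then show ?thesis using nz t False L by (simp add: ennreal_powr_def ennreal_mult_top)
  next
    case (real J)
    define T where "T = t ^ DIM('a)"
    have T: "T > 0" using t by (simp add: T_def)
    \<comment> \<open>The level at which the volume term in Young's inequality uses up exactly half
      of the mass \<open>c\<close>.\<close>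
    define \<delta> where "\<delta> = c / (2 * V * T)"
    have \<delta>: "\<delta> > 0" using c V T by (simp add: \<delta>_def)
    have "ennreal c \<le> ennreal (\<delta> * (V * T)) + ennreal (\<delta> powr (1 - p / 2)) * I"
      using order_trans[OF mass mass_le_Young[OF g p \<delta>, of "\<rho> * t"]] \<rho> t
      by (simp add: I_def V_def T_def power_mult_distrib mult.assoc)
    also have "\<dots> = ennreal (c / 2 + \<delta> powr (1 - p / 2) * J)"
      using V T c real by (simp add: \<delta>_def ennreal_mult' ennreal_plus)
    finally have "c \<le> c / 2 + \<delta> powr (1 - p / 2) * J"
      using c real by (subst (asm) ennreal_le_iff) auto
    then have "c / 2 * \<delta> powr (p / 2 - 1) \<le> (\<delta> powr (1 - p / 2) * J) * \<delta> powr (p / 2 - 1)"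
      by (intro mult_right_mono) auto
    also have "\<dots> = (\<delta> powr (1 - p / 2) * \<delta> powr (p / 2 - 1)) * J" by simp
    also have "\<delta> powr (1 - p / 2) * \<delta> powr (p / 2 - 1) = 1" using \<delta> by (simp only: powr_add[symmetric]) simp
    finally have J: "c / 2 * \<delta> powr (p / 2 - 1) \<le> J" by simp
    have "(1 / T) powr (p / 2 - 1) = T powr - (p / 2 - 1)" using T by (simp only: powr_divide powr_minus_divide powr_one_eq_one)
    then have "(1 / T) powr (p / 2 - 1) = T powr (1 - p / 2)" by simp
    moreover have "\<delta> = c / (2 * V) * (1 / T)" by (simp add: \<delta>_def)
    ultimately have \<delta>p: "\<delta> powr (p / 2 - 1) = (c / (2 * V)) powr (p / 2 - 1) * T powr (1 - p / 2)"
      by (simp only: powr_mult)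
    have Tp: "T powr (p / 2 - 1) * T powr (1 - p / 2) = 1" using T by (simp only: powr_add[symmetric]) simp
    \<comment> \<open>All dependence on time sits in a power of \<open>T\<close>; after taking p-th
      roots it is t to the power N(1/2 - 1/p), the decay rate.\<close>
    have "c / 2 * (c / (2 * V)) powr (p / 2 - 1) = T powr (p / 2 - 1) * (c / 2 * \<delta> powr (p / 2 - 1))"
      unfolding \<delta>p using Tp by (simp add: mult_ac)
    also have "\<dots> \<le> T powr (p / 2 - 1) * J" by (intro mult_left_mono J) simp
    finally have "(c / 2 * (c / (2 * V)) powr (p / 2 - 1)) powr (1 / p) \<le> (T powr (p / 2 - 1) * J) powr (1 / p)"
      using c V p by (intro powr_mono2) auto
    also have "(T powr (p / 2 - 1) * J) powr (1 / p) = t powr (real DIM('a) * (1 / 2 - 1 / p)) * J powr (1 / p)"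
    proof -
      have "T = t powr real DIM('a)" using t by (simp add: T_def powr_realpow)
      then have "(T powr (p / 2 - 1)) powr (1 / p) = t powr (real DIM('a) * (1 / 2 - 1 / p))"
        using p by (simp add: powr_powr diff_divide_distrib right_diff_distrib)
      then show ?thesis by (simp add: powr_mult)
    qed
    finally have "(c / 2 * (c / (2 * V)) powr (p / 2 - 1)) powr (1 / p) \<le> t powr (real DIM('a) * (1 / 2 - 1 / p)) * J powr (1 / p)" .
    moreover have "Lp_norm (ennreal p) f = ennreal_powr (ennreal J) (1 / p)" using L rp real by simp
    ultimately show ?thesis
      using False t real p unfolding p_def[symmetric] rp
      by (simp add: decay_rate_ennreal ennreal_powr_def ennreal_mult'[symmetric] ennreal_leI)
  qed
qed

text \<open>The decay hypothesis is applied at two exponents: r = 2 bounds the mass, and r =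
  \<alpha>+2 controls the nonlinearity. The conclusions at time 0 are kept separately, because they
  carry the information that the initial datum does not vanish.\<close>

lemma decaying_nls_of_solution:
  fixes u :: "real \<Rightarrow> 'a::euclidean_space \<Rightarrow> complex"
  assumes \<alpha>: "(if DIM('a) = 1 then 2 else 4 / (real DIM('a) + 2)) < \<alpha>" "\<alpha> \<le> 4 / real DIM('a)"
    and sol: "nls_solution lam \<alpha> \<phi> I u" and I: "open I" "{0..} \<subseteq> I"
    and decay: "\<And>r. 2 \<le> r \<Longrightarrow> r < sobolev_exponent DIM('a) \<Longrightarrow>
           \<exists>C::real. AE t in lebesgue. 0 < t \<longrightarrow> Lp_norm r (u t) \<le> ennreal (C * \<bar>t\<bar> powr (- decay_rate DIM('a) r))"
  obtains w \<kappa> M C where "decaying_nls w lam \<alpha> \<kappa> M C"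
    "\<And>t. 0 \<le> t \<Longrightarrow> u t \<in> borel_measurable lebesgue"
    "\<And>t. 0 \<le> t \<Longrightarrow> AE x in lborel. u t x = w t x"
    "integrable lborel (\<lambda>x. norm (w 0 x) ^ 2)"
    "((\<lambda>s. LINT x|lborel. norm (w s x - w 0 x) ^ 2) \<longlongrightarrow> 0) (at_right 0)"
proof -
  let ?N = "real DIM('a)"
  have N: "?N \<ge> 1" by simp
  have \<alpha>0: "\<alpha> > 0"
  proof (rule less_trans[OF _ \<alpha>(1)])
    show "0 < (if DIM('a) = 1 then 2 else 4 / (?N + 2))" using N by simp
  qed
  \<comment> \<open>The exponent N(1/2 - 1/r) r at r = \<alpha>+2. For N \<ge> 2 the hypothesis
    implies \<alpha> > 4/(N+2) \<ge> 2/N; for N = 1 it says \<alpha> > 2 directly.\<close>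
  define \<kappa> where "\<kappa> = ?N * \<alpha> / 2"
  have \<kappa>: "\<kappa> > 1"
  proof (cases "DIM('a) = 1")
    case True
    then show ?thesis using \<alpha>(1) by (simp add: \<kappa>_def)
  next
    case False
    then have N2: "?N \<ge> 2" using DIM_positive[where 'a='a] by linarith
    then have "2 / ?N \<le> 4 / (?N + 2)" by (simp add: field_simps)
    then have "2 / ?N < \<alpha>" using \<alpha>(1) False by simp
    then show ?thesis using N by (simp add: \<kappa>_def field_simps)
  qed
  have cont: "continuous_L2 I u" and dist: "nls_distributional lam \<alpha> I u"
    using sol by (auto simp: nls_solution_def)
  have um: "u t \<in> borel_measurable lebesgue" if "t \<in> I" for t
    using cont that Lp_norm_measurable[of 2 "u t"] by (auto simp: continuous_L2_def in_Lp_def)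
  \<comment> \<open>Outside \<open>I\<close> nothing is known about \<open>u t\<close>; the
    representative is set to 0 there, since the locale asks for measurability at all times.\<close>
  have "\<exists>g. g \<in> borel_measurable borel \<and> (t \<in> I \<longrightarrow> (AE x in lborel. u t x = g x))" for t
  proof (cases "t \<in> I")
    case True
    then show ?thesis using lebesgue_measurable_complex_ex_borel[OF um[OF True]] by metis
  next
    case False
    then show ?thesis by (intro exI[of _ "\<lambda>_. 0"]) simp
  qed
  then obtain w where w [measurable]: "\<And>t. w t \<in> borel_measurable borel" and uw: "\<And>t. t \<in> I \<Longrightarrow> AE x in lborel. u t x = w t x"
    by metis
  have nn: "(\<integral>\<^sup>+x. F x (u t x) \<partial>lebesgue) = (\<integral>\<^sup>+x. F x (w t x) \<partial>lborel)" if "t \<in> I" for F :: "'a \<Rightarrow> complex \<Rightarrow> ennreal" and t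
    unfolding nn_integral_completion by (rule nn_integral_cong_AE) (use uw[OF that] in eventually_elim, simp)
  have nn2: "(\<integral>\<^sup>+x. F (u s x) (u t x) \<partial>lebesgue) = (\<integral>\<^sup>+x. F (w s x) (w t x) \<partial>lborel)" if "s \<in> I" "t \<in> I" for F :: "complex \<Rightarrow> complex \<Rightarrow> ennreal" and s t
    unfolding nn_integral_completion by (rule nn_integral_cong_AE) (use uw[OF that(1)] uw[OF that(2)] in eventually_elim, simp)
  have p2: "norm z powr 2 = norm z ^ 2" for z :: complex by (simp add: powr_numeral)
  have L2: "integrable lborel (\<lambda>x. norm (w t x) ^ 2)" if t: "t \<in> I" for t
  proof -
    have "Lp_norm (ennreal 2) (u t) < \<infinity>" using cont t by (auto simp: continuous_L2_def in_Lp_def)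
    then obtain K where K: "K \<ge> 0" "Lp_norm (ennreal 2) (u t) \<le> ennreal K"
      by (cases "Lp_norm (ennreal 2) (u t)") auto
    then have "(\<integral>\<^sup>+x. ennreal (norm (w t x) ^ 2) \<partial>lborel) \<le> ennreal (K powr 2)"
      using Lp_norm_le_iff[OF um[OF t], of 2 K] nn[OF t, of "\<lambda>_ z. ennreal (norm z powr 2)"] by (simp add: p2)
    then show ?thesis unfolding integrable_iff_bounded by (auto intro: le_less_trans)
  qed
  have L2d: "integrable lborel (\<lambda>x. norm (w s x - w t x) ^ 2)" if "s \<in> I" "t \<in> I" for s t
  proof (rule Bochner_Integration.integrable_bound)
    show "integrable lborel (\<lambda>x. 2 powr 2 * (norm (w s x) ^ 2 + norm (w t x) ^ 2))"
      using L2 that by auto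
    have "norm (w s x - w t x) ^ 2 \<le> 2 powr 2 * (norm (w s x) ^ 2 + norm (w t x) ^ 2)" for x
      using norm_diff_powr_le[of 2 "w s x" "w t x" 0] by (simp only: p2 diff_zero norm_minus_cancel diff_0 zero_less_numeral simp_thms)
    then show "AE x in lborel. norm (norm (w s x - w t x) ^ 2) \<le> norm (2 powr 2 * (norm (w s x) ^ 2 + norm (w t x) ^ 2))"
      by (intro AE_I2) (auto intro: order_trans[OF _ abs_ge_self])
  qed measurable
  have L2c: "((\<lambda>s. LINT x|lborel. norm (w s x - w t x) ^ 2) \<longlongrightarrow> 0) (at t)" if t: "t \<in> I" for t
  proof (rule tendstoI)
    fix e :: real assume e: "e > 0"
    define K where "K = sqrt (e / 2)"
    have K: "K \<ge> 0" "K powr 2 = e / 2" "K > 0" using e by (auto simp: K_def powr_numeral)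
    have "((\<lambda>s. Lp_norm 2 (\<lambda>x. u s x - u t x)) \<longlongrightarrow> 0) (at t)"
      using cont t at_within_open[OF t I(1)] by (auto simp: continuous_L2_def)
    then have "\<forall>\<^sub>F s in at t. Lp_norm 2 (\<lambda>x. u s x - u t x) < ennreal K"
      using K by (intro order_tendstoD(2)) auto
    moreover have "\<forall>\<^sub>F s in at t. s \<in> I" using eventually_at_in_open'[OF I(1) t] .
    ultimately show "\<forall>\<^sub>F s in at t. dist (LINT x|lborel. norm (w s x - w t x) ^ 2) 0 < e"
    proof eventually_elim
      case (elim s)
      have m: "(\<lambda>x. u s x - u t x) \<in> borel_measurable lebesgue"
        using um[OF t] um[OF elim(2)] by measurable
      have "Lp_norm (ennreal 2) (\<lambda>x. u s x - u t x) \<le> ennreal K" using elim(1) by simp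
      then have "(\<integral>\<^sup>+x. ennreal (norm (u s x - u t x) powr 2) \<partial>lebesgue) \<le> ennreal (e / 2)"
        using Lp_norm_le_iff[OF m, of 2 K] K by simp
      then have "(\<integral>\<^sup>+x. ennreal (norm (w s x - w t x) ^ 2) \<partial>lborel) \<le> ennreal (e / 2)"
        using nn2[OF elim(2) t, of "\<lambda>a b. ennreal (norm (a - b) powr 2)"] by (simp add: p2)
      then have "ennreal (LINT x|lborel. norm (w s x - w t x) ^ 2) \<le> ennreal (e / 2)"
        by (subst (asm) nn_integral_eq_integral) (use L2d elim t in auto)
      then have "(LINT x|lborel. norm (w s x - w t x) ^ 2) \<le> e / 2" using e by (subst (asm) ennreal_le_iff) auto
      then show ?case using e by simp
    qed
  qed
  have posI: "t \<in> I" if "0 \<le> t" for t using I(2) that by auto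
  have Lp: "\<exists>C\<ge>0. \<forall>t>0. (\<integral>\<^sup>+x. ennreal (norm (w t x) powr p) \<partial>lborel) \<le> ennreal (C * t powr - (?N * (p / 2 - 1)))"
    if p: "p \<ge> 2" "ennreal p < sobolev_exponent DIM('a)" for p
  proof -
    have "2 \<le> ennreal p" using ennreal_leI[OF p(1)] by simp
    from decay[OF this p(2)] obtain C where
      C: "AE t in lebesgue. 0 < t \<longrightarrow> Lp_norm (ennreal p) (u t) \<le> ennreal (C * \<bar>t\<bar> powr (- decay_rate DIM('a) (ennreal p)))" by blast
    \<comment> \<open>The constant in the hypothesis may be negative, and powers need a nonnegative
      base.\<close>
    define D where "D = (max C 0) powr p"
    have ae: "AE t in lebesgue. 0 < t \<longrightarrow> (\<integral>\<^sup>+x. ennreal (norm (w t x) powr p) \<partial>lborel) \<le> ennreal (D * t powr - (?N * (p / 2 - 1)))"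
      using C
    proof eventually_elim
      case (elim t)
      show ?case
      proof
        assume t: "0 < t"
        define K where "K = max C 0 * t powr - (?N * (1 / 2 - 1 / p))"
        have "Lp_norm (ennreal p) (u t) \<le> ennreal (C * t powr - (?N * (1 / 2 - 1 / p)))"
          using elim t p by (simp add: decay_rate_ennreal)
        also have "\<dots> \<le> ennreal K" unfolding K_def by (intro ennreal_leI mult_right_mono) auto
        finally have "(\<integral>\<^sup>+x. ennreal (norm (u t x) powr p) \<partial>lebesgue) \<le> ennreal (K powr p)"
          using Lp_norm_le_iff[OF um, of t p K] p posI[of t] t by (simp add: K_def)
        moreover have "K powr p = D * t powr - (?N * (p / 2 - 1))"
        proof -
          have "K powr p = D * (t powr - (?N * (1 / 2 - 1 / p))) powr p" by (simp add: K_def D_def powr_mult)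
          also have "(t powr - (?N * (1 / 2 - 1 / p))) powr p = t powr (- (?N * (1 / 2 - 1 / p)) * p)" by (rule powr_powr)
          also have "- (?N * (1 / 2 - 1 / p)) * p = - (?N * (p / 2 - 1))" using p by (simp add: field_simps)
          finally show ?thesis .
        qed
        ultimately show "(\<integral>\<^sup>+x. ennreal (norm (w t x) powr p) \<partial>lborel) \<le> ennreal (D * t powr - (?N * (p / 2 - 1)))"
          using nn[of t "\<lambda>_ z. ennreal (norm z powr p)"] posI[of t] t by simp
      qed
    qed
    have "(\<integral>\<^sup>+x. ennreal (norm (w t x) powr p) \<partial>lborel) \<le> ennreal (D * t powr - (?N * (p / 2 - 1)))" if t: "t > 0" for t
    proof (rule L2_limit_nn_integral_powr_le[OF w _ _ _ ae _ t])
      show "p > 0" using p by simp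
      show "integrable lborel (\<lambda>x. norm (w s x - w t x) ^ 2)" if "s > 0" for s using that t by (intro L2d posI) auto
      show "((\<lambda>s. LINT x|lborel. norm (w s x - w t x) ^ 2) \<longlongrightarrow> 0) (at t)" using t by (intro L2c posI) auto
      show "isCont (\<lambda>t. D * t powr - (?N * (p / 2 - 1))) t" using t by (intro continuous_intros) auto
    qed
    moreover have "D \<ge> 0" by (simp add: D_def)
    ultimately show ?thesis by blast
  qed
  \<comment> \<open>At p = 2 the power of t has exponent 0, so the decay estimate becomes a uniform
    bound on the mass.\<close>
  have "ennreal 2 < sobolev_exponent DIM('a)" using two_less_sobolev_exponent by simp
  from Lp[OF order.refl this] obtain M where M: "M \<ge> 0" "\<And>t. t > 0 \<Longrightarrow> (\<integral>\<^sup>+x. ennreal (norm (w t x) powr 2) \<partial>lborel) \<le> ennreal (M * t powr - (?N * (2 / 2 - 1)))"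
    by blast
  have "ennreal (\<alpha> + 2) < sobolev_exponent DIM('a)"
    using \<alpha>(2) \<alpha>0 by (intro subcritical_less_sobolev_exponent) auto
  from Lp[OF _ this] \<alpha>0 obtain C where C: "C \<ge> 0" "\<And>t. t > 0 \<Longrightarrow> (\<integral>\<^sup>+x. ennreal (norm (w t x) powr (\<alpha> + 2)) \<partial>lborel) \<le> ennreal (C * t powr - \<kappa>)"
    unfolding \<kappa>_def by (auto simp: field_simps)
  have Cint: "integrable lborel (\<lambda>x. norm (w t x) powr (\<alpha> + 2))" if t: "t > 0" for t
    unfolding integrable_iff_bounded using C(2)[OF t] by (auto intro: le_less_trans)
  have "decaying_nls w lam \<alpha> \<kappa> M C"
  proof
    show "0 < \<alpha>" by (rule \<alpha>0)
    show "1 < \<kappa>" by (rule \<kappa>)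
    show "w t \<in> borel_measurable borel" for t by (rule w)
    fix t :: real assume t: "0 < t"
    have tI: "t \<in> I" using t by (intro posI) simp
    show i: "integrable lborel (\<lambda>x. norm (w t x) ^ 2)" by (rule L2[OF tI])
    have "ennreal (LINT x|lborel. norm (w t x) ^ 2) \<le> ennreal M"
      using M(2)[OF t] t unfolding p2 by (subst (asm) nn_integral_eq_integral[OF i]) auto
    then show "(LINT x|lborel. norm (w t x) ^ 2) \<le> M" using M(1) by simp
    show "((\<lambda>s. LINT x|lborel. norm (w s x - w t x) ^ 2) \<longlongrightarrow> 0) (at t)" by (rule L2c[OF tI])
    show j: "integrable lborel (\<lambda>x. norm (w t x) powr (\<alpha> + 2))" by (rule Cint[OF t])
    have "ennreal (LINT x|lborel. norm (w t x) powr (\<alpha> + 2)) \<le> ennreal (C * t powr - \<kappa>)"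
      using C(2)[OF t] by (subst (asm) nn_integral_eq_integral[OF j]) auto
    then show "(LINT x|lborel. norm (w t x) powr (\<alpha> + 2)) \<le> C * t powr - \<kappa>" using C(1) by simp
  next
    fix \<psi> :: "real \<times> 'a \<Rightarrow> complex" assume \<psi>: "test_function ({0<..} \<times> UNIV) \<psi>"
    have "{0<..} \<subseteq> I" using I(2) by auto
    then have "test_function (I \<times> UNIV) \<psi>" using \<psi> unfolding test_function_def by blast
    then have eq: "(\<integral>t. (\<integral>x. - \<i> * u t x * time_deriv \<psi> (t, x) + u t x * space_laplacian \<psi> (t, x)
                 + of_real lam * (of_real (norm (u t x) powr \<alpha>) * u t x) * \<psi> (t, x) \<partial>lebesgue) \<partial>lebesgue) = 0"
      using dist unfolding nls_distributional_def by blast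
    note [measurable] = test_function_derivs_measurable[OF \<psi>]
    have [measurable]: "nonlinearity \<alpha> \<in> borel_measurable borel"
      by (intro borel_measurable_continuous_onI continuous_nonlinearity \<alpha>0)
    show "(LINT t|lebesgue. LINT x|lborel. - \<i> * w t x * time_deriv \<psi> (t, x) + w t x * space_laplacian \<psi> (t, x)
                 + of_real lam * nonlinearity \<alpha> (w t x) * \<psi> (t, x)) = 0"
      unfolding eq[symmetric]
    proof (rule Bochner_Integration.integral_cong[OF refl])
      fix t :: real
      show "(LINT x|lborel. - \<i> * w t x * time_deriv \<psi> (t, x) + w t x * space_laplacian \<psi> (t, x) + of_real lam * nonlinearity \<alpha> (w t x) * \<psi> (t, x))
         = (\<integral>x. - \<i> * u t x * time_deriv \<psi> (t, x) + u t x * space_laplacian \<psi> (t, x)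
                 + of_real lam * (of_real (norm (u t x) powr \<alpha>) * u t x) * \<psi> (t, x) \<partial>lebesgue)"
      proof (cases "t > 0")
        case True
        then have tI: "t \<in> I" by (intro posI) simp
        let ?F = "\<lambda>v x. - \<i> * v x * time_deriv \<psi> (t, x) + v x * space_laplacian \<psi> (t, x) + of_real lam * nonlinearity \<alpha> (v x) * \<psi> (t, x)"
        have m: "?F (w t) \<in> borel_measurable lborel" by measurable
        have mu: "?F (u t) \<in> borel_measurable lebesgue"
        proof -
          note [measurable] = um[OF tI]
          have [measurable]: "(\<lambda>x. \<psi> (t, x)) \<in> borel_measurable lebesgue" "(\<lambda>x. time_deriv \<psi> (t, x)) \<in> borel_measurable lebesgue"
            "(\<lambda>x. space_laplacian \<psi> (t, x)) \<in> borel_measurable lebesgue"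
            using test_function_derivs_measurable[OF \<psi>] by (auto intro: measurable_completion)
          show ?thesis by measurable
        qed
        have "(LINT x|lborel. ?F (w t) x) = (LINT x|lebesgue. ?F (w t) x)"
          by (rule integral_completion[symmetric, OF m])
        also have "\<dots> = (LINT x|lebesgue. ?F (u t) x)"
        proof (rule integral_cong_AE)
          show "?F (w t) \<in> borel_measurable lebesgue" using m by (rule measurable_completion)
          show "?F (u t) \<in> borel_measurable lebesgue" by (rule mu)
          show "AE x in lebesgue. ?F (w t) x = ?F (u t) x"
            unfolding AE_completion_iff using uw[OF tI] by eventually_elim simp
        qed
        finally show ?thesis by (simp add: nonlinearity_def)
      next
        case False
        \<comment> \<open>The test function lives on positive times, so for t \<le> 0 both inner
          integrands vanish and the two double integrals agree.\<close>
        have "(t, x) \<notin> closure {z. \<psi> z \<noteq> 0}" for x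
          using \<psi> False unfolding test_function_def by auto
        note z = test_function_derivs_zero[OF this]
        show ?thesis unfolding z by simp
      qed
    qed
  qed
  moreover have "((\<lambda>s. LINT x|lborel. norm (w s x - w 0 x) ^ 2) \<longlongrightarrow> 0) (at_right 0)"
    using L2c[OF posI[of 0]] by (auto intro: filterlim_mono at_le)
  moreover have "integrable lborel (\<lambda>x. norm (w 0 x) ^ 2)" by (rule L2[OF posI]) simp
  ultimately show ?thesis using that um uw posI by blast
qed

text \<open>If the mass vanished at all positive times, the L^2 distance to the initial value would
  be constantly the norm of that value, contradicting continuity at 0.\<close>

lemma (in decaying_nls) exists_time_positive_mass:
  assumes int: "integrable lborel (\<lambda>x. norm (u 0 x) ^ 2)"
    and lim: "((\<lambda>s. LINT x|lborel. norm (u s x - u 0 x) ^ 2) \<longlongrightarrow> 0) (at_right 0)"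
    and nz: "\<not> (AE x in lborel. u 0 x = 0)"
  shows "\<exists>t>0. 0 < (LINT x|lborel. norm (u t x) ^ 2)"
proof (rule ccontr)
  assume H: "\<not> ?thesis"
  have 0: "(LINT x|lborel. norm (u t x) ^ 2) = 0" if "t > 0" for t
  proof (rule antisym)
    show "(LINT x|lborel. norm (u t x) ^ 2) \<le> 0" using H that not_less by blast
  qed simp
  have "(LINT x|lborel. norm (u s x - u 0 x) ^ 2) = (LINT x|lborel. norm (u 0 x) ^ 2)" if s: "s > 0" for s
  proof (rule integral_cong_AE)
    have "AE x in lborel. norm (u s x) ^ 2 = 0"
      using 0[OF s] integral_nonneg_eq_0_iff_AE[OF integrable_L2[OF s]] by simp
    then show "AE x in lborel. norm (u s x - u 0 x) ^ 2 = norm (u 0 x) ^ 2" by eventually_elim simp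
  qed measurable
  then have "\<forall>\<^sub>F s in at_right 0. (LINT x|lborel. norm (u s x - u 0 x) ^ 2) = (LINT x|lborel. norm (u 0 x) ^ 2)"
    by (intro eventually_at_rightI[of 0 1]) auto
  from tendsto_eventually[OF this] have "(LINT x|lborel. norm (u 0 x) ^ 2) = 0"
    using lim by (rule tendsto_unique[OF trivial_limit_at_right_real])
  then have "AE x in lborel. norm (u 0 x) ^ 2 = 0"
    using integral_nonneg_eq_0_iff_AE[OF int] by simp
  then have "AE x in lborel. u 0 x = 0" by eventually_elim simp
  with nz show False by simp
qed

theorem theorem3p1:
  fixes N :: nat and lam \<alpha> :: real
    and \<phi> :: "real ^ 'n \<Rightarrow> complex"
    and u :: "real \<Rightarrow> real ^ 'n \<Rightarrow> complex"
    and Tm Tp :: ereal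
  assumes "N = CARD('n)"
    and "lam \<noteq> 0"
    and "(if N = 1 then 2 else 4 / (real N + 2)) < \<alpha>" and "\<alpha> \<le> 4 / real N"
    and "in_Lp 2 \<phi>" and "\<not> (AE x in lebesgue. \<phi> x = 0)"
    and "nls_maximal_solution lam \<alpha> \<phi> Tm Tp u"
    and "\<alpha> = 4 / real N \<Longrightarrow> Tp = \<infinity>"
    and "\<And>r. 2 \<le> r \<Longrightarrow> r < sobolev_exponent N \<Longrightarrow>
           \<exists>C::real. AE t in lebesgue. 0 < t \<longrightarrow>
             ereal t < Tp \<and> Lp_norm r (u t) \<le> ennreal (C * \<bar>t\<bar> powr (- decay_rate N r))"
  shows "\<forall>r::ennreal. 2 \<le> r \<longrightarrow>
           0 < Liminf at_top (\<lambda>t::real. ennreal (\<bar>t\<bar> powr decay_rate N r) * Lp_norm r (u t))"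
proof -
  have N: "N = DIM(real ^ 'n)" using assms(1) by simp
  \<comment> \<open>The decay estimate includes that almost every positive time lies below
    \<open>Tp\<close>; such times exist beyond any given \<open>s\<close>.\<close>
  have Tp: "ereal s < Tp" for s
  proof -
    obtain C where "AE t in lebesgue. 0 < t \<longrightarrow> ereal t < Tp \<and> Lp_norm 2 (u t) \<le> ennreal (C * \<bar>t\<bar> powr (- decay_rate N 2))"
      using assms(9)[OF order.refl two_less_sobolev_exponent] by blast
    from AE_lebesgue_dense[OF this, of "max s 0" "max s 0 + 1"] obtain t where "max s 0 < t" "0 < t \<longrightarrow> ereal t < Tp"
      by auto
    then have "ereal s < ereal t" "ereal t < Tp" by auto
    then show ?thesis by (rule less_trans)
  qed
  have sol: "nls_solution lam \<alpha> \<phi> (einterval (- Tm) Tp) u" and Tm: "0 < Tm"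
    using assms(7) by (auto simp: nls_maximal_solution_def)
  have "- Tm < ereal t" if "0 \<le> t" for t
    using Tm that by (cases Tm) auto
  then have I: "{0..} \<subseteq> einterval (- Tm) Tp" using Tp by (auto simp: einterval_iff)
  have decay: "\<exists>C::real. AE t in lebesgue. 0 < t \<longrightarrow> Lp_norm r (u t) \<le> ennreal (C * \<bar>t\<bar> powr (- decay_rate N r))"
    if r: "2 \<le> r" "r < sobolev_exponent N" for r
  proof -
    obtain C where "AE t in lebesgue. 0 < t \<longrightarrow> ereal t < Tp \<and> Lp_norm r (u t) \<le> ennreal (C * \<bar>t\<bar> powr (- decay_rate N r))"
      using assms(9)[OF r] by blast
    then have "AE t in lebesgue. 0 < t \<longrightarrow> Lp_norm r (u t) \<le> ennreal (C * \<bar>t\<bar> powr (- decay_rate N r))"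
      by eventually_elim simp
    then show ?thesis by blast
  qed
  obtain w \<kappa> M C where w: "decaying_nls w lam \<alpha> \<kappa> M C"
    and um: "\<And>t. 0 \<le> t \<Longrightarrow> u t \<in> borel_measurable lebesgue"
    and uw: "\<And>t. 0 \<le> t \<Longrightarrow> AE x in lborel. u t x = w t x"
    and w0: "integrable lborel (\<lambda>x. norm (w 0 x) ^ 2)"
      "((\<lambda>s. LINT x|lborel. norm (w s x - w 0 x) ^ 2) \<longlongrightarrow> 0) (at_right 0)"
  proof (rule decaying_nls_of_solution[OF assms(3)[unfolded N] assms(4)[unfolded N] sol open_einterval I])
    show "\<exists>C::real. AE t in lebesgue. 0 < t \<longrightarrow> Lp_norm r (u t) \<le> ennreal (C * \<bar>t\<bar> powr (- decay_rate DIM(real ^ 'n) r))"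
      if "2 \<le> r" "r < sobolev_exponent DIM(real ^ 'n)" for r
      using decay[of r] that unfolding N by blast
  qed (rule that)
  interpret decaying_nls w lam \<alpha> \<kappa> M C by (rule w)
  have "\<not> (AE x in lborel. w 0 x = 0)"
  proof
    assume "AE x in lborel. w 0 x = 0"
    moreover have "AE x in lborel. u 0 x = \<phi> x" using sol by (simp add: nls_solution_def AE_completion_iff)
    ultimately have "AE x in lborel. \<phi> x = 0" using uw[OF order.refl] by eventually_elim simp
    then show False using assms(6) by (simp add: AE_completion_iff)
  qed
  then obtain t0 where t0: "t0 > 0" "0 < (LINT x|lborel. norm (w t0 x) ^ 2)"
    using exists_time_positive_mass[OF w0] by blast
  obtain \<rho> c where \<rho>: "\<rho> > 0" and c: "c > 0"
    and mass: "\<And>t. t \<ge> t0 \<Longrightarrow> c \<le> (LINT x|lborel. indicator (cball 0 (\<rho> * t)) x * norm (w t x) ^ 2)"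
    using mass_in_cone[OF t0] by blast
  show ?thesis
  proof (intro allI impI)
    fix r :: ennreal assume r: "2 \<le> r"
    define V where "V = unit_ball_vol DIM(real ^ 'n) * \<rho> ^ DIM(real ^ 'n)"
    have V: "V > 0" using \<rho> by (simp add: V_def)
    \<comment> \<open>Depends on \<open>r\<close>, on the mass \<open>c\<close> and on the opening
      of the cone, but not on t, so it bounds the lower limit.\<close>
    define K where "K = (if r = \<infinity> then sqrt (c / V) else ((c / 2) * (c / (2 * V)) powr (enn2real r / 2 - 1)) powr (1 / enn2real r))"
    have K: "K > 0" using c V by (simp add: K_def)
    have "\<forall>\<^sub>F t in at_top. ennreal K \<le> ennreal (\<bar>t\<bar> powr decay_rate N r) * Lp_norm r (u t)"
      using eventually_ge_at_top[of t0]
    proof eventually_elim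
      case (elim t)
      then have t: "t > 0" using t0 by simp
      have "integrable lborel (\<lambda>x. indicator (cball 0 (\<rho> * t)) x * norm (w t x) ^ 2)"
      proof (rule Bochner_Integration.integrable_bound[OF integrable_L2[OF t]])
        show "(\<lambda>x. indicator (cball 0 (\<rho> * t)) x * norm (w t x) ^ 2) \<in> borel_measurable lborel"
          by (intro borel_measurable_times borel_measurable_indicator) auto
      qed (auto simp: indicator_def)
      then have "ennreal c \<le> (\<integral>\<^sup>+x. ennreal (indicator (cball 0 (\<rho> * t)) x * norm (w t x) ^ 2) \<partial>lborel)"
        using mass[OF elim] by (subst nn_integral_eq_integral) (auto intro: ennreal_leI)
      also have "\<dots> = (\<integral>\<^sup>+x. indicator (cball 0 (\<rho> * t)) x * ennreal (norm (w t x) ^ 2) \<partial>lborel)"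
        by (intro nn_integral_cong) (simp add: indicator_def)
      finally show ?case
        unfolding K_def V_def N using t
        by (intro Lp_norm_lower_bound[OF um measurable_u uw c t \<rho> _ r]) auto
    qed
    then have "ennreal K \<le> Liminf at_top (\<lambda>t. ennreal (\<bar>t\<bar> powr decay_rate N r) * Lp_norm r (u t))"
      by (rule Liminf_bounded)
    moreover have "0 < ennreal K" using K by simp
    ultimately show "0 < Liminf at_top (\<lambda>t. ennreal (\<bar>t\<bar> powr decay_rate N r) * Lp_norm r (u t))"
      by (rule less_le_trans[rotated])
  qed
qed

end
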